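(* Let $E^{n.n}$ be an odd symplectic superspace and let ${\bf s}$ be a semidensity on it. Define $\Delta^{\#}{\bf s}$ by the following rule: if $z^A=(x^1,\dots,x^n,\theta_1,\dots,\theta_n)$ are Darboux coordinates and ${\bf s}=s(z)|dz|^{1/2}$ in these coordinates, then $$\Delta^{\#}{\bf s}=\sum_{i=1}^n\frac{\partial^2 s}{\partial x^i\partial\theta_i}\,|dx\,d\theta|^{1/2}.$$ Then $\Delta^{\#}{\bf s}$ is a well-defined semidensity, i.e. it does not depend on the choice of Darboux coordinates: if $\tilde z=(\tilde x^1,\dots,\tilde x^n,\tilde\theta_1,\dots,\tilde\theta_n)$ are other Darboux coordinates, then $$\left(\sum_{i=1}^n\frac{\partial^2 s(z)}{\partial x^i\partial\theta_i}\right)_{z=z(\tilde z)}\cdot\left(\mathrm{Ber}\,\frac{\partial z(\tilde z)}{\partial\tilde z}\right)^{1/2}=\sum_{i=1}^n\frac{\partial^2}{\partial\tilde x^i\partial\tilde\theta_i}\left(s(z(\tilde z))\cdot\left(\mathrm{Ber}\,\frac{\partial z(\tilde z)}{\partial\tilde z}\right)^{1/2}\right).$$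
   Context: $E^{n.n}$ is a superspace with $n$ even coordinates and $n$ odd coordinates (points are $\Lambda$-points, $\Lambda$ an arbitrary Grassmann algebra, so functions may have coefficients in $\Lambda$). It is an odd symplectic superspace if it is endowed with an odd closed non-degenerate two-form $\Omega=\Omega_{AB}(z)dz^Adz^B$. The corresponding odd Poisson (Buttin) bracket is $\{f,g\}=\frac{\partial f}{\partial z^A}(-1)^{p(f)p(A)+p(A)}\Omega^{AB}\frac{\partial g}{\partial z^B}$, where $p$ is parity, $p(A)=p(z^A)$, $\Omega^{AB}=\{z^A,z^B\}$ is the inverse matrix of $\Omega_{AB}$. Darboux coordinates are coordinates $x^1,\dots,x^n$ (even), $\theta_1,\dots,\theta_n$ (odd) with $\{x^i,x^j\}=0$, $\{\theta_i,\theta_j\}=0$, $\{x^i,\theta_j\}=\delta^i_j$. A density of weight $\sigma$ is an object given in local coordinates by a function which is multiplied by the $\sigma$-th power of the Berezinian (superdeterminant) of the coordinate transformation under a change of coordinates; a semidensity is a density of weight $\sigma=1/2$, written ${\bf s}=s(z)|dz|^{1/2}$. Here $\mathrm{Ber}\begin{pmatrix}A&B\\ C&D\end{pmatrix}=\det(A-BD^{-1}C)/\det D$. *)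

theory Defs
  imports "HOL-Analysis.Analysis" "HOL-Combinatorics.Permutations"
begin

section \<open>Grassmann algebras\<close>

text \<open>
  The real Grassmann algebra on a linearly ordered set \<open>'g\<close> of anticommuting generators.
  An element is the family of its coefficients with respect to the monomials
  \<open>e\<^sub>S = e\<^bsub>g1\<^esub> \<cdots> e\<^bsub>gk\<^esub>\<close> with \<open>S = {g1 < \<dots> < gk}\<close>.
  For infinite \<open>'g\<close> infinite sums of monomials are admitted; the subalgebra of finite sums is closed
  under all operations below.
\<close>

typedef 'g grass = "{f :: 'g set \<Rightarrow> real. \<forall>S. infinite S \<longrightarrow> f S = 0}"
  morphisms coeff Abs_grass
  by (rule exI[of _ "\<lambda>_. 0"]) simp

setup_lifting type_definition_grass

lemma grass_eqI: "(\<And>S. finite S \<Longrightarrow> coeff a S = coeff b S) \<Longrightarrow> a = b"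
  by transfer (rule ext, metis)

text \<open>\<open>e\<^sub>S e\<^sub>T = gsign S T e\<^bsub>S \<union> T\<^esub>\<close> for disjoint \<open>S\<close> and \<open>T\<close>.\<close>

definition gsign :: "'g::linorder set \<Rightarrow> 'g set \<Rightarrow> real"
  where "gsign S T = (- 1) ^ card {(s, t). s \<in> S \<and> t \<in> T \<and> t < s}"

lemma gsign_empty [simp]: "gsign {} T = 1" "gsign S {} = 1"
  by (simp_all add: gsign_def)

lemma gsign_Un_left:
  assumes "finite A" "finite B" "finite C" "A \<inter> B = {}"
  shows "gsign (A \<union> B) C = gsign A C * gsign B C"
proof -
  let ?P = "\<lambda>X Y. {(s, t). s \<in> X \<and> t \<in> Y \<and> t < s}"
  have fin: "finite (?P X Y)" if "finite X" "finite Y" for X Y :: "'a set"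
    by (rule finite_subset[of _ "X \<times> Y"]) (use that in auto)
  have "?P (A \<union> B) C = ?P A C \<union> ?P B C" by auto
  moreover have "?P A C \<inter> ?P B C = {}" using assms(4) by auto
  ultimately have "card (?P (A \<union> B) C) = card (?P A C) + card (?P B C)"
    using fin assms by (simp add: card_Un_disjoint)
  then show ?thesis by (simp add: gsign_def power_add)
qed

lemma gsign_Un_right:
  assumes "finite A" "finite B" "finite C" "B \<inter> C = {}"
  shows "gsign A (B \<union> C) = gsign A B * gsign A C"
proof -
  let ?P = "\<lambda>X Y. {(s, t). s \<in> X \<and> t \<in> Y \<and> t < s}"
  have fin: "finite (?P X Y)" if "finite X" "finite Y" for X Y :: "'a set"
    by (rule finite_subset[of _ "X \<times> Y"]) (use that in auto)
  have "?P A (B \<union> C) = ?P A B \<union> ?P A C" by auto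
  moreover have "?P A B \<inter> ?P A C = {}" using assms(4) by auto
  ultimately have "card (?P A (B \<union> C)) = card (?P A B) + card (?P A C)"
    using fin assms by (simp add: card_Un_disjoint)
  then show ?thesis by (simp add: gsign_def power_add)
qed

instantiation grass :: (linorder) real_algebra_1
begin

lift_definition zero_grass :: "'a grass" is "\<lambda>_. 0" by simp
lift_definition one_grass :: "'a grass" is "\<lambda>S. if S = {} then 1 else 0" by auto
lift_definition plus_grass :: "'a grass \<Rightarrow> 'a grass \<Rightarrow> 'a grass" is "\<lambda>a b S. a S + b S" by simp
lift_definition minus_grass :: "'a grass \<Rightarrow> 'a grass \<Rightarrow> 'a grass" is "\<lambda>a b S. a S - b S" by simp
lift_definition uminus_grass :: "'a grass \<Rightarrow> 'a grass" is "\<lambda>a S. - a S" by simp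
lift_definition scaleR_grass :: "real \<Rightarrow> 'a grass \<Rightarrow> 'a grass" is "\<lambda>c a S. c * a S" by simp
lift_definition times_grass :: "'a grass \<Rightarrow> 'a grass \<Rightarrow> 'a grass"
  is "\<lambda>a b S. \<Sum>T\<in>Pow S. gsign T (S - T) * a T * b (S - T)"
  by (simp add: finite_Pow_iff)

lemma times_grass_assoc: "(a * b) * c = a * (b * c)" for a b c :: "'a grass"
proof (rule grass_eqI)
  fix S :: "'a set"
  assume S: "finite S"
  define h where "h U V = gsign U V * gsign U (S - U - V) * gsign V (S - U - V)
      * coeff a U * coeff b V * coeff c (S - U - V)" for U V
  have fin: "finite U" if "U \<subseteq> S" for U using S that finite_subset by blast
  have l: "gsign T (S - T) * (gsign U (T - U) * coeff a U * coeff b (T - U)) * coeff c (S - T)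
      = h U (T - U)" if "T \<subseteq> S" "U \<subseteq> T" for T U
  proof -
    have "gsign (U \<union> (T - U)) (S - T) = gsign U (S - T) * gsign (T - U) (S - T)"
      using that by (intro gsign_Un_left fin) auto
    moreover have "U \<union> (T - U) = T" "S - U - (T - U) = S - T" using that by auto
    ultimately show ?thesis by (simp add: h_def)
  qed
  have r: "gsign U (S - U) * coeff a U * (gsign V (S - U - V) * coeff b V * coeff c (S - U - V))
      = h U V" if "U \<subseteq> S" "V \<subseteq> S - U" for U V
  proof -
    have "gsign U (V \<union> (S - U - V)) = gsign U V * gsign U (S - U - V)"
      using that by (intro gsign_Un_right fin) auto
    moreover have "V \<union> (S - U - V) = S - U" using that by auto
    ultimately show ?thesis by (simp add: h_def)
  qed
  have "coeff ((a * b) * c) S = (\<Sum>T\<in>Pow S. \<Sum>U\<in>Pow T. h U (T - U))"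
    by (simp add: times_grass.rep_eq sum_distrib_left sum_distrib_right l)
  also have "\<dots> = (\<Sum>(T, U)\<in>(SIGMA T:Pow S. Pow T). h U (T - U))"
    by (rule sum.Sigma) (use S fin in \<open>simp_all\<close>)
  also have "\<dots> = (\<Sum>(U, V)\<in>(SIGMA U:Pow S. Pow (S - U)). h U V)"
    by (rule sum.reindex_bij_witness[of _ "\<lambda>(U, V). (U \<union> V, U)" "\<lambda>(T, U). (U, T - U)"]) auto
  also have "\<dots> = (\<Sum>U\<in>Pow S. \<Sum>V\<in>Pow (S - U). h U V)"
    by (rule sum.Sigma[symmetric]) (use S in \<open>simp_all\<close>)
  also have "\<dots> = coeff (a * (b * c)) S"
    by (simp add: times_grass.rep_eq sum_distrib_left r)
  finally show "coeff ((a * b) * c) S = coeff (a * (b * c)) S" .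
qed

lemma one_grass_mult: "1 * a = a" for a :: "'a grass"
proof (rule grass_eqI)
  fix S :: "'a set"
  assume S: "finite S"
  have "coeff (1 * a) S = (\<Sum>T\<in>Pow S. if T = {} then coeff a S else 0)"
    unfolding times_grass.rep_eq one_grass.rep_eq by (intro sum.cong) auto
  also have "\<dots> = coeff a S" using S by (simp add: sum.delta)
  finally show "coeff (1 * a) S = coeff a S" .
qed

lemma mult_one_grass: "a * 1 = a" for a :: "'a grass"
proof (rule grass_eqI)
  fix S :: "'a set"
  assume S: "finite S"
  have "coeff (a * 1) S = (\<Sum>T\<in>Pow S. if T = S then coeff a S else 0)"
    unfolding times_grass.rep_eq one_grass.rep_eq by (intro sum.cong) auto
  also have "\<dots> = coeff a S" using S by (simp add: sum.delta)
  finally show "coeff (a * 1) S = coeff a S" .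
qed

instance
proof
  fix a b c :: "'a grass" and x y :: real
  show "a * b * c = a * (b * c)" by (rule times_grass_assoc)
  show "1 * a = a" by (rule one_grass_mult)
  show "a * 1 = a" by (rule mult_one_grass)
  show "(a + b) * c = a * c + b * c"
    by (transfer, rule ext) (simp add: algebra_simps sum.distrib)
  show "a * (b + c) = a * b + a * c"
    by (transfer, rule ext) (simp add: algebra_simps sum.distrib)
  show "(x *\<^sub>R a) * b = x *\<^sub>R (a * b)"
    by (transfer, rule ext) (simp add: sum_distrib_left mult_ac)
  show "a * (x *\<^sub>R b) = x *\<^sub>R (a * b)"
    by (transfer, rule ext) (simp add: sum_distrib_left mult_ac)
  show "(0::'a grass) \<noteq> 1" by transfer (metis zero_neq_one)
qed (transfer; auto simp: algebra_simps fun_eq_iff)+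

end

definition gen :: "'g \<Rightarrow> 'g grass"
  where "gen g = Abs_grass (\<lambda>S. if S = {g} then 1 else 0)"

definition body :: "'g grass \<Rightarrow> real"
  where "body a = coeff a {}"

definition soul :: "'g::linorder grass \<Rightarrow> 'g grass"
  where "soul a = a - of_real (body a)"

text \<open>Parities are natural numbers modulo 2.\<close>

definition has_parity :: "nat \<Rightarrow> 'g grass \<Rightarrow> bool"
  where "has_parity p a \<longleftrightarrow> (\<forall>S. coeff a S \<noteq> 0 \<longrightarrow> card S mod 2 = p mod 2)"

definition parity_part :: "nat \<Rightarrow> 'g grass \<Rightarrow> 'g grass"
  where "parity_part p a = Abs_grass (\<lambda>S. if card S mod 2 = p mod 2 then coeff a S else 0)"

definition ginv :: "'g::linorder grass \<Rightarrow> 'g grass"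
  where "ginv a = (SOME b. a * b = 1 \<and> b * a = 1)"

text \<open>
  For even \<open>a\<close> with \<open>body a \<noteq> 0\<close> this is \<open>\<bar>a\<bar>\<^sup>\<sigma>\<close>, that is the binomial series
  \<open>\<bar>body a\<bar>\<^sup>\<sigma> (1 + soul a / body a)\<^sup>\<sigma>\<close>; it is the ordinary power if \<open>body a > 0\<close>, as for
  the Berezinian of a change of Darboux coordinates. A coefficient at \<open>S\<close> receives no contribution
  from products of more than \<open>card S\<close> souls.
\<close>

definition gpowr :: "real \<Rightarrow> 'g::linorder grass \<Rightarrow> 'g grass"
  where "gpowr \<sigma> a = Abs_grass (\<lambda>S. if finite S then
     coeff (\<Sum>k\<le>card S. ((\<sigma> gchoose k) * \<bar>body a\<bar> powr \<sigma>) *\<^sub>R ((1 / body a) *\<^sub>R soul a) ^ k) S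
     else 0)"


section \<open>Matrices over a Grassmann algebra and the Berezinian\<close>

definition is_matrix_inverse ::
  "('k::finite \<Rightarrow> 'k \<Rightarrow> 'g::linorder grass) \<Rightarrow> ('k \<Rightarrow> 'k \<Rightarrow> 'g grass) \<Rightarrow> bool"
  where "is_matrix_inverse M N \<longleftrightarrow>
    (\<forall>i j. (\<Sum>k\<in>UNIV. M i k * N k j) = (if i = j then 1 else 0)) \<and>
    (\<forall>i j. (\<Sum>k\<in>UNIV. N i k * M k j) = (if i = j then 1 else 0))"

definition gmatrix_inv ::
  "('k::finite \<Rightarrow> 'k \<Rightarrow> 'g::linorder grass) \<Rightarrow> ('k \<Rightarrow> 'k \<Rightarrow> 'g grass)"
  where "gmatrix_inv M = (SOME N. is_matrix_inverse M N)"

text \<open>The Leibniz formula; for the matrices with even entries to which it is applied the order of the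
  factors is irrelevant.\<close>

definition gdet :: "('n::{finite,linorder} \<Rightarrow> 'n \<Rightarrow> 'g::linorder grass) \<Rightarrow> 'g grass"
  where "gdet M = (\<Sum>p | p permutes UNIV.
    of_int (sign p) * prod_list (map (\<lambda>i. M i (p i)) (sorted_list_of_set UNIV)))"

text \<open>Rows and columns are indexed by \<open>'n + 'n\<close>: even indices \<open>Inl i\<close>, odd indices \<open>Inr i\<close>.\<close>

definition Ber :: "('n::{finite,linorder} + 'n \<Rightarrow> 'n + 'n \<Rightarrow> 'g::linorder grass) \<Rightarrow> 'g grass"
  where "Ber M =
    (let A = (\<lambda>i j. M (Inl i) (Inl j)); B = (\<lambda>i j. M (Inl i) (Inr j));
         C = (\<lambda>i j. M (Inr i) (Inl j)); D = (\<lambda>i j. M (Inr i) (Inr j));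
         D' = gmatrix_inv D
     in gdet (\<lambda>i j. A i j - (\<Sum>k\<in>UNIV. \<Sum>l\<in>UNIV. B i k * D' k l * C l j)) * ginv (gdet D))"


section \<open>Superfunctions\<close>

text \<open>The generators \<open>Theta i\<close> are the odd coordinates, the \<open>Xi l\<close> generate the Grassmann algebra
  \<open>\<Lambda>\<close> of coefficients.\<close>

datatype ('n, 'l) gen = Theta 'n | Xi 'l

instantiation gen :: (linorder, linorder) linorder
begin

fun less_eq_gen :: "('a, 'b) gen \<Rightarrow> ('a, 'b) gen \<Rightarrow> bool" where
  "less_eq_gen (Theta i) (Theta j) = (i \<le> j)"
| "less_eq_gen (Theta i) (Xi l) = True"
| "less_eq_gen (Xi l) (Theta i) = False"
| "less_eq_gen (Xi l) (Xi m) = (l \<le> m)"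

definition less_gen :: "('a, 'b) gen \<Rightarrow> ('a, 'b) gen \<Rightarrow> bool"
  where "less_gen a b \<longleftrightarrow> a \<le> b \<and> \<not> b \<le> a"

instance
proof
  fix x y z :: "('a, 'b) gen"
  show "(x < y) = (x \<le> y \<and> \<not> y \<le> x)" by (rule less_gen_def)
  show "x \<le> x" by (cases x) auto
  show "x \<le> y \<Longrightarrow> y \<le> z \<Longrightarrow> x \<le> z" by (cases x; cases y; cases z) auto
  show "x \<le> y \<Longrightarrow> y \<le> x \<Longrightarrow> x = y" by (cases x; cases y) auto
  show "x \<le> y \<or> y \<le> x" by (cases x; cases y) auto
qed

end

text \<open>
  A superfunction \<open>f(x, \<theta>) = \<Sum>\<^sub>S f\<^sub>S(x) e\<^sub>S\<close> with coefficients in \<open>\<Lambda>\<close> assigns to the underlying point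
  \<open>x\<close> the Grassmann polynomial \<open>f x\<close> in the \<open>\<theta>\<^sub>i\<close> and the generators of \<open>\<Lambda>\<close>.
\<close>

type_synonym ('n, 'l) sfun = "real ^ 'n \<Rightarrow> ('n, 'l) gen grass"

definition pd :: "'n \<Rightarrow> (real ^ 'n::finite \<Rightarrow> real) \<Rightarrow> (real ^ 'n \<Rightarrow> real)"
  where "pd i h = (\<lambda>x. frechet_derivative h (at x) (axis i 1))"

fun iter_pd :: "'n list \<Rightarrow> (real ^ 'n::finite \<Rightarrow> real) \<Rightarrow> (real ^ 'n \<Rightarrow> real)" where
  "iter_pd [] h = h"
| "iter_pd (i # is) h = pd i (iter_pd is h)"

definition smooth_fun :: "(real ^ 'n::finite) set \<Rightarrow> (real ^ 'n \<Rightarrow> real) \<Rightarrow> bool"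
  where "smooth_fun U h \<longleftrightarrow> (\<forall>is. \<forall>x\<in>U. iter_pd is h differentiable (at x))"

definition smooth_sfun :: "(real ^ 'n::finite) set \<Rightarrow> ('n, 'l) sfun \<Rightarrow> bool"
  where "smooth_sfun U f \<longleftrightarrow> (\<forall>S. smooth_fun U (\<lambda>x. coeff (f x) S))"

text \<open>Coordinates are indexed by \<open>'n + 'n\<close>: \<open>Inl i\<close> stands for \<open>x\<^sup>i\<close> and \<open>Inr i\<close> for \<open>\<theta>\<^sub>i\<close>.\<close>

fun cpar :: "'n + 'n \<Rightarrow> nat" where
  "cpar (Inl i) = 0"
| "cpar (Inr i) = 1"

fun coord :: "'n + 'n \<Rightarrow> ('n::{finite,linorder}, 'l::linorder) sfun" where
  "coord (Inl i) = (\<lambda>x. of_real (x $ i))"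
| "coord (Inr i) = (\<lambda>x. gen (Theta i))"

definition odd_pd :: "'n \<Rightarrow> ('n::linorder, 'l::linorder) gen grass \<Rightarrow> ('n, 'l) gen grass"
  where "odd_pd i a = Abs_grass (\<lambda>S. if Theta i \<in> S then 0
     else gsign {Theta i} S * coeff a (insert (Theta i) S))"

text \<open>All derivatives are left derivatives.\<close>

fun sder :: "'n + 'n \<Rightarrow> ('n::{finite,linorder}, 'l::linorder) sfun \<Rightarrow> ('n, 'l) sfun" where
  "sder (Inl i) f = (\<lambda>x. Abs_grass (\<lambda>S. pd i (\<lambda>y. coeff (f y) S) x))"
| "sder (Inr i) f = (\<lambda>x. odd_pd i (f x))"


section \<open>Substitution and changes of coordinates\<close>

definition pt_body :: "('n + 'n \<Rightarrow> 'g grass) \<Rightarrow> real ^ 'n::finite"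
  where "pt_body X = (\<chi> i. body (X (Inl i)))"

text \<open>
  Extension of a smooth function \<open>h\<close> to even nilpotent increments of its arguments by the Taylor series
  \<open>\<Sum>\<^sub>k 1/k! \<Sum> \<partial>\<^bsub>i1\<^esub> \<cdots> \<partial>\<^bsub>ik\<^esub> h \<cdot> soul X\<^bsub>i1\<^esub> \<cdots> soul X\<^bsub>ik\<^esub>\<close>, computed coefficientwise.
\<close>

definition taylor_ext ::
  "(real ^ 'n::finite \<Rightarrow> real) \<Rightarrow> ('n + 'n \<Rightarrow> 'g::linorder grass) \<Rightarrow> 'g grass"
  where "taylor_ext h X = Abs_grass (\<lambda>R. if finite R then
     coeff (\<Sum>is | length is \<le> card R. (iter_pd is h (pt_body X) / fact (length is)) *\<^sub>R
              prod_list (map (\<lambda>i. soul (X (Inl i))) is)) R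
     else 0)"

definition subst_monomial ::
  "('n + 'n \<Rightarrow> ('n::linorder, 'l::linorder) gen grass) \<Rightarrow> ('n, 'l) gen set \<Rightarrow> ('n, 'l) gen grass"
  where "subst_monomial X S = prod_list (map
     (\<lambda>g. case g of Theta i \<Rightarrow> X (Inr i) | Xi l \<Rightarrow> gen (Xi l)) (sorted_list_of_set S))"

text \<open>
  The value of \<open>f\<close> at the coordinates \<open>X (Inl i)\<close> (even) and \<open>X (Inr i)\<close> (odd), that is
  \<open>\<Sum>\<^sub>S f\<^sub>S(X) \<cdot> X\<^sup>S\<close>. Only monomials whose generators from \<open>\<Lambda>\<close> lie in \<open>R\<close> contribute to the
  coefficient at \<open>R\<close>, so the sum for each coefficient is finite.
\<close>

definition seval ::
  "('n::{finite,linorder}, 'l::linorder) sfun \<Rightarrow> ('n + 'n \<Rightarrow> ('n, 'l) gen grass) \<Rightarrow> ('n, 'l) gen grass"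
  where "seval f X = Abs_grass (\<lambda>R. if finite R then
     coeff (\<Sum>S\<in>Pow (range Theta \<union> R). taylor_ext (\<lambda>x. coeff (f x) S) X * subst_monomial X S) R
     else 0)"

type_synonym ('n, 'l) smap = "'n + 'n \<Rightarrow> ('n, 'l) sfun"

definition at_pt :: "('n, 'l) smap \<Rightarrow> real ^ 'n \<Rightarrow> 'n + 'n \<Rightarrow> ('n, 'l) gen grass"
  where "at_pt \<phi> x = (\<lambda>A. \<phi> A x)"

definition smap_body :: "('n::finite, 'l) smap \<Rightarrow> real ^ 'n \<Rightarrow> real ^ 'n"
  where "smap_body \<phi> x = pt_body (at_pt \<phi> x)"

definition is_smap ::
  "(real ^ 'n::{finite,linorder}) set \<Rightarrow> (real ^ 'n::{finite,linorder}) set \<Rightarrow> ('n, 'l::linorder) smap \<Rightarrow> bool"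
  where "is_smap V U \<phi> \<longleftrightarrow>
    (\<forall>A. smooth_sfun V (\<phi> A) \<and> (\<forall>x\<in>V. has_parity (cpar A) (\<phi> A x))) \<and> smap_body \<phi> ` V \<subseteq> U"

definition inverse_smaps ::
  "(real ^ 'n::{finite,linorder}) set \<Rightarrow> (real ^ 'n::{finite,linorder}) set \<Rightarrow>
    ('n, 'l::linorder) smap \<Rightarrow> ('n, 'l) smap \<Rightarrow> bool"
  where "inverse_smaps V U \<phi> \<psi> \<longleftrightarrow> is_smap V U \<phi> \<and> is_smap U V \<psi> \<and>
    (\<forall>A. \<forall>x\<in>V. seval (\<psi> A) (at_pt \<phi> x) = coord A x) \<and>
    (\<forall>A. \<forall>y\<in>U. seval (\<phi> A) (at_pt \<psi> y) = coord A y)"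

text \<open>
  The superspace is described by reference coordinates \<open>w\<close> with underlying open set \<open>W\<close>. A (local)
  coordinate system is a pair \<open>(V, z)\<close> of an open \<open>V \<subseteq> W\<close> and the coordinate functions \<open>z\<^sup>A(w)\<close>.
\<close>

type_synonym ('n, 'l) chart = "(real ^ 'n) set \<times> ('n, 'l) smap"

definition chart_image :: "('n::finite, 'l) chart \<Rightarrow> (real ^ 'n) set"
  where "chart_image c = smap_body (snd c) ` fst c"

definition charts ::
  "(real ^ 'n::{finite,linorder}) set \<Rightarrow> ('n, 'l::linorder) chart set"
  where "charts W = {c. open (fst c) \<and> fst c \<subseteq> W \<and> open (chart_image c) \<and>
    (\<exists>\<psi>. inverse_smaps (fst c) (chart_image c) (snd c) \<psi>)}"

definition chart_inv :: "('n::{finite,linorder}, 'l::linorder) chart \<Rightarrow> ('n, 'l) smap"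
  where "chart_inv c = (SOME \<psi>. inverse_smaps (fst c) (chart_image c) (snd c) \<psi>)"

text \<open>For \<open>c = (V, z)\<close> and \<open>c' = (V', z')\<close> the functions \<open>z\<^sup>A(z')\<close>; they are meaningful on
  \<open>overlap c c'\<close>, the image of \<open>V \<inter> V'\<close> in the coordinates \<open>z'\<close>.\<close>

definition transition ::
  "('n::{finite,linorder}, 'l::linorder) chart \<Rightarrow> ('n, 'l) chart \<Rightarrow> ('n, 'l) smap"
  where "transition c c' = (\<lambda>A y. seval (snd c A) (at_pt (chart_inv c') y))"

definition overlap :: "('n::finite, 'l) chart \<Rightarrow> ('n, 'l) chart \<Rightarrow> (real ^ 'n) set"
  where "overlap c c' = smap_body (snd c') ` (fst c \<inter> fst c')"

text \<open>
  The rows are indexed by the differentiation variables: for left derivatives this is the arrangement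
  in which the chain rule is matrix multiplication.
\<close>

definition super_jacobian ::
  "('n::{finite,linorder}, 'l::linorder) smap \<Rightarrow> real ^ 'n::{finite,linorder} \<Rightarrow>
    'n + 'n \<Rightarrow> 'n + 'n \<Rightarrow> ('n, 'l) gen grass"
  where "super_jacobian \<phi> y = (\<lambda>A B. sder A (\<phi> B) y)"


section \<open>Densities\<close>

text \<open>
  A density on an atlas \<open>\<A>\<close> is a family of local representatives; it determines a density in all
  coordinates as soon as the charts in \<open>\<A>\<close> cover.
\<close>

definition density_on ::
  "('n::{finite,linorder}, 'l::linorder) chart set \<Rightarrow> real \<Rightarrow>
    (('n, 'l) chart \<Rightarrow> ('n, 'l) sfun) \<Rightarrow> bool"
  where "density_on \<A> \<sigma> s \<longleftrightarrow>
    (\<forall>c\<in>\<A>. smooth_sfun (chart_image c) (s c)) \<and>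
    (\<forall>c\<in>\<A>. \<forall>c'\<in>\<A>. \<forall>y\<in>overlap c c'.
       s c' y = seval (s c) (at_pt (transition c c') y)
                * gpowr \<sigma> (Ber (super_jacobian (transition c c') y)))"

abbreviation semidensity_on ::
  "('n::{finite,linorder}, 'l::linorder) chart set \<Rightarrow> (('n, 'l) chart \<Rightarrow> ('n, 'l) sfun) \<Rightarrow> bool"
  where "semidensity_on \<A> \<equiv> density_on \<A> (1 / 2)"


section \<open>Odd symplectic structure\<close>

type_synonym ('n, 'l) two_form = "'n + 'n \<Rightarrow> 'n + 'n \<Rightarrow> ('n, 'l) sfun"

text \<open>
  Sign convention for \<open>\<Omega> = \<Omega>\<^sub>A\<^sub>B dz\<^sup>A dz\<^sup>B\<close>: we have
  \<open>dz\<^sup>A dz\<^sup>B = - (-1)\<^bsup>p(A)p(B)\<^esup> dz\<^sup>B dz\<^sup>A\<close>, \<open>d\<close> is even, and the matrix \<open>\<Omega> A B\<close> holds the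
  coefficients between the differentials, \<open>\<Omega> = dz\<^sup>A \<Omega>\<^sub>A\<^sub>B dz\<^sup>B\<close> (the coefficient moved to the left
  is \<open>(-1)\<^bsup>p(A)p(B)\<^esup> \<Omega>\<^sub>A\<^sub>B\<close>). With this placement the bracket built from the inverse matrix is
  independent of the coordinates. The last but one condition is \<open>d\<Omega> = 0\<close>.
\<close>

definition odd_symplectic ::
  "(real ^ 'n::{finite,linorder}) set \<Rightarrow> ('n, 'l::linorder) two_form \<Rightarrow> bool"
  where "odd_symplectic W \<Omega> \<longleftrightarrow> open W \<and>
    (\<forall>A B. smooth_sfun W (\<Omega> A B)) \<and>
    (\<forall>x\<in>W.
      (\<forall>A B. has_parity (cpar A + cpar B + 1) (\<Omega> A B x)) \<and>
      (\<forall>A B. \<Omega> A B x = - ((- 1) ^ (cpar A * cpar B) * \<Omega> B A x)) \<and>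
      (\<forall>A B C. (- 1) ^ (cpar A * (cpar B + cpar C)) * sder C (\<Omega> A B) x
             + (- 1) ^ (cpar B * (cpar C + cpar A)) * sder A (\<Omega> B C) x
             + (- 1) ^ (cpar C * (cpar A + cpar B)) * sder B (\<Omega> C A) x = 0) \<and>
      (\<exists>N. is_matrix_inverse (\<lambda>A B. \<Omega> A B x) N))"

text \<open>The sum over \<open>p\<close> extends the formula for homogeneous \<open>f\<close> linearly to all \<open>f\<close>.\<close>

definition odd_bracket ::
  "('n::{finite,linorder}, 'l::linorder) two_form \<Rightarrow> ('n, 'l) sfun \<Rightarrow> ('n, 'l) sfun \<Rightarrow> ('n, 'l) sfun"
  where "odd_bracket \<Omega> f g = (\<lambda>x. \<Sum>p\<in>{0, 1}. \<Sum>A\<in>UNIV. \<Sum>B\<in>UNIV.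
     sder A (\<lambda>y. parity_part p (f y)) x * (- 1) ^ (p * cpar A + cpar A)
     * gmatrix_inv (\<lambda>A B. \<Omega> A B x) A B * sder B g x)"

definition darboux_charts ::
  "(real ^ 'n::{finite,linorder}) set \<Rightarrow> ('n, 'l::linorder) two_form \<Rightarrow> ('n, 'l) chart set"
  where "darboux_charts W \<Omega> = {c \<in> charts W. \<forall>w\<in>fst c. \<forall>i j.
     odd_bracket \<Omega> (snd c (Inl i)) (snd c (Inl j)) w = 0 \<and>
     odd_bracket \<Omega> (snd c (Inr i)) (snd c (Inr j)) w = 0 \<and>
     odd_bracket \<Omega> (snd c (Inl i)) (snd c (Inr j)) w = (if i = j then 1 else 0)}"

definition Delta :: "('n::{finite,linorder}, 'l::linorder) sfun \<Rightarrow> ('n, 'l) sfun"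
  where "Delta s = (\<lambda>x. \<Sum>i\<in>UNIV. sder (Inl i) (sder (Inr i) s) x)"

end

theory Submission
  imports Defs
begin

text \<open>
  A transition map \<open>z = \<phi>(y)\<close> between Darboux charts preserves the two-form
  \<open>\<Sum>\<^sub>i dx\<^sup>i d\<theta>\<^sub>i\<close>: both charts express \<open>\<Omega>\<close> by the same constant matrix, and the chain rule pulls
  this equality back along the inverse chart. Write \<open>J\<close> for the super Jacobian, with
  blocks \<open>A, B, C, D\<close>. Invariance of the form says that the inverse of \<open>J\<close> consists of the
  (signed) transposed blocks; hence the Schur complement in the Berezinian is the transposed inverse of
  \<open>D\<close>, so \<open>Ber J = (det D)\<^sup>-\<^sup>2\<close> and \<open>(Ber J)\<^sup>1\<^sup>/\<^sup>2 = \<plusminus> r\<close> with \<open>r = 1 / det D\<close>.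

  By the product and chain rules, \<open>\<Delta> (r \<cdot> F \<circ> \<phi>) = r \<cdot> (\<Delta> F) \<circ> \<phi>\<close> amounts to two identities:
  a first-order one, \<open>\<Delta> \<phi>\<^sup>A + {log r, \<phi>\<^sup>A} = 0\<close>, and \<open>\<Delta> r = 0\<close>. With
  \<open>L\<^sub>A = \<partial>\<^sub>A log r\<close> the first follows by differentiating the entries of
  \<open>J\<^sup>-\<^sup>1 J = 1\<close>. Substituting it into \<open>\<Sum>\<^sub>i \<partial>\<^sub>i L\<^sup>i\<close> gives
  \<open>2 r\<^sup>-\<^sup>1 \<Delta> r = \<Sum> \<partial>\<^sub>i \<partial>\<^sup>j \<theta>\<^sub>b \<cdot> \<partial>\<^sub>j \<partial>\<^sup>i x\<^sup>b\<close> (\<open>\<partial>\<^sup>i\<close> the odd derivatives), and this vanishes: expressed in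
  the frame \<open>J\<close>, the second derivatives form a totally (super)symmetric tensor of rank three whose complete
  contraction with itself pairs symmetric with antisymmetric indices in every term.
\<close>

section \<open>The grade involution and parity\<close>

text \<open>Two obstacles shape the argument. The algebra is not commutative and may have infinitely
  many generators: signs are handled by splitting the Jacobian into blocks of known parity,
  determinants are taken of even blocks only, and infinite sums are read coefficientwise, a
  coefficient at \<open>S\<close> seeing only terms of degree at most \<open>card S\<close>.
  Secondly, \<open>gpowr\<close> uses the absolute value of the body, so the root of
  \<open>r * r\<close> is \<open>sgn (body r)\<close> times \<open>r\<close>; this sign is locally
  constant and a differential operator does not see it. The quantity \<open>L\<close> is introduced
  by a trace formula, not as a derivative of \<open>r\<close>. The supertrace of J^-1 dJ has an even
  and an odd half, which contribute equally for a canonical map; so the root of the Berezinian needs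
  only the even half. That half involves the even vector fields d/dx^b of the target alone, whose
  Leibniz rule has no signs. The first-order identity uses nothing but this formula. The symmetry of
  the derivatives of \<open>L\<close> is visible only from \<open>r\<close>, once
  \<open>sder_r\<close> is known; \<open>laplace_log_volume\<close> therefore takes it as a
  hypothesis.\<close>

lemma coeff_infinite: "infinite S \<Longrightarrow> coeff a S = 0"
  by transfer auto

lemma coeff_Abs: "(\<And>S. infinite S \<Longrightarrow> f S = 0) \<Longrightarrow> coeff (Abs_grass f) = f"
  by (simp add: Abs_grass_inverse)

lemmas coeff_basic = zero_grass.rep_eq one_grass.rep_eq plus_grass.rep_eq minus_grass.rep_eq
  uminus_grass.rep_eq scaleR_grass.rep_eq

lemma coeff_sum: "coeff (\<Sum>i\<in>I. f i) S = (\<Sum>i\<in>I. coeff (f i) S)"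
  by (induction I rule: infinite_finite_induct) (simp_all add: coeff_basic)

lemma coeff_mult: "coeff (a * b) S = (\<Sum>T\<in>Pow S. gsign T (S - T) * coeff a T * coeff b (S - T))"
  for a b :: "'g::linorder grass"
  by (simp add: times_grass.rep_eq)

lemma coeff_of_real: "coeff (of_real c :: 'g::linorder grass) S = (if S = {} then c else 0)"
  by (simp add: of_real_def coeff_basic)

lemma coeff_gen: "coeff (gen g) S = (if S = {g} then 1 else 0)"
  unfolding gen_def by (subst coeff_Abs) auto

text \<open>The grade involution: the identity on even and minus the identity on odd elements. It
  expresses the sign of moving an odd derivation past an element that need not be
  homogeneous.\<close>

lift_definition gi :: "'g::linorder grass \<Rightarrow> 'g grass" is "\<lambda>a S. (- 1) ^ card S * a S"
  by simp

lemma gi_add [simp]: "gi (a + b) = gi a + gi b"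
  by transfer (simp add: algebra_simps)

lemma gi_diff [simp]: "gi (a - b) = gi a - gi b"
  by transfer (simp add: algebra_simps)

lemma gi_uminus [simp]: "gi (- a) = - gi a"
  by transfer simp

lemma gi_scaleR [simp]: "gi (c *\<^sub>R a) = c *\<^sub>R gi a"
  by transfer (simp add: algebra_simps)

lemma gi_zero [simp]: "gi 0 = 0"
  by transfer simp

lemma gi_one [simp]: "gi 1 = 1"
  by transfer auto

lemma gi_of_real [simp]: "gi (of_real c) = of_real c"
  by (simp add: of_real_def)

lemma gi_sum [simp]: "gi (\<Sum>i\<in>I. f i) = (\<Sum>i\<in>I. gi (f i))"
  by (induction I rule: infinite_finite_induct) simp_all

lemma gi_gi [simp]: "gi (gi a) = a"
proof (rule grass_eqI)
  fix S :: "'a set" 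
  have "(- 1::real) ^ card S * (- 1) ^ card S = 1"
    by (simp flip: power_mult_distrib)
  then show "coeff (gi (gi a)) S = coeff a S"
    by (simp add: gi.rep_eq flip: mult.assoc)
qed

lemma gi_mult [simp]: "gi (a * b) = gi a * gi b"
proof (rule grass_eqI)
  fix S :: "'a set"
  assume S: "finite S"
  have "(- 1::real) ^ card S = (- 1) ^ card T * (- 1) ^ card (S - T)" if "T \<subseteq> S" for T
    using card_Diff_subset[of T S] card_mono[OF S that] that S finite_subset[OF that S]
    by (simp flip: power_add)
  then show "coeff (gi (a * b)) S = coeff (gi a * gi b) S"
    by (auto simp: gi.rep_eq coeff_mult sum_distrib_left intro!: sum.cong)
qed

lemma neg_one_power_eq_iff: "(- 1::real) ^ m = (- 1) ^ n \<longleftrightarrow> m mod 2 = n mod 2"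
  by (cases "even m"; cases "even n") (auto simp: even_iff_mod_2_eq_zero odd_iff_mod_2_eq_one)

text \<open>Parity as an eigenvalue equation for \<open>gi\<close>: closure under sums and products
  then follows because \<open>gi\<close> is linear and multiplicative.\<close>

lemma has_parity_iff: "has_parity p a \<longleftrightarrow> gi a = (- 1) ^ p *\<^sub>R a"
proof -
  have "gi a = (- 1) ^ p *\<^sub>R a \<longleftrightarrow> (\<forall>S. (- 1) ^ card S * coeff a S = (- 1) ^ p * coeff a S)"
    by (metis (no_types) gi.rep_eq grass_eqI scaleR_grass.rep_eq)
  also have "\<dots> \<longleftrightarrow> has_parity p a"
    unfolding has_parity_def by (auto simp: neg_one_power_eq_iff)
  finally show ?thesis by simp
qed

lemma neg_one_power_mult: "(- 1) ^ k * a = (- 1::real) ^ k *\<^sub>R a"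
  for a :: "'a::real_algebra_1"
  by (cases "even k") simp_all

lemma has_parity_zero [simp]: "has_parity p (0 :: 'g::linorder grass)"
  by (simp add: has_parity_iff)

lemma has_parity_of_real [simp]: "has_parity 0 (of_real c :: 'g::linorder grass)"
  by (simp add: has_parity_iff)

lemma has_parity_one [simp]: "has_parity 0 (1 :: 'g::linorder grass)"
  by (simp add: has_parity_iff)

lemma has_parity_add: "has_parity p a \<Longrightarrow> has_parity p b \<Longrightarrow> has_parity p (a + b)"
  for a b :: "'g::linorder grass"
  by (simp add: has_parity_iff scaleR_add_right)

lemma has_parity_diff: "has_parity p a \<Longrightarrow> has_parity p b \<Longrightarrow> has_parity p (a - b)"
  for a b :: "'g::linorder grass"
  by (simp add: has_parity_iff scaleR_diff_right)

lemma has_parity_uminus: "has_parity p a \<Longrightarrow> has_parity p (- a)"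
  for a :: "'g::linorder grass"
  by (simp add: has_parity_iff)

lemma has_parity_scaleR: "has_parity p a \<Longrightarrow> has_parity p (c *\<^sub>R a)"
  for a :: "'g::linorder grass"
  by (simp add: has_parity_iff)

lemma has_parity_sum: "(\<And>i. i \<in> I \<Longrightarrow> has_parity p (f i)) \<Longrightarrow> has_parity p (\<Sum>i\<in>I. f i)"
  for f :: "_ \<Rightarrow> 'g::linorder grass"
  by (simp add: has_parity_iff scaleR_sum_right)

lemma has_parity_mult: "has_parity p a \<Longrightarrow> has_parity q b \<Longrightarrow> has_parity (p + q) (a * b)"
  for a b :: "'g::linorder grass"
  by (simp add: has_parity_iff power_add)

lemma has_parity_cong: "p mod 2 = q mod 2 \<Longrightarrow> has_parity p a \<longleftrightarrow> has_parity q a"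
  by (simp add: has_parity_def)

lemma has_parity_gen: "has_parity 1 (gen g)"
  by (simp add: has_parity_def coeff_gen)

text \<open>Disjointness leaves no ties, so each pair in \<open>A \<times> B\<close> is an inversion
  in exactly one of the two orders; the exponents add up to \<open>card A * card B\<close>.\<close>

lemma gsign_swap:
  assumes "finite A" "finite B" "A \<inter> B = {}"
  shows "gsign A B * gsign B A = (- 1) ^ (card A * card B)"
proof -
  let ?P = "{(s, t). s \<in> A \<and> t \<in> B \<and> t < s}" and ?Q = "{(t, s). t \<in> B \<and> s \<in> A \<and> s < t}"
  have "card ?Q = card ((\<lambda>(t, s). (s, t)) ` ?Q)"
    by (rule card_image[symmetric]) (auto simp: inj_on_def)
  also have "(\<lambda>(t, s). (s, t)) ` ?Q = {(s, t). s \<in> A \<and> t \<in> B \<and> s < t}"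
    by auto
  also have "card ?P + card \<dots> = card (?P \<union> {(s, t). s \<in> A \<and> t \<in> B \<and> s < t})"
    by (rule card_Un_disjoint[symmetric]; (rule finite_subset[of _ "A \<times> B"])?) (use assms in auto)
  also have "?P \<union> {(s, t). s \<in> A \<and> t \<in> B \<and> s < t} = A \<times> B"
    using assms(3) by auto
  finally show ?thesis
    by (simp add: gsign_def card_cartesian_product flip: power_add)
qed

lemma gsign_square: "gsign A B * gsign A B = 1"
  by (simp add: gsign_def flip: power_mult_distrib)

text \<open>The coefficients at complementary subsets \<open>T\<close> and \<open>S - T\<close> are
  exchanged. Where they are nonzero they fix the parities of both cardinalities, hence the sign in
  \<open>gsign_swap\<close>.\<close>

lemma supercommute:
  assumes "has_parity p a" "has_parity q b"
  shows "a * b = (- 1) ^ (p * q) *\<^sub>R (b * a)"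
proof (rule grass_eqI)
  fix S :: "'a set"
  assume S: "finite S"
  have *: "gsign T (S - T) * coeff a T * coeff b (S - T)
      = (- 1) ^ (p * q) * (gsign (S - T) T * coeff b (S - T) * coeff a T)" if "T \<subseteq> S" for T
  proof (cases "coeff a T = 0 \<or> coeff b (S - T) = 0")
    case False
    then have "card T mod 2 = p mod 2" "card (S - T) mod 2 = q mod 2"
      using assms by (auto simp: has_parity_def)
    then have "(card T * card (S - T)) mod 2 = (p * q) mod 2"
      by (metis mod_mult_eq)
    then have "(- 1::real) ^ (p * q) = (- 1) ^ (card T * card (S - T))"
      by (simp add: neg_one_power_eq_iff)
    also have "\<dots> = gsign T (S - T) * gsign (S - T) T"
      using S that by (subst gsign_swap) (auto intro: finite_subset)
    finally show ?thesis
      using gsign_square[of "S - T" T] by (simp add: mult_ac)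
  qed auto
  have "coeff (a * b) S = (\<Sum>T\<in>Pow S. (- 1) ^ (p * q) * (gsign (S - T) T * coeff b (S - T) * coeff a T))"
    unfolding coeff_mult by (rule sum.cong) (use * in auto)
  also have "\<dots> = (\<Sum>T\<in>Pow S. (- 1) ^ (p * q) * (gsign T (S - T) * coeff b T * coeff a (S - T)))"
    by (rule sum.reindex_bij_witness[of _ "\<lambda>T. S - T" "\<lambda>T. S - T"]) (auto simp: double_diff)
  finally show "coeff (a * b) S = coeff ((- 1) ^ (p * q) *\<^sub>R (b * a)) S"
    by (simp add: coeff_mult coeff_basic sum_distrib_left)
qed

text \<open>The second factor need not be homogeneous; it splits into an even and an odd eigenvector
  of \<open>gi\<close>.\<close>

lemma even_commute: "has_parity 0 a \<Longrightarrow> a * b = b * a"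
proof -
  assume a: "has_parity 0 a"
  define e o' where "e = (1 / 2) *\<^sub>R (b + gi b)" and "o' = (1 / 2) *\<^sub>R (b - gi b)"
  have "has_parity 0 e" "has_parity 1 o'" "b = e + o'"
    by (simp_all add: has_parity_iff e_def o'_def algebra_simps flip: scaleR_add_left)
  then show "a * b = b * a"
    using supercommute[OF a, of 0 e] supercommute[OF a, of 1 o'] by (simp add: algebra_simps)
qed

lemma odd_anticommute: "has_parity 1 a \<Longrightarrow> has_parity 1 b \<Longrightarrow> a * b = - (b * a)"
  using supercommute[of 1 a 1 b] by simp

lemma eq_uminus_self: "a = - a \<Longrightarrow> a = 0" for a :: "'a::real_vector"
proof -
  assume "a = - a"
  then have "a + a = 0" by (metis add.right_inverse)
  then show "a = 0" by (metis scaleR_2 scaleR_eq_0_iff zero_neq_numeral)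
qed

lemma odd_square: "has_parity 1 a \<Longrightarrow> a * a = 0"
  by (rule eq_uminus_self) (rule odd_anticommute)

section \<open>Left derivatives in the generators\<close>

lemma coeff_odd_pd: "coeff (odd_pd i a) S =
    (if Theta i \<in> S then 0 else gsign {Theta i} S * coeff a (insert (Theta i) S))"
  unfolding odd_pd_def by (subst coeff_Abs) (auto simp: coeff_infinite)

lemma odd_pd_add [simp]: "odd_pd i (a + b) = odd_pd i a + odd_pd i b"
  by (rule grass_eqI) (simp add: coeff_odd_pd coeff_basic algebra_simps)

lemma odd_pd_uminus [simp]: "odd_pd i (- a) = - odd_pd i a"
  by (rule grass_eqI) (simp add: coeff_odd_pd coeff_basic algebra_simps)

lemma odd_pd_scaleR [simp]: "odd_pd i (c *\<^sub>R a) = c *\<^sub>R odd_pd i a"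
  by (rule grass_eqI) (simp add: coeff_odd_pd coeff_basic algebra_simps)

lemma odd_pd_of_real [simp]: "odd_pd i (of_real c) = 0"
  by (rule grass_eqI) (simp add: coeff_odd_pd coeff_of_real coeff_basic)

lemma gi_odd_pd: "gi (odd_pd i a) = - odd_pd i (gi a)"
  by (rule grass_eqI) (auto simp: coeff_odd_pd gi.rep_eq coeff_basic)

lemma sum_Pow_insert:
  assumes "finite S" "g \<notin> S"
  shows "(\<Sum>T\<in>Pow (insert g S). f T) = (\<Sum>T\<in>Pow S. f T) + (\<Sum>T\<in>Pow S. f (insert g T))"
proof -
  have "(\<Sum>T\<in>Pow (insert g S). f T) = (\<Sum>T\<in>Pow S. f T) + (\<Sum>T\<in>insert g ` Pow S. f T)"
    unfolding Pow_insert by (rule sum.union_disjoint) (use assms in auto)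
  also have "(\<Sum>T\<in>insert g ` Pow S. f T) = (\<Sum>T\<in>Pow S. f (insert g T))"
    by (rule sum.reindex_cong[of "insert g"]) (use assms in \<open>auto simp: inj_on_def\<close>)
  finally show ?thesis .
qed

lemma gsign_insert_left:
  "finite A \<Longrightarrow> finite C \<Longrightarrow> g \<notin> A \<Longrightarrow> gsign (insert g A) C = gsign {g} C * gsign A C"
  using gsign_Un_left[of "{g}" A C] by simp

lemma gsign_insert_right:
  "finite A \<Longrightarrow> finite C \<Longrightarrow> g \<notin> C \<Longrightarrow> gsign A (insert g C) = gsign A {g} * gsign A C"
  using gsign_Un_right[of A "{g}" C] by simp

lemma gsign_split:
  "finite S \<Longrightarrow> T \<subseteq> S \<Longrightarrow> finite A \<Longrightarrow> gsign A S = gsign A T * gsign A (S - T)"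
  using gsign_Un_right[of A T "S - T"] finite_subset[of T S] by (simp add: Un_absorb1)

text \<open>The left odd derivative is an antiderivation, and \<open>gi\<close> supplies the sign
  for inhomogeneous \<open>a\<close>. The subsets in the coefficient of the product are sorted by
  whether they contain \<open>Theta i\<close>, that is, by which factor supplies the
  generator.\<close>

lemma odd_pd_mult: "odd_pd i (a * b) = odd_pd i a * b + gi a * odd_pd i b"
proof (rule grass_eqI)
  let ?g = "Theta i"
  have sw: "gsign {?g} T * gsign T {?g} = (- 1) ^ card T" if "finite T" "?g \<notin> T" for T :: "('a, 'b) gen set"
    using gsign_swap[of "{?g}" T] that by simp
  fix S :: "('a, 'b) gen set"
  assume S: "finite S"
  show "coeff (odd_pd i (a * b)) S = coeff (odd_pd i a * b + gi a * odd_pd i b) S"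
  proof (cases "?g \<in> S")
    case False
    \<comment> \<open>\<open>1\<close> covers the products whose generator \<open>?g\<close> comes
      from \<open>b\<close>, where it has to pass all of \<open>T\<close>; \<open>2\<close> covers
      those where it comes from \<open>a\<close>.\<close>
    have 1: "gsign {?g} S * (gsign T (insert ?g S - T) * coeff a T * coeff b (insert ?g S - T))
        = gsign T (S - T) * coeff (gi a) T * coeff (odd_pd i b) (S - T)" if "T \<subseteq> S" for T
    proof -
      have T: "finite T" "?g \<notin> T" using that S False by (auto intro: finite_subset)
      have "insert ?g S - T = insert ?g (S - T)" using that False by auto
      moreover have "gsign T (insert ?g (S - T)) = gsign T {?g} * gsign T (S - T)"
        by (rule gsign_insert_right) (use S T False in auto)
      moreover have "gsign {?g} S = gsign {?g} T * gsign {?g} (S - T)"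
        by (rule gsign_split) (use S that in auto)
      ultimately show ?thesis using T False sw[OF T, symmetric]
        by (simp add: gi.rep_eq coeff_odd_pd mult_ac)
    qed
    have 2: "gsign {?g} S * (gsign (insert ?g T) (insert ?g S - insert ?g T) * coeff a (insert ?g T)
        * coeff b (insert ?g S - insert ?g T))
        = gsign T (S - T) * coeff (odd_pd i a) T * coeff b (S - T)" if "T \<subseteq> S" for T
    proof -
      have T: "finite T" "?g \<notin> T" using that S False by (auto intro: finite_subset)
      have "insert ?g S - insert ?g T = S - T" using that False by auto
      moreover have "gsign (insert ?g T) (S - T) = gsign {?g} (S - T) * gsign T (S - T)"
        by (rule gsign_insert_left) (use S T False in auto)
      moreover have "gsign {?g} S = gsign {?g} T * gsign {?g} (S - T)"
        by (rule gsign_split) (use S that in auto)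
      ultimately show ?thesis using T False gsign_square[of "{?g}" "S - T"]
        by (simp add: coeff_odd_pd mult_ac)
    qed
    have "coeff (odd_pd i (a * b)) S = (\<Sum>T\<in>Pow S. gsign T (S - T) * coeff (gi a) T * coeff (odd_pd i b) (S - T))
        + (\<Sum>T\<in>Pow S. gsign T (S - T) * coeff (odd_pd i a) T * coeff b (S - T))"
      unfolding coeff_odd_pd[of i "a * b"] coeff_mult sum_Pow_insert[OF S False] distrib_left
        sum_distrib_left if_not_P[OF False]
    proof (rule arg_cong2[of _ _ _ _ "(+)"]; rule sum.cong)
      fix T assume "T \<in> Pow S"
      then have "T \<subseteq> S" by simp
      from 1[OF this] 2[OF this]
      show "gsign {?g} S * (gsign T (insert ?g S - T) * coeff a T * coeff b (insert ?g S - T))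
          = gsign T (S - T) * coeff (gi a) T * coeff (odd_pd i b) (S - T)"
        "gsign {?g} S * (gsign (insert ?g T) (insert ?g S - insert ?g T) * coeff a (insert ?g T)
            * coeff b (insert ?g S - insert ?g T))
          = gsign T (S - T) * coeff (odd_pd i a) T * coeff b (S - T)" .
    qed simp_all
    then show ?thesis by (simp add: coeff_mult coeff_basic)
  next
    case True
    then obtain S' where S': "S = insert ?g S'" "?g \<notin> S'" by (meson mk_disjoint_insert)
    \<comment> \<open>The left side has no monomial containing \<open>?g\<close>. On the right,
      \<open>T\<close> with the derivative on \<open>a\<close> and \<open>insert ?g T\<close> with
      the derivative on \<open>b\<close> carry the same two coefficients with opposite
      signs.\<close>
    have 1: "gsign T (S - T) * coeff (odd_pd i a) T * coeff b (S - T)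
       + gsign (insert ?g T) (S - insert ?g T) * coeff (gi a) (insert ?g T)
        * coeff (odd_pd i b) (S - insert ?g T) = 0" if "T \<subseteq> S'" for T
    proof -
      have T: "finite T" "?g \<notin> T" using that S S' by (auto intro: finite_subset)
      have "S - T = insert ?g (S' - T)" "S - insert ?g T = S' - T" using that S' by auto
      moreover have "gsign T (insert ?g (S' - T)) = gsign T {?g} * gsign T (S' - T)"
        by (rule gsign_insert_right) (use S T S' in auto)
      moreover have "gsign (insert ?g T) (S' - T) = gsign {?g} (S' - T) * gsign T (S' - T)"
        by (rule gsign_insert_left) (use S T S' in auto)
      ultimately show ?thesis using T S' sw[OF T, symmetric] gsign_square[of "{?g}" "S' - T"]
        by (simp add: coeff_odd_pd gi.rep_eq mult_ac)
    qed
    have 0: "gsign T (S - T) * coeff (gi a) T * coeff (odd_pd i b) (S - T) = 0"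
      "gsign (insert ?g T) (S - insert ?g T) * coeff (odd_pd i a) (insert ?g T)
        * coeff b (S - insert ?g T) = 0" if "T \<subseteq> S'" for T
      using that S' by (auto simp: coeff_odd_pd)
    have "finite S'" using S S' by simp
    note ins = sum_Pow_insert[OF this S'(2), folded S'(1)]
    have "coeff (odd_pd i a * b + gi a * odd_pd i b) S
        = (\<Sum>T\<in>Pow S'. gsign T (S - T) * coeff (odd_pd i a) T * coeff b (S - T)
       + gsign (insert ?g T) (S - insert ?g T) * coeff (gi a) (insert ?g T)
        * coeff (odd_pd i b) (S - insert ?g T))"
    proof -
      have "(\<Sum>T\<in>Pow S'. gsign (insert ?g T) (S - insert ?g T) * coeff (odd_pd i a) (insert ?g T)
          * coeff b (S - insert ?g T)) = 0"
        by (rule sum.neutral) (use 0 in blast)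
      moreover have "(\<Sum>T\<in>Pow S'. gsign T (S - T) * coeff (gi a) T * coeff (odd_pd i b) (S - T)) = 0"
        by (rule sum.neutral) (use 0 in blast)
      ultimately show ?thesis
        unfolding coeff_basic coeff_mult ins sum.distrib by linarith
    qed
    also have "\<dots> = 0" by (rule sum.neutral) (use 1 in auto)
    finally show ?thesis using True by (simp add: coeff_odd_pd)
  qed
qed

text \<open>Adjoining two distinct generators in either order differs by the sign of their
  transposition; for \<open>i = j\<close> both sides vanish.\<close>

lemma odd_pd_anticommute: "odd_pd i (odd_pd j a) = - odd_pd j (odd_pd i a)"
proof (rule grass_eqI)
  fix S :: "('a, 'b) gen set"
  assume S: "finite S"
  show "coeff (odd_pd i (odd_pd j a)) S = coeff (- odd_pd j (odd_pd i a)) S"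
  proof (cases "i = j")
    case False
    have 00: "gsign {Theta j} {Theta i :: ('a, 'b) gen} * gsign {Theta i} {Theta j :: ('a, 'b) gen} = - 1"
      using gsign_swap[of "{Theta j :: ('a, 'b) gen}" "{Theta i}"] False by simp
    have *: "gsign {Theta j} {Theta i :: ('a, 'b) gen} = - gsign {Theta i} {Theta j :: ('a, 'b) gen}"
    proof -
      have "gsign {Theta j} {Theta i :: ('a, 'b) gen} = (gsign {Theta j} {Theta i :: ('a, 'b) gen}
         * gsign {Theta i} {Theta j :: ('a, 'b) gen}) * gsign {Theta i} {Theta j :: ('a, 'b) gen}"
        by (simp only: mult.assoc gsign_square mult_1_right)
      also have "\<dots> = - gsign {Theta i} {Theta j :: ('a, 'b) gen}"
        unfolding 00 by simp
      finally show ?thesis .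
    qed
    have ij: "Theta i \<noteq> (Theta j :: ('a, 'b) gen)" using False by simp
    have ins: "insert (Theta i) (insert (Theta j) S) = insert (Theta j) (insert (Theta i) S)"
      by (rule insert_commute)
    show ?thesis
    proof (cases "Theta i \<in> S \<or> Theta j \<in> S")
      case True
      then show ?thesis by (auto simp: coeff_odd_pd uminus_grass.rep_eq)
    next
      case False
      have "gsign {Theta j} (insert (Theta i) S) = gsign {Theta j} {Theta i :: ('a, 'b) gen} * gsign {Theta j} S"
        by (rule gsign_insert_right) (use False S in auto)
      moreover have "gsign {Theta i} (insert (Theta j) S) = gsign {Theta i} {Theta j :: ('a, 'b) gen} * gsign {Theta i} S"
        by (rule gsign_insert_right) (use False S in auto)
      ultimately show ?thesis
        using False ij ij[symmetric] unfolding coeff_odd_pd uminus_grass.rep_eq insert_iff de_Morgan_disj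
        by (simp only: if_False simp_thms ins * insert_iff) (simp only: mult_ac mult_minus_left mult_minus_right)
    qed
  qed (simp add: coeff_odd_pd coeff_basic)
qed

section \<open>Filtration by degree and locally finite sums\<close>

text \<open>The filtration by degree: every monomial present has at least \<open>k\<close>
  generators. Terms of growing degree can then be summed even when there are infinitely many
  generators.\<close>

definition gdeg :: "nat \<Rightarrow> 'g::linorder grass \<Rightarrow> bool"
  where "gdeg k a \<longleftrightarrow> (\<forall>S. finite S \<longrightarrow> card S < k \<longrightarrow> coeff a S = 0)"

lemma gdeg_0 [simp]: "gdeg 0 a"
  by (simp add: gdeg_def)

lemma gdeg_zero [simp]: "gdeg k 0"
  by (simp add: gdeg_def coeff_basic)

lemma gdeg_scaleR: "gdeg k a \<Longrightarrow> gdeg k (c *\<^sub>R a)"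
  by (simp add: gdeg_def coeff_basic)

lemma gdeg_sum: "(\<And>i. i \<in> I \<Longrightarrow> gdeg k (f i)) \<Longrightarrow> gdeg k (\<Sum>i\<in>I. f i)"
  by (simp add: gdeg_def coeff_sum)

lemma gdeg_mult:
  assumes "gdeg k a" "gdeg l b"
  shows "gdeg (k + l) (a * b)"
  unfolding gdeg_def coeff_mult
proof (intro allI impI sum.neutral ballI)
  fix S T :: "'a set"
  assume S: "finite S" "card S < k + l" and "T \<in> Pow S"
  then have T: "finite T" "card S = card T + card (S - T)"
    by (auto intro: finite_subset simp: card_Diff_subset card_mono finite_subset)
  then have "card T < k \<or> card (S - T) < l" using S by linarith
  then show "gsign T (S - T) * coeff a T * coeff b (S - T) = 0"
    using assms S T by (auto simp: gdeg_def)
qed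

lemma gdeg_power: "gdeg 1 a \<Longrightarrow> gdeg k (a ^ k)"
proof (induction k)
  case (Suc k)
  then show ?case using gdeg_mult[of 1 a k "a ^ k"] by simp
qed simp

section \<open>The body as a ring homomorphism\<close>

lemma body_add [simp]: "body (a + b) = body a + body b"
  and body_diff [simp]: "body (a - b) = body a - body b"
  and body_uminus [simp]: "body (- a) = - body a"
  and body_zero [simp]: "body 0 = 0"
  and body_scaleR [simp]: "body (c *\<^sub>R a) = c * body a"
  and body_one [simp]: "body 1 = 1"
  and body_mult [simp]: "body (a * b) = body a * body b"
  and body_sum [simp]: "body (\<Sum>i\<in>I. f i) = (\<Sum>i\<in>I. body (f i))"
  and body_of_real [simp]: "body (of_real c) = c"
  for a :: "'g::linorder grass"
  by (simp_all add: body_def coeff_basic coeff_sum coeff_mult coeff_of_real)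

lemma body_odd: "has_parity 1 a \<Longrightarrow> body a = 0"
  unfolding has_parity_def body_def by force

lemma gdeg_1_iff: "gdeg 1 a \<longleftrightarrow> body a = 0"
  unfolding gdeg_def body_def by (metis card_eq_0_iff finite.emptyI less_one)

lemma gdeg_soul: "gdeg 1 (soul a)"
  by (simp only: gdeg_1_iff) (simp add: soul_def)

text \<open>Meaningful when \<open>gdeg k (u k)\<close> for all \<open>k\<close>: then a coefficient at \<open>S\<close> only receives
  contributions from \<open>k \<le> card S\<close>.\<close>

definition lsum :: "(nat \<Rightarrow> 'g::linorder grass) \<Rightarrow> 'g grass"
  where "lsum u = Abs_grass (\<lambda>S. if finite S then coeff (\<Sum>k\<le>card S. u k) S else 0)"

text \<open>The cutoff may be any bound on the degree, so sums truncated at different orders can be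
  compared at one coefficient.\<close>

lemma coeff_lsum:
  assumes "\<And>k. gdeg k (u k)" "card S \<le> m"
  shows "coeff (lsum u) S = coeff (\<Sum>k\<le>m. u k) S"
proof (cases "finite S")
  case True
  have "coeff (lsum u) S = (\<Sum>k\<le>card S. coeff (u k) S)"
    unfolding lsum_def using True by (subst coeff_Abs) (auto simp: coeff_sum)
  also have "\<dots> = (\<Sum>k\<le>m. coeff (u k) S)"
    using assms True by (intro sum.mono_neutral_left) (auto simp: gdeg_def)
  finally show ?thesis by (simp add: coeff_sum)
qed (simp add: coeff_infinite)

lemma coeff_mult_cong:
  assumes "\<And>T. T \<subseteq> S \<Longrightarrow> coeff a T = coeff a' T" "\<And>T. T \<subseteq> S \<Longrightarrow> coeff b T = coeff b' T"
  shows "coeff (a * b) S = coeff (a' * b') S"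
  unfolding coeff_mult using assms by (intro sum.cong) auto

text \<open>The Cauchy product. At a fixed \<open>S\<close> both factors may be cut off at the same
  order, because the coefficient of a product involves only subsets of \<open>S\<close>.\<close>

lemma lsum_mult:
  assumes u: "\<And>k. gdeg k (u k)" and v: "\<And>k. gdeg k (v k)"
  shows "lsum u * lsum v = lsum (\<lambda>k. \<Sum>p\<le>k. u p * v (k - p))"
proof (rule grass_eqI)
  fix S :: "'a set"
  assume S: "finite S"
  let ?m = "card S"
  have w: "gdeg k (\<Sum>p\<le>k. u p * v (k - p))" for k
    using gdeg_mult[OF u v] by (intro gdeg_sum) (metis atMost_iff le_add_diff_inverse)
  have "coeff (lsum u * lsum v) S = coeff ((\<Sum>p\<le>?m. u p) * (\<Sum>q\<le>?m. v q)) S"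
    by (intro coeff_mult_cong coeff_lsum u v card_mono S)
  also have "\<dots> = (\<Sum>(p, q)\<in>{..?m} \<times> {..?m}. coeff (u p * v q) S)"
    by (simp add: sum_product coeff_sum sum.cartesian_product case_prod_unfold)
  \<comment> \<open>A product of total degree above \<open>card S\<close> is invisible at
    \<open>S\<close>, which shrinks the square of indices to a triangle.\<close>
  also have "\<dots> = (\<Sum>(p, q)\<in>{(p, q). p + q \<le> ?m}. coeff (u p * v q) S)"
  proof (rule sum.mono_neutral_right)
    have "coeff (u p * v q) S = 0" if "\<not> p + q \<le> ?m" for p q
      using S gdeg_mult[OF u v, of p q] that by (simp add: gdeg_def)
    then show "\<forall>i\<in>{..?m} \<times> {..?m} - {(p, q). p + q \<le> ?m}. (case i of (p, q) \<Rightarrow> coeff (u p * v q) S) = 0"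
      by auto
  qed auto
  also have "\<dots> = (\<Sum>(k, p)\<in>(SIGMA k:{..?m}. {..k}). coeff (u p * v (k - p)) S)"
    by (rule sum.reindex_bij_witness[of _ "\<lambda>(k, p). (p, k - p)" "\<lambda>(p, q). (p + q, p)"]) auto
  also have "\<dots> = (\<Sum>k\<le>?m. \<Sum>p\<le>k. coeff (u p * v (k - p)) S)"
    by (rule sum.Sigma[symmetric]) auto
  also have "\<dots> = coeff (lsum (\<lambda>k. \<Sum>p\<le>k. u p * v (k - p))) S"
    by (simp add: coeff_lsum[OF w order_refl] coeff_sum)
  finally show "coeff (lsum u * lsum v) S = coeff (lsum (\<lambda>k. \<Sum>p\<le>k. u p * v (k - p))) S" .
qed

lemma has_parity_lsum:
  fixes u :: "nat \<Rightarrow> 'g::linorder grass"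
  assumes "\<And>k. has_parity p (u k)"
  shows "has_parity p (lsum u)"
proof -
  have "has_parity p (\<Sum>k\<le>n. u k)" for n
    by (intro has_parity_sum assms)
  moreover have "coeff (lsum u) = (\<lambda>S. if finite S then coeff (\<Sum>k\<le>card S. u k) S else 0)"
    unfolding lsum_def by (rule coeff_Abs) simp
  ultimately show ?thesis
    unfolding has_parity_def by simp
qed

section \<open>The binomial series and inverses\<close>

text \<open>The binomial series of (1 + n)^\<sigma>, meaningful for \<open>n\<close> with vanishing
  body.\<close>

definition gbin :: "real \<Rightarrow> 'g::linorder grass \<Rightarrow> 'g grass"
  where "gbin \<sigma> n = lsum (\<lambda>k. (\<sigma> gchoose k) *\<^sub>R n ^ k)"

text \<open>Vandermonde's convolution of binomial coefficients is the law of exponents.\<close>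

lemma gbin_mult:
  assumes "body n = 0"
  shows "gbin \<sigma> n * gbin \<tau> n = gbin (\<sigma> + \<tau>) n"
proof -
  have d: "gdeg k ((\<sigma> gchoose k) *\<^sub>R n ^ k)" for \<sigma> k
    using assms by (intro gdeg_scaleR gdeg_power) (simp only: gdeg_1_iff)
  have "(\<Sum>p\<le>k. (\<sigma> gchoose p) *\<^sub>R n ^ p * (\<tau> gchoose (k - p)) *\<^sub>R n ^ (k - p))
      = (\<sigma> + \<tau> gchoose k) *\<^sub>R n ^ k" for k
  proof -
    have "(\<Sum>p\<le>k. (\<sigma> gchoose p) *\<^sub>R n ^ p * (\<tau> gchoose (k - p)) *\<^sub>R n ^ (k - p))
        = (\<Sum>p\<le>k. (\<sigma> gchoose p) * (\<tau> gchoose (k - p))) *\<^sub>R n ^ k"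
      by (simp add: scaleR_sum_left mult.commute flip: power_add)
    then show ?thesis by (simp add: gbinomial_Vandermonde flip: atLeast0AtMost)
  qed
  then show ?thesis unfolding gbin_def by (simp add: lsum_mult[OF d d])
qed

lemma gbin_1:
  assumes "body n = 0"
  shows "gbin 1 n = 1 + n"
proof (rule grass_eqI)
  fix S :: "'a set"
  have d: "gdeg k ((1 gchoose k) *\<^sub>R n ^ k)" for k
    using assms by (intro gdeg_scaleR gdeg_power) (simp only: gdeg_1_iff)
  have c: "(1::real) gchoose k = (if k \<le> 1 then 1 else 0)" for k
    using binomial_gbinomial[of 1 k, where 'a = real] by (cases k) (auto simp: binomial_eq_0)
  have "coeff (gbin 1 n) S = coeff (\<Sum>k\<le>Suc (card S). (1 gchoose k) *\<^sub>R n ^ k) S"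
    unfolding gbin_def by (rule coeff_lsum[OF d]) simp
  also have "(\<Sum>k\<le>Suc (card S). (1 gchoose k) *\<^sub>R n ^ k) = (\<Sum>k\<le>1. n ^ k)"
    by (rule sum.mono_neutral_cong_right) (auto simp: c)
  finally show "coeff (gbin 1 n) S = coeff (1 + n) S" by simp
qed

lemma gbin_0:
  assumes "body n = 0"
  shows "gbin 0 n = 1"
proof (rule grass_eqI)
  fix S :: "'a set"
  have d: "gdeg k ((0 gchoose k) *\<^sub>R n ^ k)" for k
    using assms by (intro gdeg_scaleR gdeg_power) (simp only: gdeg_1_iff)
  have c: "(0::real) gchoose k = (if k = 0 then 1 else 0)" for k
    by (cases k) auto
  have "coeff (gbin 0 n) S = coeff (\<Sum>k\<le>card S. (0 gchoose k) *\<^sub>R n ^ k) S"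
    unfolding gbin_def by (rule coeff_lsum[OF d]) simp
  also have "(\<Sum>k\<le>card S. (0 gchoose k) *\<^sub>R n ^ k) = (\<Sum>k\<in>{0}. n ^ k)"
    by (rule sum.mono_neutral_cong_right) (auto simp: c)
  finally show "coeff (gbin 0 n) S = coeff 1 S" by simp
qed

lemma has_parity_power: "has_parity 0 a \<Longrightarrow> has_parity 0 (a ^ k)"
  for a :: "'g::linorder grass"
  by (induction k) (use has_parity_mult[of 0 a 0] in auto)

lemma has_parity_gbin: "has_parity 0 n \<Longrightarrow> has_parity 0 (gbin \<sigma> n)"
  unfolding gbin_def by (intro has_parity_lsum has_parity_scaleR has_parity_power)

lemma body_gbin: "body n = 0 \<Longrightarrow> body (gbin \<sigma> n) = 1"
proof -
  assume "body n = 0"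
  then have d: "gdeg k ((\<sigma> gchoose k) *\<^sub>R n ^ k)" for k
    by (intro gdeg_scaleR gdeg_power) (simp only: gdeg_1_iff)
  show ?thesis
    unfolding body_def gbin_def using coeff_lsum[OF d, of "{}" 0] by (simp add: coeff_basic)
qed

lemma gpowr_eq_gbin: "gpowr \<sigma> a = (\<bar>body a\<bar> powr \<sigma>) *\<^sub>R gbin \<sigma> ((1 / body a) *\<^sub>R soul a)"
proof (rule grass_eqI)
  fix S :: "'a set"
  assume S: "finite S"
  show "coeff (gpowr \<sigma> a) S = coeff ((\<bar>body a\<bar> powr \<sigma>) *\<^sub>R gbin \<sigma> ((1 / body a) *\<^sub>R soul a)) S"
    unfolding gpowr_def gbin_def lsum_def coeff_basic using S
    by (subst (1 2) coeff_Abs) (auto simp: coeff_sum coeff_basic sum_distrib_left mult_ac)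
qed

text \<open>An element with nonzero body is not a zero divisor: at a minimal \<open>S\<close> where
  \<open>x\<close> might be nonzero, the coefficient of \<open>x * c\<close> is that of
  \<open>x\<close> times \<open>body c\<close>.\<close>

lemma mult_right_cancel_body:
  assumes "x * c = 0" "body c \<noteq> 0"
  shows "x = 0"
proof (rule grass_eqI)
  fix S :: "'a set"
  assume "finite S"
  then show "coeff x S = coeff 0 S"
  proof (induction "card S" arbitrary: S rule: less_induct)
    case less
    have "0 = coeff (x * c) S" using assms by (simp add: coeff_basic)
    also have "\<dots> = (\<Sum>T\<in>Pow S. if T = S then coeff x S * body c else 0)"
      unfolding coeff_mult
    proof (rule sum.cong)
      fix T assume T: "T \<in> Pow S"
      show "gsign T (S - T) * coeff x T * coeff c (S - T) = (if T = S then coeff x S * body c else 0)"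
      proof (cases "T = S")
        case False
        then have "card T < card S" "finite T"
          using T less.prems by (auto intro: psubset_card_mono finite_subset)
        then show ?thesis using less.hyps False by (simp add: coeff_basic)
      qed (simp add: body_def)
    qed simp
    also have "\<dots> = coeff x S * body c" using less.prems by simp
    finally show ?case using assms by (simp add: coeff_basic)
  qed
qed

text \<open>With \<open>n\<close> the normalised soul, \<open>a\<close> is its body times 1 + n, and
  the binomial series with exponent -1 inverts the second factor.\<close>

lemma even_inverse_exists:
  assumes "has_parity 0 a" "body a \<noteq> 0"
  shows "\<exists>b. has_parity 0 b \<and> a * b = 1 \<and> b * a = 1"
proof -
  define n where "n = (1 / body a) *\<^sub>R soul a"
  define b where "b = (1 / body a) *\<^sub>R gbin (- 1) n"
  have n: "body n = 0" "has_parity 0 n"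
    using assms by (auto simp: n_def soul_def intro!: has_parity_scaleR has_parity_diff)
  have a: "a = body a *\<^sub>R gbin 1 n"
    using assms n by (simp add: gbin_1) (simp add: n_def soul_def scaleR_add_right of_real_def)
  have "a * b = 1" "b * a = 1"
    using assms n by (subst a, simp add: b_def gbin_mult gbin_0)+
  moreover have "has_parity 0 b"
    unfolding b_def using n by (intro has_parity_scaleR has_parity_gbin)
  ultimately show ?thesis by blast
qed

lemma ginv_eq:
  assumes "a * b = 1" "b * a = 1"
  shows "ginv a = b"
proof -
  have "a * ginv a = 1 \<and> ginv a * a = 1"
    unfolding ginv_def by (rule someI[of _ b]) (use assms in auto)
  then show ?thesis using assms by (metis mult.assoc mult_1_left mult_1_right)
qed

text \<open>After normalising the body to 1, the binomial root \<open>w\<close> and \<open>v\<close>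
  have the same square. As even elements commute, (w - v)(w + v) = 0, and w + v has body 2 and can
  be cancelled. The sign enters because \<open>gpowr\<close> takes the positive root of the square
  of \<open>body r\<close>.\<close>

lemma gpowr_half_square:
  assumes r: "has_parity 0 r" "body r \<noteq> 0"
  shows "gpowr (1 / 2) (r * r) = sgn (body r) *\<^sub>R r"
proof -
  define \<beta> where "\<beta> = body r"
  have \<beta>: "\<beta> \<noteq> 0" using r \<beta>_def by simp
  define v where "v = (1 / \<beta>) *\<^sub>R r"
  define u where "u = (1 / body (r * r)) *\<^sub>R soul (r * r)"
  define w where "w = gbin (1 / 2) u"
  have rv: "r = \<beta> *\<^sub>R v" using \<beta> by (simp add: v_def)
  have v: "body v = 1" "has_parity 0 v"
    using r \<beta> by (auto simp: v_def \<beta>_def intro!: has_parity_scaleR)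
  have u: "body u = 0" "has_parity 0 u"
    using r has_parity_mult[of 0 r 0 r]
    by (auto simp: u_def soul_def simp del: of_real_mult intro!: has_parity_scaleR has_parity_diff)
  have uv: "1 + u = v * v"
    using \<beta> by (simp add: u_def soul_def v_def \<beta>_def scaleR_diff_right of_real_def)
  have w: "body w = 1" "has_parity 0 w" "w * w = 1 + u"
    using u by (simp_all add: w_def body_gbin has_parity_gbin gbin_mult gbin_1)
  have "(w - v) * (w + v) = 0"
    using w uv even_commute[OF v(2), of w] by (simp add: algebra_simps)
  then have "w - v = 0" by (rule mult_right_cancel_body) (use w v in simp)
  moreover have "gpowr (1 / 2) (r * r) = \<bar>\<beta>\<bar> *\<^sub>R w"
    by (simp add: gpowr_eq_gbin w_def u_def \<beta>_def powr_half_sqrt)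
  moreover have "\<bar>\<beta>\<bar> *\<^sub>R v = sgn \<beta> *\<^sub>R r"
    using \<beta> by (simp add: v_def sgn_if)
  ultimately show ?thesis
    by (simp add: \<beta>_def)
qed

section \<open>Partial derivatives and smooth functions\<close>

lemma sum_axis: "(\<Sum>k\<in>UNIV. axis i (1::real) $ k * c k) = c i" for c :: "'n::finite \<Rightarrow> real"
proof -
  have "(\<Sum>k\<in>UNIV. axis i (1::real) $ k * c k) = (\<Sum>k\<in>UNIV. if k = i then c k else 0)"
    by (rule sum.cong) (auto simp: axis_def)
  then show ?thesis by simp
qed

lemma pd_eqI: "(h has_derivative h') (at x) \<Longrightarrow> pd i h x = h' (axis i 1)"
  unfolding pd_def by (metis frechet_derivative_at)

lemma has_derivative_pd:
  fixes h :: "real ^ 'n::finite \<Rightarrow> real"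
  assumes "h differentiable (at x)"
  shows "(h has_derivative (\<lambda>v. \<Sum>i\<in>UNIV. v $ i * pd i h x)) (at x)"
proof -
  let ?h' = "frechet_derivative h (at x)"
  have d: "(h has_derivative ?h') (at x)"
    using assms by (rule frechet_derivative_works[THEN iffD1])
  then interpret linear ?h' by (rule has_derivative_linear)
  have "?h' v = (\<Sum>i\<in>UNIV. v $ i * pd i h x)" for v
  proof -
    have "v = (\<Sum>i\<in>UNIV. v $ i *\<^sub>R axis i 1)"
      using basis_expansion[of v] by (simp add: scalar_mult_eq_scaleR)
    then have "?h' v = ?h' (\<Sum>i\<in>UNIV. v $ i *\<^sub>R axis i 1)" by simp
    then show ?thesis by (simp add: sum scale pd_def)
  qed
  then have "?h' = (\<lambda>v. \<Sum>i\<in>UNIV. v $ i * pd i h x)" by (rule ext)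
  with d show ?thesis by simp
qed

lemma pd_cong:
  assumes "open U" "x \<in> U" "\<And>y. y \<in> U \<Longrightarrow> f y = g y"
  shows "pd i f x = pd i g x"
proof -
  have "(f has_derivative f') (at x) \<longleftrightarrow> (g has_derivative f') (at x)" for f'
    by (rule iffI; erule has_derivative_transform_within_open[OF _ assms(1,2)]) (simp_all add: assms(3))
  then show ?thesis unfolding pd_def frechet_derivative_def by simp
qed

lemma differentiable_cong:
  assumes "open U" "x \<in> U" "\<And>y. y \<in> U \<Longrightarrow> f y = g y" "f differentiable (at x)"
  shows "g differentiable (at x)"
proof -
  obtain D where "(f has_derivative D) (at x)" using assms(4) unfolding differentiable_def by blast
  then have "(g has_derivative D) (at x)"
    by (rule has_derivative_transform_within_open[OF _ assms(1,2)]) (rule assms(3))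
  then show ?thesis unfolding differentiable_def by blast
qed

lemma pd_const [simp]: "pd i (\<lambda>_. c) = (\<lambda>_. 0)"
  by (rule ext, subst pd_eqI[OF has_derivative_const]) simp

lemma pd_nth: "pd i (\<lambda>x. x $ j) x = (if i = j then 1 else 0)"
proof -
  have "((\<lambda>x. x $ j) has_derivative (\<lambda>x. x $ j)) (at x)"
    by (rule bounded_linear_imp_has_derivative) (rule bounded_linear_vec_nth)
  from pd_eqI[OF this] show ?thesis by (simp add: axis_def)
qed

lemma pd_add:
  assumes "f differentiable (at x)" "g differentiable (at x)"
  shows "pd i (\<lambda>x. f x + g x) x = pd i f x + pd i g x"
  using pd_eqI[OF has_derivative_add[OF has_derivative_pd[OF assms(1)] has_derivative_pd[OF assms(2)]]]
  by (simp add: sum_axis)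

lemma pd_mult:
  assumes "f differentiable (at x)" "g differentiable (at x)"
  shows "pd i (\<lambda>x. f x * g x) x = pd i f x * g x + f x * pd i g x"
  using pd_eqI[OF has_derivative_mult[OF has_derivative_pd[OF assms(1)] has_derivative_pd[OF assms(2)]]]
  by (simp add: sum_axis)

lemma pd_cmult: "f differentiable (at x) \<Longrightarrow> pd i (\<lambda>x. c * f x) x = c * pd i f x"
  by (subst pd_mult) auto

lemma pd_sum:
  assumes "\<And>j. j \<in> I \<Longrightarrow> f j differentiable (at x)"
  shows "pd i (\<lambda>x. \<Sum>j\<in>I. f j x) x = (\<Sum>j\<in>I. pd i (f j) x)"
  using assms
proof (induction I rule: infinite_finite_induct)
  case (insert j I)
  then have "(\<lambda>x. \<Sum>j\<in>I. f j x) differentiable (at x)" by (intro differentiable_sum) auto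
  with insert show ?case by (simp add: pd_add)
qed simp_all

lemma pd_inverse:
  assumes "f differentiable (at x)" "f x \<noteq> 0"
  shows "pd i (\<lambda>x. inverse (f x)) x = - (pd i f x * (inverse (f x) * inverse (f x)))"
  using pd_eqI[OF Deriv.has_derivative_inverse[OF assms(2) has_derivative_pd[OF assms(1)]], of i]
  unfolding sum_axis by (simp add: mult_ac)

lemma has_derivative_vec_fun:
  fixes b :: "'m::finite \<Rightarrow> real ^ 'n::finite \<Rightarrow> real"
  assumes "\<And>j. (b j has_derivative b' j) (at x)"
  shows "((\<lambda>x. \<chi> j. b j x) has_derivative (\<lambda>v. \<chi> j. b' j v)) (at x)"
  by (subst has_derivative_componentwise_within) (use assms in \<open>auto simp: Basis_vec_def inner_axis\<close>)

lemma
  fixes b :: "'m::finite \<Rightarrow> real ^ 'n::finite \<Rightarrow> real"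
  assumes "\<And>j. b j differentiable (at x)" "h differentiable (at (\<chi> j. b j x))"
  shows pd_compose: "pd i (\<lambda>x. h (\<chi> j. b j x)) x = (\<Sum>j\<in>UNIV. pd i (b j) x * pd j h (\<chi> j. b j x))"
    and differentiable_compose_vec: "(\<lambda>x. h (\<chi> j. b j x)) differentiable (at x)"
proof -
  have *: "((\<lambda>x. h (\<chi> j. b j x)) has_derivative
      (\<lambda>v. \<Sum>j\<in>UNIV. (\<chi> j. \<Sum>k\<in>UNIV. v $ k * pd k (b j) x) $ j * pd j h (\<chi> j. b j x))) (at x)"
    by (rule has_derivative_compose[OF has_derivative_vec_fun[OF has_derivative_pd[OF assms(1)]]
          has_derivative_pd[OF assms(2)]])
  then show "(\<lambda>x. h (\<chi> j. b j x)) differentiable (at x)" unfolding differentiable_def by blast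
  show "pd i (\<lambda>x. h (\<chi> j. b j x)) x = (\<Sum>j\<in>UNIV. pd i (b j) x * pd j h (\<chi> j. b j x))"
    using pd_eqI[OF *, of i] by (simp add: sum_axis)
qed

section \<open>Iterated partial derivatives and closure properties of smooth functions\<close>

lemma iter_pd_append: "iter_pd (xs @ ys) h = iter_pd xs (iter_pd ys h)"
  by (induction xs) simp_all

lemma iter_pd_cong:
  assumes "open U" "x \<in> U" "\<And>y. y \<in> U \<Longrightarrow> f y = g y"
  shows "iter_pd is f x = iter_pd is g x"
  using assms(2)
proof (induction "is" arbitrary: x)
  case (Cons i "is")
  show ?case using pd_cong[OF assms(1) Cons.prems, of "iter_pd is f" "iter_pd is g"] Cons.IH by simp
qed (use assms in simp)

lemma iter_pd_zero [simp]: "iter_pd is (\<lambda>_. 0) = (\<lambda>_. 0)"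
  by (induction "is") simp_all

lemma smooth_funD: "smooth_fun U h \<Longrightarrow> x \<in> U \<Longrightarrow> h differentiable (at x)"
  unfolding smooth_fun_def by (metis iter_pd.simps(1))

lemma smooth_fun_pd: "smooth_fun U h \<Longrightarrow> smooth_fun U (pd i h)"
  unfolding smooth_fun_def
proof (intro allI)
  fix "is"
  assume "\<forall>is. \<forall>x\<in>U. iter_pd is h differentiable (at x)"
  then have "\<forall>x\<in>U. iter_pd (is @ [i]) h differentiable (at x)" by blast
  then show "\<forall>x\<in>U. iter_pd is (pd i h) differentiable (at x)" by (simp add: iter_pd_append)
qed

lemma smooth_fun_subset: "smooth_fun U h \<Longrightarrow> V \<subseteq> U \<Longrightarrow> smooth_fun V h"
  unfolding smooth_fun_def by blast

text \<open>Smoothness asks for all iterated derivatives at once; it suffices to find a class of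
  differentiable functions closed under partial derivatives. Agreement with a member of the class is
  asked only on \<open>U\<close>, where the differentiation rules hold.\<close>

lemma smooth_fun_coinduct:
  assumes "open U" "P h"
    and step: "\<And>h. P h \<Longrightarrow> (\<forall>x\<in>U. h differentiable (at x)) \<and> (\<forall>i. \<exists>g. P g \<and> (\<forall>x\<in>U. pd i h x = g x))"
  shows "smooth_fun U h"
  unfolding smooth_fun_def
proof
  fix "is"
  show "\<forall>x\<in>U. iter_pd is h differentiable (at x)"
    using assms(2)
  \<comment> \<open>The last index of the list is the first to be differentiated, hence the
    induction from the right.\<close>
  proof (induction "is" arbitrary: h rule: rev_induct)
    case (snoc i "is")
    then obtain g where g: "P g" "\<forall>x\<in>U. pd i h x = g x" using step by blast
    show ?case
    proof
      fix x assume x: "x \<in> U"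
      have "iter_pd is g differentiable (at x)" using snoc.IH g x by blast
      moreover have "iter_pd is g y = iter_pd is (pd i h) y" if "y \<in> U" for y
        by (rule iter_pd_cong[OF assms(1) that]) (simp add: g(2))
      ultimately show "iter_pd (is @ [i]) h differentiable (at x)"
        using differentiable_cong[OF assms(1) x, of "iter_pd is g"] by (simp add: iter_pd_append)
    qed
  qed (use step in auto)
qed

text \<open>An invariant for \<open>smooth_fun_coinduct\<close>: the product, quotient and chain
  rules stay inside this class. In \<open>comp\<close> the outer function has to be smooth, not
  merely in the class, so that each \<open>pd j h\<close> can be composed again.\<close>

inductive smooth_closure :: "(real ^ 'n::finite) set \<Rightarrow> (real ^ 'n \<Rightarrow> real) \<Rightarrow> bool" for U where
  base: "smooth_fun U f \<Longrightarrow> smooth_closure U f"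
| const: "smooth_closure U (\<lambda>_. c)"
| add: "smooth_closure U f \<Longrightarrow> smooth_closure U g \<Longrightarrow> smooth_closure U (\<lambda>x. f x + g x)"
| mult: "smooth_closure U f \<Longrightarrow> smooth_closure U g \<Longrightarrow> smooth_closure U (\<lambda>x. f x * g x)"
| inv: "smooth_closure U f \<Longrightarrow> \<forall>x\<in>U. f x \<noteq> 0 \<Longrightarrow> smooth_closure U (\<lambda>x. inverse (f x))"
| comp: "smooth_fun V h \<Longrightarrow> \<forall>j::'n. smooth_fun U (b j) \<Longrightarrow> \<forall>x\<in>U. (\<chi> j. b j x) \<in> V
    \<Longrightarrow> smooth_closure U (\<lambda>x. h (\<chi> j. b j x))"

lemma smooth_closure_sum:
  "(\<And>i. i \<in> I \<Longrightarrow> smooth_closure U (f i)) \<Longrightarrow> smooth_closure U (\<lambda>x. \<Sum>i\<in>I. f i x)"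
  by (induction I rule: infinite_finite_induct) (auto intro: smooth_closure.base smooth_closure.const smooth_closure.add smooth_closure.mult smooth_closure.inv)

lemma smooth_closure_step:
  assumes "smooth_closure U h"
  shows "(\<forall>x\<in>U. h differentiable (at x)) \<and> (\<forall>i. \<exists>g. smooth_closure U g \<and> (\<forall>x\<in>U. pd i h x = g x))"
  using assms
proof induction
  case (base f)
  then show ?case using smooth_funD smooth_fun_pd smooth_closure.base by blast
next
  case (const c)
  then show ?case using smooth_closure.const by fastforce
next
  case (add f g)
  show ?case
  proof (intro conjI allI)
    fix i
    obtain f' g' where "smooth_closure U f'" "\<forall>x\<in>U. pd i f x = f' x"
      "smooth_closure U g'" "\<forall>x\<in>U. pd i g x = g' x" using add.IH by meson
    then show "\<exists>h. smooth_closure U h \<and> (\<forall>x\<in>U. pd i (\<lambda>x. f x + g x) x = h x)"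
      using add.IH by (intro exI[of _ "\<lambda>x. f' x + g' x"]) (auto simp: pd_add intro: smooth_closure.add)
  qed (use add in auto)
next
  case (mult f g)
  show ?case
  proof (intro conjI allI)
    fix i
    obtain f' g' where "smooth_closure U f'" "\<forall>x\<in>U. pd i f x = f' x"
      "smooth_closure U g'" "\<forall>x\<in>U. pd i g x = g' x" using mult.IH by meson
    then show "\<exists>h. smooth_closure U h \<and> (\<forall>x\<in>U. pd i (\<lambda>x. f x * g x) x = h x)"
      using mult by (intro exI[of _ "\<lambda>x. f' x * g x + f x * g' x"])
        (auto simp: pd_mult intro!: smooth_closure.add smooth_closure.mult)
  qed (use mult in auto)
next
  case (inv f)
  show ?case
  proof (intro conjI allI)
    fix i
    obtain f' where "smooth_closure U f'" "\<forall>x\<in>U. pd i f x = f' x" using inv.IH by meson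
    then have "smooth_closure U (\<lambda>x. (- 1) * (f' x * (inverse (f x) * inverse (f x))))"
      using inv by (intro smooth_closure.mult smooth_closure.const smooth_closure.inv)
    then show "\<exists>h. smooth_closure U h \<and> (\<forall>x\<in>U. pd i (\<lambda>x. inverse (f x)) x = h x)"
    proof (intro exI conjI ballI)
      fix x assume "x \<in> U"
      then show "pd i (\<lambda>x. inverse (f x)) x = (- 1) * (f' x * (inverse (f x) * inverse (f x)))"
        using inv \<open>\<forall>x\<in>U. pd i f x = f' x\<close> by (simp add: pd_inverse)
    qed
  next
    show "\<forall>x\<in>U. (\<lambda>x. inverse (f x)) differentiable (at x)"
      using inv by (auto intro!: differentiable_inverse)
  qed
next
  case (comp V h b)
  show ?case
  proof (intro conjI allI)
    fix i
    have "smooth_closure U (\<lambda>x. \<Sum>j\<in>UNIV. pd i (b j) x * pd j h (\<chi> j. b j x))"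
      using comp by (intro smooth_closure_sum smooth_closure.mult smooth_closure.base smooth_fun_pd
          smooth_closure.comp[of V "pd _ h"]) auto
    then show "\<exists>g. smooth_closure U g \<and> (\<forall>x\<in>U. pd i (\<lambda>x. h (\<chi> j. b j x)) x = g x)"
    proof (intro exI conjI ballI)
      fix x assume "x \<in> U"
      then show "pd i (\<lambda>x. h (\<chi> j. b j x)) x = (\<Sum>j\<in>UNIV. pd i (b j) x * pd j h (\<chi> j. b j x))"
        using comp by (intro pd_compose) (blast intro: smooth_funD)+
    qed
  next
    show "\<forall>x\<in>U. (\<lambda>x. h (\<chi> j. b j x)) differentiable (at x)"
    proof
      fix x assume "x \<in> U"
      then show "(\<lambda>x. h (\<chi> j. b j x)) differentiable (at x)"
        using comp by (intro differentiable_compose_vec) (blast intro: smooth_funD)+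
    qed
  qed
qed

lemma smooth_closure_smooth: "open U \<Longrightarrow> smooth_closure U h \<Longrightarrow> smooth_fun U h"
  by (rule smooth_fun_coinduct[where P = "smooth_closure U"]) (auto dest: smooth_closure_step)

lemma smooth_fun_const: "open U \<Longrightarrow> smooth_fun U (\<lambda>_. c)"
  by (intro smooth_closure_smooth smooth_closure.const)

lemma smooth_fun_add: "open U \<Longrightarrow> smooth_fun U f \<Longrightarrow> smooth_fun U g \<Longrightarrow> smooth_fun U (\<lambda>x. f x + g x)"
  by (rule smooth_closure_smooth) (auto intro: smooth_closure.base smooth_closure.const smooth_closure.add smooth_closure.mult smooth_closure.inv)

lemma smooth_fun_mult: "open U \<Longrightarrow> smooth_fun U f \<Longrightarrow> smooth_fun U g \<Longrightarrow> smooth_fun U (\<lambda>x. f x * g x)"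
  by (rule smooth_closure_smooth) (auto intro: smooth_closure.base smooth_closure.const smooth_closure.add smooth_closure.mult smooth_closure.inv)

lemma smooth_fun_sum:
  "open U \<Longrightarrow> (\<And>i. i \<in> I \<Longrightarrow> smooth_fun U (f i)) \<Longrightarrow> smooth_fun U (\<lambda>x. \<Sum>i\<in>I. f i x)"
  by (rule smooth_closure_smooth) (auto intro: smooth_closure_sum smooth_closure.base)

lemma smooth_fun_inverse:
  "open U \<Longrightarrow> smooth_fun U f \<Longrightarrow> (\<And>x. x \<in> U \<Longrightarrow> f x \<noteq> 0) \<Longrightarrow> smooth_fun U (\<lambda>x. inverse (f x))"
  by (rule smooth_closure_smooth) (auto intro: smooth_closure.base smooth_closure.const smooth_closure.add smooth_closure.mult smooth_closure.inv)

lemma smooth_fun_compose: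
  fixes b :: "'n::finite \<Rightarrow> real ^ 'n \<Rightarrow> real"
  assumes "open U" "smooth_fun V h" "\<And>j. smooth_fun U (b j)" "\<And>x. x \<in> U \<Longrightarrow> (\<chi> j. b j x) \<in> V"
  shows "smooth_fun U (\<lambda>x. h (\<chi> j. b j x))"
  by (rule smooth_closure_smooth[OF assms(1)], rule smooth_closure.comp[OF assms(2)]) (use assms in auto)

lemma smooth_fun_cong:
  assumes "open U" "\<And>x. x \<in> U \<Longrightarrow> f x = g x" "smooth_fun U f"
  shows "smooth_fun U g"
  unfolding smooth_fun_def
proof (intro allI ballI)
  fix "is" x assume x: "x \<in> U"
  have "iter_pd is f differentiable (at x)" using assms(3) x unfolding smooth_fun_def by blast
  moreover have "iter_pd is f y = iter_pd is g y" if "y \<in> U" for y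
    by (rule iter_pd_cong[OF assms(1) that assms(2)])
  ultimately show "iter_pd is g differentiable (at x)"
    using differentiable_cong[OF assms(1) x] by blast
qed

section \<open>Symmetry of second partial derivatives\<close>

lemma pd_DERIV:
  fixes k :: "real ^ 'n::finite \<Rightarrow> real"
  assumes "k differentiable (at (p + s *\<^sub>R axis l 1))"
  shows "((\<lambda>s. k (p + s *\<^sub>R axis l 1)) has_real_derivative pd l k (p + s *\<^sub>R axis l 1)) (at s)"
proof -
  have "((\<lambda>s. p + s *\<^sub>R axis l 1) has_derivative (\<lambda>s. s *\<^sub>R axis l 1)) (at s)"
    by (auto intro!: derivative_eq_intros)
  from has_derivative_compose[OF this has_derivative_pd[OF assms]]
  have "((\<lambda>s. k (p + s *\<^sub>R axis l 1)) has_derivative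
      (\<lambda>r. \<Sum>i\<in>UNIV. (r *\<^sub>R axis l 1) $ i * pd i k (p + s *\<^sub>R axis l 1))) (at s)" .
  moreover have "(\<lambda>r. \<Sum>i\<in>UNIV. (r *\<^sub>R axis l 1) $ i * pd i k (p + s *\<^sub>R axis l 1))
      = (*) (pd l k (p + s *\<^sub>R axis l 1))"
    by (simp add: fun_eq_iff mult.assoc sum_axis flip: sum_distrib_left)
  ultimately show ?thesis unfolding has_field_derivative_def by simp
qed

text \<open>The mean value theorem twice: first along \<open>axis i 1\<close>, for the difference of
  \<open>h\<close> in the direction \<open>axis j 1\<close>, then along \<open>axis j 1\<close>, for
  \<open>pd i h\<close>.\<close>

lemma second_difference:
  fixes h :: "real ^ 'n::finite \<Rightarrow> real"
  assumes "0 < t"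
    and U: "\<And>s r. 0 \<le> s \<Longrightarrow> s \<le> t \<Longrightarrow> 0 \<le> r \<Longrightarrow> r \<le> t \<Longrightarrow> x + s *\<^sub>R axis i 1 + r *\<^sub>R axis j 1 \<in> U"
    and h: "\<And>y. y \<in> U \<Longrightarrow> h differentiable (at y)" "\<And>y. y \<in> U \<Longrightarrow> pd i h differentiable (at y)"
  shows "\<exists>s r. 0 < s \<and> s < t \<and> 0 < r \<and> r < t \<and>
    h (x + t *\<^sub>R axis i 1 + t *\<^sub>R axis j 1) - h (x + t *\<^sub>R axis i 1) - h (x + t *\<^sub>R axis j 1) + h x
      = t * t * pd j (pd i h) (x + s *\<^sub>R axis i 1 + r *\<^sub>R axis j 1)"
proof -
  let ?e = "axis i (1::real) :: real ^ 'n" and ?f = "axis j (1::real) :: real ^ 'n"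
  have dg: "((\<lambda>s. h ((x + t *\<^sub>R ?f) + s *\<^sub>R ?e) - h (x + s *\<^sub>R ?e)) has_real_derivative
      pd i h ((x + t *\<^sub>R ?f) + s *\<^sub>R ?e) - pd i h (x + s *\<^sub>R ?e)) (at s)" if "0 \<le> s" "s \<le> t" for s
    using U[OF that, of t] U[OF that, of 0] assms(1)
    by (intro DERIV_diff pd_DERIV h) (simp_all add: add.assoc add.commute[of "t *\<^sub>R ?f"])
  obtain s where s: "0 < s" "s < t"
    "(h ((x + t *\<^sub>R ?f) + t *\<^sub>R ?e) - h (x + t *\<^sub>R ?e)) - (h ((x + t *\<^sub>R ?f) + 0 *\<^sub>R ?e) - h (x + 0 *\<^sub>R ?e))
      = (t - 0) * (pd i h ((x + t *\<^sub>R ?f) + s *\<^sub>R ?e) - pd i h (x + s *\<^sub>R ?e))"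
    using MVT2[OF assms(1) dg] by blast
  have dk: "((\<lambda>r. pd i h ((x + s *\<^sub>R ?e) + r *\<^sub>R ?f)) has_real_derivative
      pd j (pd i h) ((x + s *\<^sub>R ?e) + r *\<^sub>R ?f)) (at r)" if "0 \<le> r" "r \<le> t" for r
    using U[OF _ _ that, of s] s by (intro pd_DERIV h) simp_all
  obtain r where r: "0 < r" "r < t" "pd i h ((x + s *\<^sub>R ?e) + t *\<^sub>R ?f) - pd i h ((x + s *\<^sub>R ?e) + 0 *\<^sub>R ?f)
      = (t - 0) * pd j (pd i h) ((x + s *\<^sub>R ?e) + r *\<^sub>R ?f)"
    using MVT2[OF assms(1) dk] by blast
  show ?thesis
  proof (intro exI conjI)
    have "x + t *\<^sub>R ?f + t *\<^sub>R ?e = x + t *\<^sub>R ?e + t *\<^sub>R ?f"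
      "x + t *\<^sub>R ?f + s *\<^sub>R ?e = x + s *\<^sub>R ?e + t *\<^sub>R ?f" by (simp_all add: algebra_simps)
    with s(3) have "h (x + t *\<^sub>R ?e + t *\<^sub>R ?f) - h (x + t *\<^sub>R ?e) - h (x + t *\<^sub>R ?f) + h x
        = t * (pd i h (x + s *\<^sub>R ?e + t *\<^sub>R ?f) - pd i h (x + s *\<^sub>R ?e))" by simp
    also have "\<dots> = t * t * pd j (pd i h) (x + s *\<^sub>R ?e + r *\<^sub>R ?f)" using r(3) by simp
    finally show "h (x + t *\<^sub>R ?e + t *\<^sub>R ?f) - h (x + t *\<^sub>R ?e) - h (x + t *\<^sub>R ?f) + h x
        = t * t * pd j (pd i h) (x + s *\<^sub>R ?e + r *\<^sub>R ?f)" .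
  qed (use s r in auto)
qed

text \<open>Schwarz's theorem: one second difference equals t^2 times either mixed derivative at
  some point near \<open>x\<close>, and both mixed derivatives are continuous at
  \<open>x\<close>.\<close>

lemma pd_commute:
  fixes h :: "real ^ 'n::finite \<Rightarrow> real"
  assumes U: "open U" "x \<in> U" and h: "smooth_fun U h"
  shows "pd i (pd j h) x = pd j (pd i h) x"
proof (rule ccontr)
  let ?e = "axis i (1::real) :: real ^ 'n" and ?f = "axis j (1::real) :: real ^ 'n"
  \<comment> \<open>Half the supposed gap: two deviations below \<epsilon> cannot bridge it.\<close>
  define \<epsilon> where "\<epsilon> = \<bar>pd i (pd j h) x - pd j (pd i h) x\<bar> / 2"
  assume "pd i (pd j h) x \<noteq> pd j (pd i h) x"
  then have "\<epsilon> > 0" by (simp add: \<epsilon>_def)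
  have c: "isCont (pd a (pd b h)) x" for a b
    using smooth_funD[OF smooth_fun_pd[OF smooth_fun_pd[OF h]] U(2)]
    by (intro differentiable_imp_continuous_within)
  obtain d1 where d1: "d1 > 0" "\<And>y. dist y x < d1 \<Longrightarrow> dist (pd i (pd j h) y) (pd i (pd j h) x) < \<epsilon>"
    using c[of i j] \<open>\<epsilon> > 0\<close> unfolding continuous_at_eps_delta by blast
  obtain d2 where d2: "d2 > 0" "\<And>y. dist y x < d2 \<Longrightarrow> dist (pd j (pd i h) y) (pd j (pd i h) x) < \<epsilon>"
    using c[of j i] \<open>\<epsilon> > 0\<close> unfolding continuous_at_eps_delta by blast
  obtain d3 where d3: "d3 > 0" "\<And>y. dist y x < d3 \<Longrightarrow> y \<in> U"
    using U unfolding open_dist by blast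
  \<comment> \<open>The points in question lie within 2 t of \<open>x\<close>; the factor 3 makes
    the bounds strict.\<close>
  define t where "t = min d1 (min d2 d3) / 3"
  have t: "0 < t" "3 * t \<le> d1" "3 * t \<le> d2" "3 * t \<le> d3" using d1 d2 d3 by (auto simp: t_def)
  have near: "dist (x + s *\<^sub>R a + r *\<^sub>R b) x < 3 * t"
    if "0 \<le> s" "s \<le> t" "0 \<le> r" "r \<le> t" "norm a = 1" "norm b = 1" for s r and a b :: "real ^ 'n"
  proof -
    have "dist (x + s *\<^sub>R a + r *\<^sub>R b) x = norm (s *\<^sub>R a + r *\<^sub>R b)"
      by (simp add: dist_norm algebra_simps)
    also have "\<dots> \<le> s + r"
      using that norm_triangle_ineq[of "s *\<^sub>R a" "r *\<^sub>R b"] by simp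
    finally show ?thesis using that t by simp
  qed
  have inU: "x + s *\<^sub>R a + r *\<^sub>R b \<in> U"
    if "0 \<le> s" "s \<le> t" "0 \<le> r" "r \<le> t" "norm a = 1" "norm b = 1" for s r and a b :: "real ^ 'n"
    by (rule d3(2), rule order_less_le_trans[OF near[OF that] t(4)])
  have n: "norm ?e = 1" "norm ?f = 1" by (simp_all add: norm_axis_1)
  obtain s r where 1: "0 < s" "s < t" "0 < r" "r < t"
    "h (x + t *\<^sub>R ?e + t *\<^sub>R ?f) - h (x + t *\<^sub>R ?e) - h (x + t *\<^sub>R ?f) + h x
      = t * t * pd j (pd i h) (x + s *\<^sub>R ?e + r *\<^sub>R ?f)"
    using second_difference[OF t(1) inU[OF _ _ _ _ n] smooth_funD[OF h] smooth_funD[OF smooth_fun_pd[OF h]]]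
    by blast
  obtain s' r' where 2: "0 < s'" "s' < t" "0 < r'" "r' < t"
    "h (x + t *\<^sub>R ?f + t *\<^sub>R ?e) - h (x + t *\<^sub>R ?f) - h (x + t *\<^sub>R ?e) + h x
      = t * t * pd i (pd j h) (x + s' *\<^sub>R ?f + r' *\<^sub>R ?e)"
    using second_difference[OF t(1) inU[OF _ _ _ _ n(2,1)] smooth_funD[OF h] smooth_funD[OF smooth_fun_pd[OF h]]]
    by blast
  have "t * t * pd j (pd i h) (x + s *\<^sub>R ?e + r *\<^sub>R ?f) = t * t * pd i (pd j h) (x + s' *\<^sub>R ?f + r' *\<^sub>R ?e)"
  proof -
    have e: "x + t *\<^sub>R ?f + t *\<^sub>R ?e = x + t *\<^sub>R ?e + t *\<^sub>R ?f" by simp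
    have "a - b - c + d = a - c - b + d" for a b c d :: real by simp
    from trans[OF trans[OF 1(5)[symmetric] this] 2(5)[unfolded e]] show ?thesis .
  qed
  then have eq: "pd j (pd i h) (x + s *\<^sub>R ?e + r *\<^sub>R ?f) = pd i (pd j h) (x + s' *\<^sub>R ?f + r' *\<^sub>R ?e)"
    using t by simp
  have "dist (pd j (pd i h) (x + s *\<^sub>R ?e + r *\<^sub>R ?f)) (pd j (pd i h) x) < \<epsilon>"
    by (rule d2(2), rule order_less_le_trans[OF near t(3)]) (use 1 in simp_all)
  moreover have "dist (pd i (pd j h) (x + s' *\<^sub>R ?f + r' *\<^sub>R ?e)) (pd i (pd j h) x) < \<epsilon>"
    by (rule d1(2), rule order_less_le_trans[OF near t(2)]) (use 2 in simp_all)
  moreover have "dist (pd i (pd j h) x) (pd j (pd i h) x) = 2 * \<epsilon>"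
    by (simp add: \<epsilon>_def dist_real_def)
  ultimately show False
    using dist_triangle3[of "pd i (pd j h) x" "pd j (pd i h) x" "pd i (pd j h) (x + s' *\<^sub>R ?f + r' *\<^sub>R ?e)"]
    unfolding eq by linarith
qed

section \<open>Superfunctions\<close>

lemma coeff_sder_Inl: "coeff (sder (Inl i) f x) S = pd i (\<lambda>y. coeff (f y) S) x"
  by (simp, subst coeff_Abs) (simp_all add: coeff_infinite)

lemma smooth_sfun_cong:
  "open U \<Longrightarrow> (\<And>x. x \<in> U \<Longrightarrow> f x = g x) \<Longrightarrow> smooth_sfun U f \<Longrightarrow> smooth_sfun U g"
  unfolding smooth_sfun_def
proof
  fix S
  assume "open U" "\<And>x. x \<in> U \<Longrightarrow> f x = g x" "\<forall>S. smooth_fun U (\<lambda>x. coeff (f x) S)"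
  then show "smooth_fun U (\<lambda>x. coeff (g x) S)"
    by - (rule smooth_fun_cong[of U "\<lambda>x. coeff (f x) S"]; simp)
qed

lemma smooth_sfun_subset: "smooth_sfun U f \<Longrightarrow> V \<subseteq> U \<Longrightarrow> smooth_sfun V f"
  unfolding smooth_sfun_def using smooth_fun_subset by blast

lemma smooth_sfun_const: "open U \<Longrightarrow> smooth_sfun U (\<lambda>_. c)"
  unfolding smooth_sfun_def by (simp add: smooth_fun_const)

lemma smooth_sfun_add:
  "open U \<Longrightarrow> smooth_sfun U f \<Longrightarrow> smooth_sfun U g \<Longrightarrow> smooth_sfun U (\<lambda>x. f x + g x)"
  unfolding smooth_sfun_def coeff_basic by (simp add: smooth_fun_add)

lemma smooth_sfun_scaleR: "open U \<Longrightarrow> smooth_sfun U f \<Longrightarrow> smooth_sfun U (\<lambda>x. c *\<^sub>R f x)"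
  unfolding smooth_sfun_def coeff_basic by (simp add: smooth_fun_mult smooth_fun_const)

lemma smooth_sfun_uminus: "open U \<Longrightarrow> smooth_sfun U f \<Longrightarrow> smooth_sfun U (\<lambda>x. - f x)"
  using smooth_sfun_scaleR[of U f "- 1"] by simp

lemma smooth_sfun_diff:
  "open U \<Longrightarrow> smooth_sfun U f \<Longrightarrow> smooth_sfun U g \<Longrightarrow> smooth_sfun U (\<lambda>x. f x - g x)"
  using smooth_sfun_add[of U f "\<lambda>x. - g x"] smooth_sfun_uminus[of U g] by simp

lemma smooth_sfun_sum:
  "open U \<Longrightarrow> (\<And>i. i \<in> I \<Longrightarrow> smooth_sfun U (f i)) \<Longrightarrow> smooth_sfun U (\<lambda>x. \<Sum>i\<in>I. f i x)"
  unfolding smooth_sfun_def coeff_sum by (simp add: smooth_fun_sum)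

lemma smooth_sfun_mult:
  fixes f g :: "('n::{finite,linorder}, 'l::linorder) sfun"
  shows "open U \<Longrightarrow> smooth_sfun U f \<Longrightarrow> smooth_sfun U g \<Longrightarrow> smooth_sfun U (\<lambda>x. f x * g x)"
  unfolding smooth_sfun_def coeff_mult
  by (auto intro!: smooth_fun_sum smooth_fun_mult smooth_fun_const)

lemma smooth_sfun_of_real: "open U \<Longrightarrow> smooth_fun U h \<Longrightarrow> smooth_sfun U (\<lambda>x. of_real (h x) :: ('n::{finite,linorder}, 'l::linorder) gen grass)"
  unfolding smooth_sfun_def coeff_of_real
  by (intro allI, case_tac "S = {}") (simp_all add: smooth_fun_const)

lemma smooth_sfun_sder:
  fixes f :: "('n::{finite,linorder}, 'l::linorder) sfun"
  assumes "open U" "smooth_sfun U f"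
  shows "smooth_sfun U (sder A f)"
proof (cases A)
  case (Inl i)
  show ?thesis using assms unfolding smooth_sfun_def Inl coeff_sder_Inl by (simp add: smooth_fun_pd)
next
  case (Inr i)
  have "smooth_fun U (\<lambda>x. coeff (odd_pd i (f x)) S)" for S
  proof (cases "Theta i \<in> S")
    case False
    then have "(\<lambda>x. coeff (odd_pd i (f x)) S) = (\<lambda>x. gsign {Theta i} S * coeff (f x) (insert (Theta i) S))"
      by (simp add: coeff_odd_pd)
    then show ?thesis using assms by (auto simp: smooth_sfun_def intro!: smooth_fun_mult smooth_fun_const)
  qed (simp add: coeff_odd_pd smooth_fun_const assms(1))
  then show ?thesis unfolding smooth_sfun_def Inr by simp
qed

text \<open>The sign rule for moving a derivation of parity \<open>p\<close> past an element that need not be homogeneous.\<close>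

definition twist :: "nat \<Rightarrow> 'g::linorder grass \<Rightarrow> 'g grass"
  where "twist p a = (if even p then a else gi a)"

lemma twist_parity: "has_parity q a \<Longrightarrow> twist p a = (- 1) ^ (p * q) *\<^sub>R a"
  unfolding twist_def has_parity_iff by (auto elim!: oddE simp: power_add power_mult)

lemma twist_even: "has_parity 0 a \<Longrightarrow> twist p a = a"
  using twist_parity[of 0] by simp

section \<open>Rules for the left derivatives of superfunctions\<close>

lemma sder_cong:
  assumes "open U" "x \<in> U" "\<And>y. y \<in> U \<Longrightarrow> f y = g y"
  shows "sder A f x = sder A g x"
proof (cases A)
  case (Inl i)
  have "coeff (sder A f x) S = coeff (sder A g x) S" for S
    unfolding Inl coeff_sder_Inl by (rule pd_cong[OF assms(1,2)]) (simp add: assms(3))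
  then show ?thesis by (simp add: grass_eqI)
qed (use assms in simp)

lemma smooth_sfunD: "smooth_sfun U f \<Longrightarrow> x \<in> U \<Longrightarrow> (\<lambda>x. coeff (f x) S) differentiable (at x)"
  unfolding smooth_sfun_def using smooth_funD by blast

lemma sder_add:
  assumes "x \<in> U" "smooth_sfun U f" "smooth_sfun U g"
  shows "sder A (\<lambda>x. f x + g x) x = sder A f x + sder A g x"
proof (cases A)
  case (Inl i)
  show ?thesis unfolding Inl
    by (rule grass_eqI) (simp only: coeff_sder_Inl coeff_basic pd_add smooth_sfunD[OF assms(2,1)] smooth_sfunD[OF assms(3,1)])
qed simp

lemma sder_scaleR:
  assumes "x \<in> U" "smooth_sfun U f"
  shows "sder A (\<lambda>x. c *\<^sub>R f x) x = c *\<^sub>R sder A f x"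
proof (cases A)
  case (Inl i)
  show ?thesis unfolding Inl
    by (rule grass_eqI) (simp only: coeff_sder_Inl coeff_basic pd_cmult smooth_sfunD[OF assms(2,1)])
qed simp

lemma sder_uminus:
  "x \<in> U \<Longrightarrow> smooth_sfun U f \<Longrightarrow> sder A (\<lambda>x. - f x) x = - sder A f x"
  using sder_scaleR[of x U f A "- 1"] by simp

lemma sder_const [simp]: "sder A (\<lambda>_. of_real c) x = 0"
proof (cases A)
  case (Inl i)
  show ?thesis unfolding Inl
    by (rule grass_eqI) (simp only: coeff_sder_Inl pd_const coeff_basic)
qed simp

lemma sder_zero [simp]: "sder A (\<lambda>_. 0) x = 0"
  using sder_const[of A 0 x] by simp

lemma sder_one [simp]: "sder A (\<lambda>_. 1) x = 0"
  using sder_const[of A 1 x] by simp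

lemma sder_sum:
  assumes "open U" "x \<in> U" "\<And>i. i \<in> I \<Longrightarrow> smooth_sfun U (f i)"
  shows "sder A (\<lambda>x. \<Sum>i\<in>I. f i x) x = (\<Sum>i\<in>I. sder A (f i) x)"
  using assms(3)
proof (induction I rule: infinite_finite_induct)
  case (insert i I)
  then show ?case using sder_add[OF assms(2), of "f i" "\<lambda>x. \<Sum>i\<in>I. f i x" A] assms(1)
    by (simp add: smooth_sfun_sum)
qed simp_all

lemma sder_mult:
  fixes f g :: "('n::{finite,linorder}, 'l::linorder) sfun"
  assumes "open U" "x \<in> U" "smooth_sfun U f" "smooth_sfun U g"
  shows "sder A (\<lambda>x. f x * g x) x = sder A f x * g x + twist (cpar A) (f x) * sder A g x"
proof (cases A)
  case (Inl i)
  have "coeff (sder A (\<lambda>x. f x * g x) x) S = coeff (sder A f x * g x + f x * sder A g x) S" for S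
  proof -
    have df: "(\<lambda>x. coeff (f x) T) differentiable (at x)" for T by (rule smooth_sfunD[OF assms(3,2)])
    have dg: "(\<lambda>x. coeff (g x) T) differentiable (at x)" for T by (rule smooth_sfunD[OF assms(4,2)])
    have "pd i (\<lambda>y. \<Sum>T\<in>Pow S. gsign T (S - T) * coeff (f y) T * coeff (g y) (S - T)) x
       = (\<Sum>T\<in>Pow S. pd i (\<lambda>y. gsign T (S - T) * coeff (f y) T * coeff (g y) (S - T)) x)"
      by (rule pd_sum) (auto intro!: derivative_intros df dg)
    also have "\<dots> = (\<Sum>T\<in>Pow S. gsign T (S - T) * (pd i (\<lambda>y. coeff (f y) T) x) * coeff (g x) (S - T)
       + gsign T (S - T) * coeff (f x) T * pd i (\<lambda>y. coeff (g y) (S - T)) x)"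
      by (intro sum.cong refl, subst pd_mult) (auto simp: pd_cmult df dg intro!: derivative_intros)
    finally show ?thesis
      unfolding Inl coeff_sder_Inl plus_grass.rep_eq coeff_mult sum.distrib .
  qed
  then show ?thesis by (simp add: grass_eqI Inl twist_def)
qed (simp add: odd_pd_mult twist_def)

lemma has_parity_sder:
  fixes f :: "('n::{finite,linorder}, 'l::linorder) sfun"
  assumes "open U" "x \<in> U" "\<And>y. y \<in> U \<Longrightarrow> has_parity p (f y)"
  shows "has_parity (p + cpar A) (sder A f x)"
proof (cases A)
  case (Inl i)
  have "coeff (sder A f x) S = 0" if "card S mod 2 \<noteq> p mod 2" for S
  proof -
    have "pd i (\<lambda>y. coeff (f y) S) x = pd i (\<lambda>_. 0) x"
      by (rule pd_cong[OF assms(1,2)]) (use assms(3) that in \<open>auto simp: has_parity_def\<close>)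
    then show ?thesis by (simp add: Inl coeff_sder_Inl del: sder.simps)
  qed
  then show ?thesis unfolding has_parity_def Inl by auto
next
  case (Inr i)
  show ?thesis
    using assms(3)[OF assms(2)] unfolding Inr has_parity_iff by (simp add: gi_odd_pd)
qed

text \<open>The coefficients of an odd derivative are those of the function, relabelled with
  constant signs, so odd derivatives commute with even ones. Two even ones commute by Schwarz's
  theorem, and two odd ones anticommute.\<close>

lemma sder_commute:
  fixes f :: "('n::{finite,linorder}, 'l::linorder) sfun"
  assumes "open U" "x \<in> U" "smooth_sfun U f"
  shows "sder A (sder B f) x = (- 1) ^ (cpar A * cpar B) *\<^sub>R sder B (sder A f) x"
proof -
  have mixed: "sder (Inl i) (sder (Inr j) f) x = sder (Inr j) (sder (Inl i) f) x" for i j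
  proof (rule grass_eqI)
    fix S
    show "coeff (sder (Inl i) (sder (Inr j) f) x) S = coeff (sder (Inr j) (sder (Inl i) f) x) S"
      unfolding coeff_sder_Inl sder.simps(2) coeff_odd_pd
      using pd_cmult[OF smooth_sfunD[OF assms(3,2)]] by auto
  qed
  show ?thesis
  proof (cases A; cases B)
    fix i j assume AB: "A = Inl i" "B = Inl j"
    have "coeff (sder (Inl i) (sder (Inl j) f) x) S = coeff (sder (Inl j) (sder (Inl i) f) x) S" for S
      unfolding coeff_sder_Inl by (rule pd_commute[OF assms(1,2)]) (use assms(3) in \<open>simp add: smooth_sfun_def\<close>)
    then show ?thesis unfolding AB by (simp add: grass_eqI)
  next
    fix i j assume AB: "A = Inr i" "B = Inr j"
    then show ?thesis by (simp add: odd_pd_anticommute[of i j])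
  qed (use mixed in \<open>simp_all del: sder.simps\<close>)
qed

lemma sder_coord: "sder A (coord B) x = (if A = B then 1 else 0)"
proof (rule grass_eqI)
  fix S
  show "coeff (sder A (coord B) x) S = coeff (if A = B then 1 else 0) S"
  proof (cases A; cases B)
    fix i j assume AB: "A = Inl i" "B = Inl j"
    show ?thesis
    proof (cases "S = {}")
      case True
      then show ?thesis unfolding AB coeff_sder_Inl by (simp add: coeff_of_real pd_nth coeff_basic)
    next
      case False
      then show ?thesis unfolding AB coeff_sder_Inl by (simp add: coeff_of_real coeff_basic)
    qed
  next
    fix i j assume AB: "A = Inl i" "B = Inr j"
    then show ?thesis unfolding AB coeff_sder_Inl by (simp add: coeff_basic)
  qed (auto simp: coeff_odd_pd coeff_gen coeff_basic)
qed

section \<open>The Taylor extension of smooth functions\<close>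

definition taylor_term ::
  "nat \<Rightarrow> (real ^ 'n::finite \<Rightarrow> real) \<Rightarrow> ('n + 'n \<Rightarrow> 'g::linorder grass) \<Rightarrow> 'g grass"
  where "taylor_term k h X = (\<Sum>is | length is = k. (iter_pd is h (pt_body X) / fact k) *\<^sub>R
    prod_list (map (\<lambda>i. soul (X (Inl i))) is))"

lemma finite_lists_length: "finite {is :: 'n::finite list. length is = k}"
  using finite_lists_length_eq[of "UNIV :: 'n set" k] by simp

lemma lists_length_le: "{is. length is \<le> m} = (\<Union>k\<in>{..m}. {is. length is = k})"
  by auto

lemma taylor_ext_lsum: "taylor_ext h X = lsum (\<lambda>k. taylor_term k h X)"
proof -
  have *: "(\<Sum>is | length is \<le> m. (iter_pd is h (pt_body X) / fact (length is)) *\<^sub>R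
      prod_list (map (\<lambda>i. soul (X (Inl i))) is)) = (\<Sum>k\<le>m. taylor_term k h X)" for m
  proof -
    show ?thesis
      unfolding taylor_term_def lists_length_le
      by (subst sum.UNION_disjoint) (auto simp: finite_lists_length)
  qed
  show ?thesis unfolding taylor_ext_def lsum_def * ..
qed

lemma taylor_term_0: "taylor_term 0 h X = of_real (h (pt_body X))"
  by (simp add: taylor_term_def of_real_def)

lemma even_soul: "has_parity 0 a \<Longrightarrow> has_parity 0 (soul a)"
  unfolding soul_def by (intro has_parity_diff has_parity_of_real)

lemma even_prod_list:
  "(\<And>a. a \<in> set as \<Longrightarrow> has_parity 0 (f a)) \<Longrightarrow> has_parity 0 (prod_list (map f as))"
  for f :: "_ \<Rightarrow> 'g::linorder grass"
proof (induction as)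
  case (Cons a as)
  then show ?case using has_parity_mult[of 0 "f a" 0 "prod_list (map f as)"] by simp
qed simp

definition superpoint :: "('n + 'n \<Rightarrow> 'g::linorder grass) \<Rightarrow> bool"
  where "superpoint X \<longleftrightarrow> (\<forall>A. has_parity (cpar A) (X A))"

lemma superpoint_even: "superpoint X \<Longrightarrow> has_parity 0 (X (Inl i))"
  unfolding superpoint_def by (metis cpar.simps(1))

lemma superpoint_odd: "superpoint X \<Longrightarrow> has_parity 1 (X (Inr i))"
  unfolding superpoint_def by (metis cpar.simps(2))

text \<open>Splits off the innermost derivative, the last entry of the list; its soul factor is even
  and moves to the front. This recursion carries the later inductions on the order of a Taylor
  term.\<close>

lemma taylor_term_Suc:
  assumes "superpoint X"
  shows "taylor_term (Suc k) h X = (1 / Suc k) *\<^sub>R (\<Sum>i\<in>UNIV. soul (X (Inl i)) * taylor_term k (pd i h) X)"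
proof -
  let ?u = "\<lambda>i. soul (X (Inl i))"
  have ev: "has_parity 0 (?u i)" for i
    by (intro even_soul superpoint_even assms)
  have "taylor_term (Suc k) h X = (\<Sum>(i, is)\<in>UNIV \<times> {is. length is = k}.
      (iter_pd (is @ [i]) h (pt_body X) / fact (Suc k)) *\<^sub>R prod_list (map ?u (is @ [i])))"
    unfolding taylor_term_def
    by (rule sum.reindex_bij_witness[of _ "\<lambda>(i, is). is @ [i]" "\<lambda>is. (last is, butlast is)"])
      (auto simp: length_Suc_conv_rev)
  also have "\<dots> = (\<Sum>(i, is)\<in>UNIV \<times> {is. length is = k}. (1 / Suc k) *\<^sub>R
      (?u i * ((iter_pd is (pd i h) (pt_body X) / fact k) *\<^sub>R prod_list (map ?u is))))"
  proof (rule sum.cong[OF refl])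
    fix x :: "'a \<times> 'a list"
    obtain i "is" where x: "x = (i, is)" by fastforce
    have "prod_list (map ?u (is @ [i])) = ?u i * prod_list (map ?u is)"
      using even_commute[OF ev, of i "prod_list (map ?u is)"] by simp
    then show "(case x of (i, is) \<Rightarrow> (iter_pd (is @ [i]) h (pt_body X) / fact (Suc k)) *\<^sub>R prod_list (map ?u (is @ [i])))
      = (case x of (i, is) \<Rightarrow>
          (1 / Suc k) *\<^sub>R (?u i * ((iter_pd is (pd i h) (pt_body X) / fact k) *\<^sub>R prod_list (map ?u is))))"
      by (simp add: x iter_pd_append)
  qed
  also have "\<dots> = (1 / Suc k) *\<^sub>R (\<Sum>i\<in>UNIV. ?u i * taylor_term k (pd i h) X)"
    by (simp add: taylor_term_def sum_distrib_left scaleR_sum_right sum.cartesian_product case_prod_unfold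
        del: of_nat_Suc)
  finally show ?thesis .
qed

lemma taylor_term_cong:
  assumes "open U" "pt_body X \<in> U" "\<And>y. y \<in> U \<Longrightarrow> f y = g y"
  shows "taylor_term k f X = taylor_term k g X"
  unfolding taylor_term_def using iter_pd_cong[OF assms] by simp

lemma even_taylor_term: "superpoint X \<Longrightarrow> has_parity 0 (taylor_term k h X)"
  unfolding taylor_term_def
  by (intro has_parity_sum has_parity_scaleR even_prod_list even_soul superpoint_even)

lemma gdeg_taylor_term: "gdeg k (taylor_term k h X)"
proof -
  have "gdeg (length is) (prod_list (map (\<lambda>i. soul (X (Inl i))) is))" for "is"
  proof (induction "is")
    case (Cons i "is")
    then show ?case using gdeg_mult[OF gdeg_soul Cons.IH, of "X (Inl i)"] by simp
  qed simp
  then show ?thesis unfolding taylor_term_def by (auto intro!: gdeg_sum gdeg_scaleR)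
qed

lemma taylor_term_add:
  assumes "open U" "pt_body X \<in> U" "smooth_fun U f" "smooth_fun U g" "superpoint X"
  shows "taylor_term k (\<lambda>x. f x + g x) X = taylor_term k f X + taylor_term k g X"
  using assms(3,4)
proof (induction k arbitrary: f g)
  case (Suc k)
  have "taylor_term k (pd i (\<lambda>x. f x + g x)) X = taylor_term k (pd i f) X + taylor_term k (pd i g) X" for i
    using taylor_term_cong[OF assms(1,2), of "pd i (\<lambda>x. f x + g x)" "\<lambda>x. pd i f x + pd i g x" k]
      Suc.IH[of "pd i f" "pd i g"] Suc.prems by (simp add: pd_add smooth_funD smooth_fun_pd)
  then show ?case
    by (simp add: taylor_term_Suc[OF assms(5)] sum.distrib algebra_simps)
qed (simp add: taylor_term_0)

lemma taylor_term_cmult: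
  assumes "open U" "pt_body X \<in> U" "smooth_fun U f" "superpoint X"
  shows "taylor_term k (\<lambda>x. c * f x) X = c *\<^sub>R taylor_term k f X"
  using assms(3)
proof (induction k arbitrary: f)
  case (Suc k)
  have "taylor_term k (pd i (\<lambda>x. c * f x)) X = c *\<^sub>R taylor_term k (pd i f) X" for i
    using taylor_term_cong[OF assms(1,2), of "pd i (\<lambda>x. c * f x)" "\<lambda>x. c * pd i f x" k]
      Suc.IH[of "pd i f"] Suc.prems by (simp add: pd_cmult smooth_funD smooth_fun_pd)
  then show ?case
    by (simp add: taylor_term_Suc[OF assms(4)] scaleR_sum_right mult.commute)
qed (simp add: taylor_term_0 of_real_def)

text \<open>Both sides satisfy the recursion of \<open>taylor_term_Suc\<close>: on the right,
  differentiating one or the other factor yields the weights p and k + 1 - p, whose sum is the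
  weight k + 1 on the left.\<close>

lemma taylor_term_mult:
  assumes "open U" "pt_body X \<in> U" "smooth_fun U f" "smooth_fun U g" "superpoint X"
  shows "taylor_term k (\<lambda>x. f x * g x) X = (\<Sum>p\<le>k. taylor_term p f X * taylor_term (k - p) g X)"
  using assms(3,4)
proof (induction k arbitrary: f g)
  case (Suc k)
  let ?t = "\<lambda>k h. taylor_term k h X" and ?u = "\<lambda>i. soul (X (Inl i))"
  have ts: "real (Suc k) *\<^sub>R ?t (Suc k) h = (\<Sum>i\<in>UNIV. ?u i * ?t k (pd i h))" for k h
    by (simp add: taylor_term_Suc[OF assms(5)] del: of_nat_Suc)
  have 1: "?t k (pd i (\<lambda>x. f x * g x))
      = (\<Sum>p\<le>k. ?t p (pd i f) * ?t (k - p) g) + (\<Sum>p\<le>k. ?t p f * ?t (k - p) (pd i g))" for i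
  proof -
    have "?t k (pd i (\<lambda>x. f x * g x)) = ?t k (\<lambda>x. pd i f x * g x + f x * pd i g x)"
      by (rule taylor_term_cong[OF assms(1,2)]) (use Suc.prems in \<open>simp add: pd_mult smooth_funD\<close>)
    also have "\<dots> = ?t k (\<lambda>x. pd i f x * g x) + ?t k (\<lambda>x. f x * pd i g x)"
      by (rule taylor_term_add[OF assms(1,2) _ _ assms(5)])
        (use Suc.prems assms(1) in \<open>auto intro!: smooth_fun_mult smooth_fun_pd\<close>)
    finally show ?thesis using Suc.IH Suc.prems by (simp add: smooth_fun_pd)
  qed
  have c: "?u i * (a * b) = a * (?u i * b)" if "has_parity 0 a" for i a b
    using even_commute[OF that, of "?u i"] by (simp flip: mult.assoc)
  have "real (Suc k) *\<^sub>R ?t (Suc k) (\<lambda>x. f x * g x)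
      = (\<Sum>i\<in>UNIV. \<Sum>p\<le>k. ?u i * ?t p (pd i f) * ?t (k - p) g)
      + (\<Sum>i\<in>UNIV. \<Sum>p\<le>k. ?t p f * (?u i * ?t (k - p) (pd i g)))"
    unfolding ts 1 distrib_left sum.distrib sum_distrib_left
    by (simp add: c even_taylor_term assms(5) mult.assoc)
  also have "\<dots> = (\<Sum>p\<le>k. (\<Sum>i\<in>UNIV. ?u i * ?t p (pd i f)) * ?t (k - p) g)
      + (\<Sum>p\<le>k. ?t p f * (\<Sum>i\<in>UNIV. ?u i * ?t (k - p) (pd i g)))"
    unfolding sum_distrib_left sum_distrib_right by (intro arg_cong2[of _ _ _ _ "(+)"]; rule sum.swap)
  also have "\<dots> = (\<Sum>p\<le>k. real (Suc p) *\<^sub>R (?t (Suc p) f * ?t (k - p) g))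
      + (\<Sum>p\<le>k. real (Suc (k - p)) *\<^sub>R (?t p f * ?t (Suc (k - p)) g))"
    unfolding ts[symmetric] by simp
  \<comment> \<open>An index shift; the added term at p = 0 has weight 0.\<close>
  also have "(\<Sum>p\<le>k. real (Suc p) *\<^sub>R (?t (Suc p) f * ?t (k - p) g))
      = (\<Sum>p\<le>Suc k. real p *\<^sub>R (?t p f * ?t (Suc k - p) g))"
    by (subst sum.atMost_Suc_shift) simp
  \<comment> \<open>Here the added term is the one at p = k + 1, again of weight 0.\<close>
  also have "(\<Sum>p\<le>k. real (Suc (k - p)) *\<^sub>R (?t p f * ?t (Suc (k - p)) g))
      = (\<Sum>p\<le>Suc k. real (Suc k - p) *\<^sub>R (?t p f * ?t (Suc k - p) g))"
    by (simp add: Suc_diff_le add_diff_eq)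
  also have "(\<Sum>p\<le>Suc k. real p *\<^sub>R (?t p f * ?t (Suc k - p) g))
      + (\<Sum>p\<le>Suc k. real (Suc k - p) *\<^sub>R (?t p f * ?t (Suc k - p) g))
      = real (Suc k) *\<^sub>R (\<Sum>p\<le>Suc k. ?t p f * ?t (Suc k - p) g)"
    unfolding sum.distrib[symmetric] scaleR_sum_right
    by (rule sum.cong) (simp_all add: of_nat_diff del: of_nat_Suc flip: scaleR_add_left)
  finally show ?case by (simp del: of_nat_Suc)
qed (simp add: taylor_term_0)

lemma even_taylor_ext: "superpoint X \<Longrightarrow> has_parity 0 (taylor_ext h X)"
  unfolding taylor_ext_lsum by (intro has_parity_lsum even_taylor_term)

lemma taylor_ext_cong:
  assumes "open U" "pt_body X \<in> U" "\<And>y. y \<in> U \<Longrightarrow> f y = g y"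
  shows "taylor_ext f X = taylor_ext g X"
  unfolding taylor_ext_lsum using taylor_term_cong[OF assms] by simp

lemma coeff_taylor_ext:
  "card R \<le> m \<Longrightarrow> coeff (taylor_ext h X) R = coeff (\<Sum>k\<le>m. taylor_term k h X) R"
  unfolding taylor_ext_lsum by (rule coeff_lsum[OF gdeg_taylor_term])

lemma taylor_ext_mult:
  assumes "open U" "pt_body X \<in> U" "smooth_fun U f" "smooth_fun U g" "superpoint X"
  shows "taylor_ext (\<lambda>x. f x * g x) X = taylor_ext f X * taylor_ext g X"
  unfolding taylor_ext_lsum lsum_mult[OF gdeg_taylor_term gdeg_taylor_term] taylor_term_mult[OF assms] ..

lemma taylor_ext_add:
  assumes "open U" "pt_body X \<in> U" "smooth_fun U f" "smooth_fun U g" "superpoint X"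
  shows "taylor_ext (\<lambda>x. f x + g x) X = taylor_ext f X + taylor_ext g X"
  by (rule grass_eqI) (simp add: coeff_taylor_ext[OF order_refl] taylor_term_add[OF assms] sum.distrib coeff_basic)

lemma taylor_ext_cmult:
  assumes "open U" "pt_body X \<in> U" "smooth_fun U f" "superpoint X"
  shows "taylor_ext (\<lambda>x. c * f x) X = c *\<^sub>R taylor_ext f X"
  by (rule grass_eqI) (simp add: coeff_taylor_ext[OF order_refl] taylor_term_cmult[OF assms] coeff_basic
      flip: scaleR_sum_right)

lemma taylor_ext_zero [simp]: "taylor_ext (\<lambda>_. 0) X = 0"
  by (rule grass_eqI) (simp add: coeff_taylor_ext[OF order_refl] taylor_term_def coeff_basic)

lemma taylor_ext_sum:
  assumes "open U" "pt_body X \<in> U" "\<And>i. i \<in> I \<Longrightarrow> smooth_fun U (f i)" "superpoint X"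
  shows "taylor_ext (\<lambda>x. \<Sum>i\<in>I. f i x) X = (\<Sum>i\<in>I. taylor_ext (f i) X)"
  using assms(3)
proof (induction I rule: infinite_finite_induct)
  case (insert i I)
  then show ?case
    using taylor_ext_add[OF assms(1,2) _ _ assms(4), of "f i" "\<lambda>x. \<Sum>i\<in>I. f i x"] assms(1)
    by (simp add: smooth_fun_sum)
qed simp_all

lemma body_taylor_ext: "body (taylor_ext h X) = h (pt_body X)"
  unfolding body_def using coeff_taylor_ext[of "{}" 0 h X]
  by (simp add: taylor_term_0 coeff_of_real)

section \<open>Derivatives of the Taylor extension\<close>

lemma at_pt_apply: "at_pt \<phi> y A = \<phi> A y"
  by (simp add: at_pt_def)

lemma is_smap_superpoint: "is_smap V U \<phi> \<Longrightarrow> y \<in> V \<Longrightarrow> superpoint (at_pt \<phi> y)"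
  by (simp add: is_smap_def superpoint_def at_pt_apply)

lemma is_smap_body: "is_smap V U \<phi> \<Longrightarrow> y \<in> V \<Longrightarrow> pt_body (at_pt \<phi> y) \<in> U"
  by (auto simp: is_smap_def smap_body_def)

lemma is_smap_smooth: "is_smap V U \<phi> \<Longrightarrow> smooth_sfun V (\<phi> A)"
  by (simp add: is_smap_def)

lemma is_smap_parity: "is_smap V U \<phi> \<Longrightarrow> y \<in> V \<Longrightarrow> has_parity (cpar A) (\<phi> A y)"
  by (simp add: is_smap_def)

lemma smooth_fun_body: "smooth_sfun V f \<Longrightarrow> smooth_fun V (\<lambda>y. body (f y))"
  by (simp add: smooth_sfun_def body_def)

lemma smooth_sfun_body:
  fixes f :: "('n::{finite,linorder}, 'l::linorder) sfun"
  shows "open V \<Longrightarrow> smooth_sfun V f \<Longrightarrow> smooth_sfun V (\<lambda>y. of_real (body (f y)) :: ('n, 'l) gen grass)"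
  by (intro smooth_sfun_of_real smooth_fun_body)

lemma smooth_sfun_soul:
  fixes f :: "('n::{finite,linorder}, 'l::linorder) sfun"
  shows "open V \<Longrightarrow> smooth_sfun V f \<Longrightarrow> smooth_sfun V (\<lambda>y. soul (f y))"
  unfolding soul_def by (intro smooth_sfun_diff smooth_sfun_body)

lemma smooth_fun_smap_body:
  assumes "open V" "is_smap V U \<phi>" "smooth_fun U h"
  shows "smooth_fun V (\<lambda>y. h (pt_body (at_pt \<phi> y)))"
  unfolding pt_body_def at_pt_def
  by (rule smooth_fun_compose[OF assms(1,3)])
    (use is_smap_body[OF assms(2)] in \<open>auto simp: pt_body_def at_pt_def intro: smooth_fun_body is_smap_smooth[OF assms(2)]\<close>)

lemma smooth_taylor_term:
  fixes \<phi> :: "('n::{finite,linorder}, 'l::linorder) smap"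
  assumes "open V" "is_smap V U \<phi>" "smooth_fun U h"
  shows "smooth_sfun V (\<lambda>y. taylor_term k h (at_pt \<phi> y))"
  using assms(3)
proof (induction k arbitrary: h)
  case 0
  show ?case unfolding taylor_term_0
    by (intro smooth_sfun_of_real smooth_fun_smap_body[OF assms(1,2)] assms(1) 0)
next
  case (Suc k)
  have "smooth_sfun V (\<lambda>y. (1 / Suc k) *\<^sub>R
      (\<Sum>i\<in>UNIV. soul (\<phi> (Inl i) y) * taylor_term k (pd i h) (at_pt \<phi> y)))"
    by (intro smooth_sfun_scaleR smooth_sfun_sum smooth_sfun_mult smooth_sfun_soul assms(1)
        is_smap_smooth[OF assms(2)] Suc.IH smooth_fun_pd Suc.prems)
  then show ?case
  proof (rule smooth_sfun_cong[OF assms(1), rotated])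
    fix y assume "y \<in> V"
    show "(1 / Suc k) *\<^sub>R (\<Sum>i\<in>UNIV. soul (\<phi> (Inl i) y) * taylor_term k (pd i h) (at_pt \<phi> y))
        = taylor_term (Suc k) h (at_pt \<phi> y)"
      unfolding taylor_term_Suc[OF is_smap_superpoint[OF assms(2) \<open>y \<in> V\<close>]] at_pt_apply ..
  qed
qed

lemma smooth_taylor_ext:
  fixes \<phi> :: "('n::{finite,linorder}, 'l::linorder) smap"
  assumes "open V" "is_smap V U \<phi>" "smooth_fun U h"
  shows "smooth_sfun V (\<lambda>y. taylor_ext h (at_pt \<phi> y))"
  unfolding smooth_sfun_def
proof
  fix R :: "('n, 'l) gen set"
  have "smooth_sfun V (\<lambda>y. \<Sum>k\<le>card R. taylor_term k h (at_pt \<phi> y))"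
    by (intro smooth_sfun_sum assms(1) smooth_taylor_term[OF assms])
  then show "smooth_fun V (\<lambda>y. coeff (taylor_ext h (at_pt \<phi> y)) R)"
    unfolding coeff_taylor_ext[OF order_refl] smooth_sfun_def by blast
qed

lemma sder_of_real:
  "sder A (\<lambda>y. of_real (h y)) y = (case A of Inl i \<Rightarrow> of_real (pd i h y) | Inr _ \<Rightarrow> 0)"
proof (cases A)
  case (Inl i)
  have "coeff (sder (Inl i) (\<lambda>y. of_real (h y)) y) S = coeff (of_real (pd i h y)) S" for S
    unfolding coeff_sder_Inl coeff_of_real by (cases "S = {}") simp_all
  then have "sder (Inl i) (\<lambda>y. of_real (h y)) y = (of_real (pd i h y) :: ('a, 'b) gen grass)"
    by (rule grass_eqI)
  then show ?thesis unfolding Inl by simp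
qed simp

text \<open>Each coordinate function is split into body and soul. Differentiating a body keeps the
  order \<open>k\<close>, differentiating a soul lowers it by one; only after summation over all
  orders do the two parts combine to the derivative of \<phi>.\<close>

lemma sder_taylor_term:
  fixes \<phi> :: "('n::{finite,linorder}, 'l::linorder) smap"
  assumes "open V" "y \<in> V" "is_smap V U \<phi>" "open U" "smooth_fun U h"
  shows "sder A (\<lambda>y. taylor_term k h (at_pt \<phi> y)) y =
    (\<Sum>j\<in>UNIV. sder A (\<lambda>y. of_real (body (\<phi> (Inl j) y))) y * taylor_term k (pd j h) (at_pt \<phi> y))
    + (case k of 0 \<Rightarrow> 0 | Suc k' \<Rightarrow>
        (\<Sum>j\<in>UNIV. sder A (\<lambda>y. soul (\<phi> (Inl j) y)) y * taylor_term k' (pd j h) (at_pt \<phi> y)))"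
  using assms(5)
proof (induction k arbitrary: h)
  case 0
  show ?case
  proof (cases A)
    case (Inl i)
    have "pd i (\<lambda>y. h (\<chi> j. body (\<phi> (Inl j) y))) y
        = (\<Sum>j\<in>UNIV. pd i (\<lambda>y. body (\<phi> (Inl j) y)) y * pd j h (\<chi> j. body (\<phi> (Inl j) y)))"
    proof (rule pd_compose)
      show "(\<lambda>y. body (\<phi> (Inl j) y)) differentiable (at y)" for j
        using smooth_funD[OF smooth_fun_body[OF is_smap_smooth[OF assms(3)]] assms(2)] .
      show "h differentiable (at (\<chi> j. body (\<phi> (Inl j) y)))"
        using smooth_funD[OF 0 is_smap_body[OF assms(3,2)]] by (simp add: pt_body_def at_pt_def)
    qed
    then show ?thesis
      unfolding taylor_term_0 sder_of_real Inl by (simp add: pt_body_def at_pt_def)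
  qed (simp add: taylor_term_0)
next
  case (Suc k)
  let ?t = "\<lambda>k h. taylor_term k h (at_pt \<phi> y)" and ?u = "\<lambda>i. soul (\<phi> (Inl i) y)"
  let ?db = "\<lambda>j. sder A (\<lambda>y. of_real (body (\<phi> (Inl j) y))) y" and ?du = "\<lambda>j. sder A (\<lambda>y. soul (\<phi> (Inl j) y)) y"
  have sp: "superpoint (at_pt \<phi> y)" if "y \<in> V" for y by (rule is_smap_superpoint[OF assms(3) that])
  have ts: "(\<Sum>i\<in>UNIV. ?u i * ?t k (pd i h)) = real (Suc k) *\<^sub>R ?t (Suc k) h" for k h
    by (simp add: taylor_term_Suc[OF sp[OF assms(2)]] at_pt_apply del: of_nat_Suc)
  have ev: "has_parity 0 (?u i)" for i
    using even_soul[OF superpoint_even[OF sp[OF assms(2)]], of i] by (simp add: at_pt_apply)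
  have c: "?u i * (d * t) = d * (?u i * t)" for i d t
    using even_commute[OF ev, of i d] by (simp flip: mult.assoc)
  have comm: "?t k (pd i (pd j h)) = ?t k (pd j (pd i h))" for i j k
    by (rule taylor_term_cong[OF assms(4) is_smap_body[OF assms(3,2)]]) (rule pd_commute[OF assms(4) _ Suc.prems])
  have smt: "smooth_sfun V (\<lambda>y. soul (\<phi> (Inl i) y) * taylor_term k (pd i h) (at_pt \<phi> y))" for i
    by (intro smooth_sfun_mult smooth_sfun_soul assms(1) is_smap_smooth[OF assms(3)]
        smooth_taylor_term[OF assms(1,3)] smooth_fun_pd Suc.prems)
  \<comment> \<open>What the induction hypothesis contributes from derivatives of souls. It amounts
    to \<open>k\<close> copies of the expected sum; the product rule in the recursion supplies the
    missing one.\<close>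
  define Q where "Q = (case k of 0 \<Rightarrow> 0 | Suc k' \<Rightarrow> (\<Sum>j\<in>UNIV. \<Sum>i\<in>UNIV. ?du j * (?u i * ?t k' (pd i (pd j h)))))"
  have Q: "Q = real k *\<^sub>R (\<Sum>j\<in>UNIV. ?du j * ?t k (pd j h))"
  proof (cases k)
    case (Suc k')
    have "Q = (\<Sum>j\<in>UNIV. ?du j * (\<Sum>i\<in>UNIV. ?u i * ?t k' (pd i (pd j h))))"
      unfolding Q_def Suc by (simp add: sum_distrib_left)
    then show ?thesis unfolding ts Suc by (simp add: scaleR_sum_right)
  qed (simp add: Q_def)
  have "sder A (\<lambda>y. taylor_term (Suc k) h (at_pt \<phi> y)) y
      = sder A (\<lambda>y. (1 / Suc k) *\<^sub>R (\<Sum>i\<in>UNIV. soul (\<phi> (Inl i) y) * taylor_term k (pd i h) (at_pt \<phi> y))) y"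
  proof (rule sder_cong[OF assms(1,2)])
    fix y assume "y \<in> V"
    show "taylor_term (Suc k) h (at_pt \<phi> y)
      = (1 / Suc k) *\<^sub>R (\<Sum>i\<in>UNIV. soul (\<phi> (Inl i) y) * taylor_term k (pd i h) (at_pt \<phi> y))"
      unfolding taylor_term_Suc[OF sp[OF \<open>y \<in> V\<close>]] at_pt_apply ..
  qed
  also have "\<dots> = (1 / Suc k) *\<^sub>R (\<Sum>i\<in>UNIV. sder A (\<lambda>y. soul (\<phi> (Inl i) y) * taylor_term k (pd i h) (at_pt \<phi> y)) y)"
    unfolding sder_scaleR[OF assms(2) smooth_sfun_sum[OF assms(1) smt]] sder_sum[OF assms(1,2) smt] ..
  also have "(\<Sum>i\<in>UNIV. sder A (\<lambda>y. soul (\<phi> (Inl i) y) * taylor_term k (pd i h) (at_pt \<phi> y)) y)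
     = (\<Sum>i\<in>UNIV. ?du i * ?t k (pd i h) + ?u i * sder A (\<lambda>y. taylor_term k (pd i h) (at_pt \<phi> y)) y)"
    by (rule sum.cong[OF refl], subst sder_mult[OF assms(1,2)])
      (auto simp: twist_even ev intro!: smooth_sfun_soul assms(1) is_smap_smooth[OF assms(3)]
        smooth_taylor_term[OF assms(1,3)] smooth_fun_pd Suc.prems)
  also have "\<dots> = (\<Sum>i\<in>UNIV. ?du i * ?t k (pd i h)) + (\<Sum>i\<in>UNIV. \<Sum>j\<in>UNIV. ?db j * (?u i * ?t k (pd j (pd i h)))) 
      + (\<Sum>i\<in>UNIV. case k of 0 \<Rightarrow> 0 | Suc k' \<Rightarrow> (\<Sum>j\<in>UNIV. ?du j * (?u i * ?t k' (pd j (pd i h)))))"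
    unfolding Suc.IH[OF smooth_fun_pd[OF Suc.prems]] distrib_left sum.distrib
    by (cases k) (simp_all add: sum_distrib_left c add.assoc)
  also have "(\<Sum>i\<in>UNIV. \<Sum>j\<in>UNIV. ?db j * (?u i * ?t k (pd j (pd i h))))
      = (\<Sum>j\<in>UNIV. ?db j * (\<Sum>i\<in>UNIV. ?u i * ?t k (pd i (pd j h))))"
    unfolding sum_distrib_left by (subst sum.swap, simp only: comm)
  also have "\<dots> = real (Suc k) *\<^sub>R (\<Sum>j\<in>UNIV. ?db j * ?t (Suc k) (pd j h))"
    unfolding ts by (simp add: scaleR_sum_right)
  also have "(\<Sum>i\<in>UNIV. case k of 0 \<Rightarrow> 0 | Suc k' \<Rightarrow> (\<Sum>j\<in>UNIV. ?du j * (?u i * ?t k' (pd j (pd i h))))) = Q"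
    unfolding Q_def comm[of _ i for i]
    by (cases k) (simp_all, subst sum.swap, simp add: comm)
  finally have "sder A (\<lambda>y. taylor_term (Suc k) h (at_pt \<phi> y)) y
    = (1 / Suc k) *\<^sub>R (real (Suc k) *\<^sub>R (\<Sum>j\<in>UNIV. ?db j * ?t (Suc k) (pd j h))
       + real (Suc k) *\<^sub>R (\<Sum>j\<in>UNIV. ?du j * ?t k (pd j h)))"
    unfolding Q by (simp add: algebra_simps)
  then show ?case by (simp add: scaleR_add_right del: of_nat_Suc)
qed

text \<open>An odd derivative reads the coefficient at the larger set
  \<open>insert (Theta i) R\<close>. Hence a truncation that is correct one degree higher is
  enough.\<close>

lemma coeff_sder_local:
  assumes "card R < m" "\<And>y S. card S \<le> m \<Longrightarrow> S \<subseteq> range Theta \<union> R \<Longrightarrow> coeff (f y) S = coeff (g y) S"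
  shows "coeff (sder A f y) R = coeff (sder A g y) R"
proof (cases A)
  case (Inl i)
  then show ?thesis using assms(2)[of R] assms(1) unfolding Inl coeff_sder_Inl by (simp add: subset_iff)
next
  case (Inr i)
  have "card (insert (Theta i) R) \<le> m"
    using assms(1) card_insert_le_m1[of m R] by (cases "finite R") (auto simp: card_insert_if)
  then show ?thesis using assms(2)[of "insert (Theta i) R" y] unfolding Inr by (simp add: coeff_odd_pd subset_iff)
qed

lemma sder_taylor_ext:
  fixes \<phi> :: "('n::{finite,linorder}, 'l::linorder) smap"
  assumes "open V" "y \<in> V" "is_smap V U \<phi>" "open U" "smooth_fun U h"
  shows "sder A (\<lambda>y. taylor_ext h (at_pt \<phi> y)) y
    = (\<Sum>j\<in>UNIV. sder A (\<phi> (Inl j)) y * taylor_ext (pd j h) (at_pt \<phi> y))"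
proof (rule grass_eqI)
  fix R :: "('n, 'l) gen set"
  assume R: "finite R"
  let ?t = "\<lambda>k h. taylor_term k h (at_pt \<phi> y)"
  let ?db = "\<lambda>j. sder A (\<lambda>y. of_real (body (\<phi> (Inl j) y))) y" and ?du = "\<lambda>j. sder A (\<lambda>y. soul (\<phi> (Inl j) y)) y"
  define m where "m = card R"
  have d: "sder A (\<phi> (Inl j)) y = ?db j + ?du j" for j
    using sder_add[OF assms(2) smooth_sfun_body[OF assms(1) is_smap_smooth[OF assms(3)], of "Inl j"]
        smooth_sfun_soul[OF assms(1) is_smap_smooth[OF assms(3)], of "Inl j"], of A]
    by (simp add: soul_def)
  have t: "coeff (x * taylor_ext g (at_pt \<phi> y)) R = coeff (x * (\<Sum>k\<le>n. ?t k g)) R" if "m \<le> n" for x g n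
    by (rule coeff_mult_cong[OF refl coeff_taylor_ext]) (use that R card_mono in \<open>auto simp: m_def intro: order_trans\<close>)
  \<comment> \<open>The series is cut at order \<open>Suc m\<close> because an odd derivative lowers
    the degree by one; afterwards the surplus order is invisible at \<open>R\<close>.\<close>
  have "coeff (sder A (\<lambda>y. taylor_ext h (at_pt \<phi> y)) y) R
      = coeff (sder A (\<lambda>y. \<Sum>k\<le>Suc m. taylor_term k h (at_pt \<phi> y)) y) R"
    by (rule coeff_sder_local[where m = "Suc m"]) (auto simp: m_def coeff_taylor_ext)
  also have "sder A (\<lambda>y. \<Sum>k\<le>Suc m. taylor_term k h (at_pt \<phi> y)) y
      = (\<Sum>k\<le>Suc m. sder A (\<lambda>y. taylor_term k h (at_pt \<phi> y)) y)"
    by (rule sder_sum[OF assms(1,2) smooth_taylor_term[OF assms(1,3,5)]])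
  also have "\<dots> = (\<Sum>k\<le>Suc m. \<Sum>j\<in>UNIV. ?db j * ?t k (pd j h)) + (\<Sum>k\<le>m. \<Sum>j\<in>UNIV. ?du j * ?t k (pd j h))"
    unfolding sder_taylor_term[OF assms] sum.distrib
    by (intro arg_cong2[of _ _ _ _ "(+)"] refl, subst sum.atMost_Suc_shift, simp)
  also have "\<dots> = (\<Sum>j\<in>UNIV. ?db j * (\<Sum>k\<le>Suc m. ?t k (pd j h))) + (\<Sum>j\<in>UNIV. ?du j * (\<Sum>k\<le>m. ?t k (pd j h)))"
    unfolding sum_distrib_left by (intro arg_cong2[of _ _ _ _ "(+)"]; rule sum.swap)
  also have "coeff \<dots> R = (\<Sum>j\<in>UNIV. coeff (?db j * taylor_ext (pd j h) (at_pt \<phi> y)) R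
      + coeff (?du j * taylor_ext (pd j h) (at_pt \<phi> y)) R)"
    unfolding plus_grass.rep_eq coeff_sum t[of "Suc m", OF le_SucI[OF order_refl]] sum.distrib
    by (simp only: t[of m, OF order_refl, symmetric] t[of "Suc m", OF le_SucI[OF order_refl], symmetric])
  also have "\<dots> = coeff (\<Sum>j\<in>UNIV. sder A (\<phi> (Inl j)) y * taylor_ext (pd j h) (at_pt \<phi> y)) R"
    unfolding d distrib_right coeff_sum plus_grass.rep_eq ..
  finally show "coeff (sder A (\<lambda>y. taylor_ext h (at_pt \<phi> y)) y) R
    = coeff (\<Sum>j\<in>UNIV. sder A (\<phi> (Inl j)) y * taylor_ext (pd j h) (at_pt \<phi> y)) R" .
qed

section \<open>Monomials in the substituted coordinates\<close>

definition gen_value ::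
  "('n + 'n \<Rightarrow> ('n::linorder, 'l::linorder) gen grass) \<Rightarrow> ('n, 'l) gen \<Rightarrow> ('n, 'l) gen grass"
  where "gen_value X g = (case g of Theta i \<Rightarrow> X (Inr i) | Xi l \<Rightarrow> gen (Xi l))"

lemma gen_value_simps: "gen_value X (Theta i) = X (Inr i)" "gen_value X (Xi l) = gen (Xi l)"
  by (simp_all add: gen_value_def)

lemma gen_value_at_pt: "gen_value (at_pt \<phi> y) (Theta i) = \<phi> (Inr i) y"
  by (simp add: gen_value_simps at_pt_apply)

lemma odd_gen_value: "superpoint X \<Longrightarrow> has_parity 1 (gen_value X g)"
  by (cases g) (simp_all only: gen_value_simps superpoint_odd has_parity_gen)

lemma subst_monomial_empty: "subst_monomial X {} = 1"
  by (simp add: subst_monomial_def)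

text \<open>A generator below all others goes to the front of the sorted product, so no sign
  appears.\<close>

lemma subst_monomial_insert_min:
  assumes "finite S" "\<forall>a\<in>S. g < a"
  shows "subst_monomial X (insert g S) = gen_value X g * subst_monomial X S"
proof -
  have "g \<notin> S" using assms by auto
  then have "sorted_list_of_set (insert g S) = insort g (sorted_list_of_set S)"
    using assms by (simp add: sorted_list_of_set_insert)
  also have "\<dots> = g # sorted_list_of_set S"
    using assms by (intro insort_is_Cons) (auto intro: less_imp_le)
  finally show ?thesis unfolding subst_monomial_def gen_value_def by simp
qed

lemma parity_subst_monomial:
  assumes "superpoint X" "finite S"
  shows "has_parity (card S) (subst_monomial X S)"
  using assms(2)
proof (induction S rule: finite_linorder_min_induct)
  case (insert b A)
  have "b \<notin> A" using insert by auto
  then show ?case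
    using has_parity_mult[OF odd_gen_value[OF assms(1)] insert.IH, of b] insert
    by (simp add: subst_monomial_insert_min)
qed (simp add: subst_monomial_empty)

lemma body_subst_monomial:
  assumes "superpoint X" "finite S" "S \<noteq> {}"
  shows "body (subst_monomial X S) = 0"
  using assms(2,3)
proof (induction S rule: finite_linorder_min_induct)
  case (insert b A)
  show ?case
    unfolding subst_monomial_insert_min[OF insert(1,2)] by (simp add: body_odd[OF odd_gen_value[OF assms(1)]])
qed simp

lemma gsign_singletons: "gsign {g} {b} = (if b < g then - 1 else 1)"
proof -
  have "{(s, t). s \<in> {g} \<and> t \<in> {b} \<and> t < s} = (if b < g then {(g, b)} else {})" by auto
  then show ?thesis unfolding gsign_def by simp
qed

lemma gsign_min: "\<forall>a\<in>S. g \<le> a \<Longrightarrow> gsign {g} S = 1"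
proof -
  assume "\<forall>a\<in>S. g \<le> a"
  then have *: "{(s, t). s \<in> {g} \<and> t \<in> S \<and> t < s} = {}" by force
  show ?thesis unfolding gsign_def * by simp
qed

text \<open>The factors are odd. Moving the new one to its place costs a sign for each smaller
  generator, which is \<open>gsign\<close>; on meeting itself it gives a square, hence 0.\<close>

lemma subst_monomial_insert:
  assumes "superpoint X" "finite S"
  shows "gen_value X g * subst_monomial X S
    = (if g \<in> S then 0 else gsign {g} S *\<^sub>R subst_monomial X (insert g S))"
  using assms(2)
proof (induction S rule: finite_linorder_min_induct)
  case empty
  show ?case using subst_monomial_insert_min[of "{}" g X] by (simp add: subst_monomial_empty)
next
  case (insert b A)
  note b = subst_monomial_insert_min[OF insert(1,2), of X]
  have odd: "has_parity 1 (gen_value X g)" for g by (rule odd_gen_value[OF assms(1)])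
  consider "g < b" | "g = b" | "b < g" by force
  then show ?case
  proof cases
    case 1
    then have m: "\<forall>a\<in>insert b A. g < a" using insert by auto
    then have "g \<notin> insert b A" "gsign {g} (insert b A) = 1"
      by (auto intro!: gsign_min less_imp_le)
    then show ?thesis using subst_monomial_insert_min[OF _ m] insert by simp
  next
    case 2
    then show ?thesis using odd_square[OF odd, of g] unfolding b by (simp flip: mult.assoc)
  next
    case 3
    have nb: "b \<notin> A" using insert by auto
    have "gen_value X g * subst_monomial X (insert b A)
        = - (gen_value X b * (gen_value X g * subst_monomial X A))"
      unfolding b mult.assoc[symmetric] odd_anticommute[OF odd odd, of g b] by simp
    also have "\<dots> = (if g \<in> A then 0 else - gsign {g} A *\<^sub>R (gen_value X b * subst_monomial X (insert g A)))"
      unfolding insert.IH by simp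
    also have "gen_value X b * subst_monomial X (insert g A) = subst_monomial X (insert b (insert g A))"
      by (rule subst_monomial_insert_min[symmetric]) (use insert 3 in auto)
    also have "- gsign {g} A = gsign {g} (insert b A)"
      using gsign_insert_right[of "{g}" A b] gsign_singletons[of g b] 3 insert nb by simp
    finally show ?thesis using 3 by (auto simp: insert_commute)
  qed
qed

text \<open>The substituted values multiply by the same sign rule as the generators; this is what
  makes substitution multiplicative.\<close>

lemma subst_monomial_mult:
  assumes "superpoint X" "finite S" "finite T"
  shows "subst_monomial X S * subst_monomial X T
    = (if S \<inter> T = {} then gsign S T *\<^sub>R subst_monomial X (S \<union> T) else 0)"
  using assms(2)
proof (induction S rule: finite_linorder_min_induct)
  case (insert b A)
  have b: "b \<notin> A" "gsign {b} A = 1" using insert(2) by (auto intro!: gsign_min less_imp_le)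
  have "subst_monomial X (insert b A) * subst_monomial X T
      = gen_value X b * (subst_monomial X A * subst_monomial X T)"
    using insert by (simp add: subst_monomial_insert_min mult.assoc)
  also have "\<dots> = (if A \<inter> T = {} \<and> b \<notin> T then
      (gsign A T * gsign {b} (A \<union> T)) *\<^sub>R subst_monomial X (insert b (A \<union> T)) else 0)"
    unfolding insert.IH using subst_monomial_insert[OF assms(1), of "A \<union> T" b] insert(1) assms(3) b by simp
  also have "\<dots> = (if insert b A \<inter> T = {} then gsign (insert b A) T *\<^sub>R subst_monomial X (insert b A \<union> T) else 0)"
  proof (cases "insert b A \<inter> T = {}")
    case True
    then have "gsign {b} (A \<union> T) = gsign {b} A * gsign {b} T"
      using insert(1) assms(3) by (intro gsign_Un_right) auto
    moreover have "gsign (insert b A) T = gsign {b} T * gsign A T"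
      using insert(1) assms(3) b by (intro gsign_insert_left) auto
    ultimately show ?thesis using True b by (simp add: mult.commute)
  qed auto
  finally show ?case .
qed (simp add: subst_monomial_empty)

lemma smooth_gen_value:
  fixes \<phi> :: "('n::{finite,linorder}, 'l::linorder) smap"
  assumes "open V" "is_smap V U \<phi>"
  shows "smooth_sfun V (\<lambda>y. gen_value (at_pt \<phi> y) g)"
  by (cases g) (simp_all add: gen_value_simps at_pt_apply is_smap_smooth[OF assms(2)] smooth_sfun_const[OF assms(1)])

lemma smooth_subst_monomial:
  fixes \<phi> :: "('n::{finite,linorder}, 'l::linorder) smap"
  assumes "open V" "is_smap V U \<phi>" "finite S"
  shows "smooth_sfun V (\<lambda>y. subst_monomial (at_pt \<phi> y) S)"
  using assms(3)
proof (induction S rule: finite_linorder_min_induct)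
  case (insert b A)
  show ?case unfolding subst_monomial_insert_min[OF insert(1,2)]
    by (intro smooth_sfun_mult smooth_gen_value[OF assms(1,2)] insert.IH assms(1))
qed (simp add: subst_monomial_empty smooth_sfun_const assms(1))

lemma sder_gen: "sder A (\<lambda>_. gen (Xi l)) x = 0"
proof (rule grass_eqI)
  fix S :: "('a, 'b) gen set"
  show "coeff (sder A (\<lambda>_. gen (Xi l)) x) S = coeff 0 S"
  proof (cases A)
    case (Inl i)
    show ?thesis unfolding Inl coeff_sder_Inl by (simp add: coeff_basic)
  qed (auto simp: coeff_odd_pd coeff_gen coeff_basic)
qed

lemma finite_Theta: "finite S \<Longrightarrow> finite {a. Theta a \<in> S}"
  using finite_vimageI[of S Theta] by (simp add: inj_on_def vimage_def)

text \<open>Each factor from some \<open>Theta a\<close> is replaced by its derivative, which is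
  then moved to the front; \<open>gsign {Theta a} S\<close> counts the factors passed, whatever the
  parity of the derivation.\<close>

lemma sder_subst_monomial:
  fixes \<phi> :: "('n::{finite,linorder}, 'l::linorder) smap"
  assumes "open V" "y \<in> V" "is_smap V U \<phi>" "finite S"
  shows "sder A (\<lambda>y. subst_monomial (at_pt \<phi> y) S) y = (\<Sum>a | Theta a \<in> S.
    gsign {Theta a} S *\<^sub>R (sder A (\<phi> (Inr a)) y * subst_monomial (at_pt \<phi> y) (S - {Theta a})))"
  using assms(4)
proof (induction S rule: finite_linorder_min_induct)
  case empty
  show ?case by (simp add: subst_monomial_empty)
next
  case (insert b S)
  let ?X = "at_pt \<phi> y" and ?p = "cpar A"
  have X: "superpoint ?X" by (rule is_smap_superpoint[OF assms(3,2)])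
  have "sder A (\<lambda>y. subst_monomial (at_pt \<phi> y) (insert b S)) y
      = sder A (\<lambda>y. gen_value (at_pt \<phi> y) b) y * subst_monomial ?X S
       + twist ?p (gen_value ?X b) * sder A (\<lambda>y. subst_monomial (at_pt \<phi> y) S) y"
    unfolding subst_monomial_insert_min[OF insert(1,2)]
    by (rule sder_mult[OF assms(1,2) smooth_gen_value[OF assms(1,3)] smooth_subst_monomial[OF assms(1,3) insert(1)]])
  also have "\<dots> = (\<Sum>a | Theta a \<in> insert b S.
    gsign {Theta a} (insert b S) *\<^sub>R (sder A (\<phi> (Inr a)) y * subst_monomial ?X (insert b S - {Theta a})))"
  proof (cases b)
    case (Xi l)
    \<comment> \<open>In the order of generators every \<open>Theta\<close> precedes every
      \<open>Xi\<close>: if the minimum is some \<open>Xi l\<close>, no odd coordinate is left to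
      differentiate.\<close>
    have no: "Theta a \<notin> insert b S" for a
      using insert(2) Xi by (auto simp: less_gen_def)
    then show ?thesis unfolding insert.IH by (simp add: Xi gen_value_simps sder_gen)
  next
    case (Theta c)
    have nb: "b \<notin> S" using insert(2) by auto
    have set: "{a. Theta a \<in> insert b S} = insert c {a. Theta a \<in> S}" "c \<notin> {a. Theta a \<in> S}"
      using nb unfolding Theta by auto
    have tc: "gsign {Theta c} (insert b S) *\<^sub>R (sder A (\<phi> (Inr c)) y * subst_monomial ?X (insert b S - {Theta c}))
      = sder A (\<phi> (Inr c)) y * subst_monomial ?X S"
    proof -
      have "gsign {b} (insert b S) = 1" using insert(2) by (intro gsign_min) auto
      moreover have "insert b S - {b} = S" using nb by auto
      ultimately show ?thesis unfolding Theta by simp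
    qed
    \<comment> \<open>The sign of the derivation passing \<open>\<phi> (Inr c)\<close> and the sign
      of moving the differentiated factor back over it multiply to -1 for either parity of
      \<open>A\<close>.\<close>
    have ta: "twist ?p (\<phi> (Inr c) y) * (gsign {Theta a} S *\<^sub>R (sder A (\<phi> (Inr a)) y * subst_monomial ?X (S - {Theta a})))
       = gsign {Theta a} (insert b S) *\<^sub>R (sder A (\<phi> (Inr a)) y * subst_monomial ?X (insert b S - {Theta a}))"
      if "Theta a \<in> S" for a
    proof -
      have lt: "b < Theta a" using insert(2) that by auto
      have "has_parity (cpar (Inr a) + ?p) (sder A (\<phi> (Inr a)) y)"
        by (rule has_parity_sder[OF assms(1,2) is_smap_parity[OF assms(3)]])
      then have "\<phi> (Inr c) y * sder A (\<phi> (Inr a)) y = (- 1) ^ (1 + ?p) *\<^sub>R (sder A (\<phi> (Inr a)) y * \<phi> (Inr c) y)"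
        using supercommute[OF is_smap_parity[OF assms(3,2), of "Inr c"]] by fastforce
      moreover have "twist ?p (\<phi> (Inr c) y) = (- 1) ^ ?p *\<^sub>R \<phi> (Inr c) y"
        using twist_parity[OF is_smap_parity[OF assms(3,2), of "Inr c"], of ?p] by simp
      moreover have "(- 1::real) ^ ?p * (- 1) ^ (1 + ?p) = - 1" by (simp flip: power_mult_distrib)
      ultimately have "twist ?p (\<phi> (Inr c) y) * sder A (\<phi> (Inr a)) y = - (sder A (\<phi> (Inr a)) y * \<phi> (Inr c) y)"
        by simp
      moreover have "gsign {Theta a} (insert b S) = - gsign {Theta a} S"
        using gsign_insert_right[of "{Theta a}" S b] gsign_singletons[of "Theta a" b] lt insert(1) nb by simp
      moreover have "\<phi> (Inr c) y * subst_monomial ?X (S - {Theta a}) = subst_monomial ?X (insert b S - {Theta a})"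
      proof -
        have "insert b S - {Theta a} = insert b (S - {Theta a})" using lt by auto
        moreover have "subst_monomial ?X (insert b (S - {Theta a})) = gen_value ?X b * subst_monomial ?X (S - {Theta a})"
          by (rule subst_monomial_insert_min) (use insert in auto)
        ultimately show ?thesis unfolding Theta gen_value_at_pt by simp
      qed
      ultimately show ?thesis
        by (simp flip: mult.assoc) (simp add: mult.assoc)
    qed
    show ?thesis
      unfolding set(1) sum.insert[OF finite_Theta[OF insert(1)] set(2)] tc insert.IH sum_distrib_left
      unfolding Theta gen_value_at_pt
      by (intro arg_cong2[of _ _ _ _ "(+)"] sum.cong) (use ta[unfolded Theta] in auto)
  qed
  finally show ?case .
qed

section \<open>Substitution is a homomorphism and satisfies the chain rule\<close>

text \<open>\<open>seval\<close> sums over a set of monomials that depends on the coefficient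
  \<open>R\<close>. With a common finite \<open>P\<close> all terms of an identity share one index
  set.\<close>

definition seval_upto ::
  "('n, 'l) gen set \<Rightarrow> ('n::{finite,linorder}, 'l::linorder) sfun \<Rightarrow> ('n + 'n \<Rightarrow> ('n, 'l) gen grass) \<Rightarrow> ('n, 'l) gen grass"
  where "seval_upto P f X = (\<Sum>S\<in>Pow P. taylor_ext (\<lambda>x. coeff (f x) S) X * subst_monomial X S)"

lemma coeff_gen_mult: "g \<notin> R \<Longrightarrow> coeff (gen g * a) R = 0"
  unfolding coeff_mult by (rule sum.neutral) (auto simp: coeff_gen)

text \<open>Substitution leaves each \<open>Xi l\<close> fixed, so a monomial containing a
  \<open>Xi l\<close> outside \<open>R\<close> keeps that factor and cannot contribute at
  \<open>R\<close>.\<close>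

lemma coeff_seval:
  assumes "superpoint X" "finite P" "range Theta \<union> R \<subseteq> P"
  shows "coeff (seval f X) R = coeff (seval_upto P f X) R"
proof -
  have R: "finite R" using assms by (auto intro: finite_subset)
  have "coeff (seval f X) R = coeff (seval_upto (range Theta \<union> R) f X) R"
    unfolding seval_def seval_upto_def using R by (subst coeff_Abs) auto
  also have "\<dots> = coeff (seval_upto P f X) R"
    unfolding seval_upto_def coeff_sum
  proof (rule sum.mono_neutral_left)
    show "\<forall>S\<in>Pow P - Pow (range Theta \<union> R). coeff (taylor_ext (\<lambda>x. coeff (f x) S) X * subst_monomial X S) R = 0"
    proof
      fix S assume S: "S \<in> Pow P - Pow (range Theta \<union> R)"
      then obtain g where g: "g \<in> S" "g \<notin> range Theta \<union> R" by auto
      then obtain l where l: "g = Xi l" by (cases g) auto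
      have "finite S" using S assms(2) by (auto intro: finite_subset)
      then have "gen_value X g * subst_monomial X (S - {g}) = gsign {g} (S - {g}) *\<^sub>R subst_monomial X S"
        using subst_monomial_insert[OF assms(1), of "S - {g}" g] g(1) by (simp add: insert_absorb)
      then have "gsign {g} (S - {g}) *\<^sub>R (gen g * subst_monomial X (S - {g}))
          = (gsign {g} (S - {g}) * gsign {g} (S - {g})) *\<^sub>R subst_monomial X S"
        by (simp add: l gen_value_simps)
      then have m: "subst_monomial X S = gsign {g} (S - {g}) *\<^sub>R (gen g * subst_monomial X (S - {g}))"
        by (simp add: gsign_square)
      show "coeff (taylor_ext (\<lambda>x. coeff (f x) S) X * subst_monomial X S) R = 0"
        unfolding even_commute[OF even_taylor_ext[OF assms(1)]] m
        using g(2) by (simp add: mult.assoc coeff_gen_mult coeff_basic)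
    qed
  qed (use assms in \<open>auto intro: finite_subset\<close>)
  finally show ?thesis .
qed

lemma seval_eqI:
  fixes a :: "('n::{finite,linorder}, 'l::linorder) gen grass"
  assumes "\<And>P R. finite P \<Longrightarrow> range Theta \<union> R \<subseteq> P \<Longrightarrow> coeff a R = coeff b R"
  shows "a = b"
  using assms[of "range Theta \<union> _"] by (intro grass_eqI) auto

lemma seval_cong:
  assumes "open U" "pt_body X \<in> U" "\<And>y. y \<in> U \<Longrightarrow> f y = g y"
  shows "seval f X = seval g X"
proof -
  have "taylor_ext (\<lambda>x. coeff (f x) S) X = taylor_ext (\<lambda>x. coeff (g x) S) X" for S
    by (rule taylor_ext_cong[OF assms(1,2)]) (simp add: assms(3))
  then have *: "(\<lambda>S. taylor_ext (\<lambda>x. coeff (f x) S) X) = (\<lambda>S. taylor_ext (\<lambda>x. coeff (g x) S) X)"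
    by (rule ext)
  show ?thesis unfolding seval_def fun_cong[OF *] ..
qed

lemma seval_add:
  assumes "superpoint X" "open U" "pt_body X \<in> U" "smooth_sfun U f" "smooth_sfun U g"
  shows "seval (\<lambda>x. f x + g x) X = seval f X + seval g X"
proof (rule seval_eqI)
  fix P R :: "('a, 'b) gen set"
  assume P: "finite P" "range Theta \<union> R \<subseteq> P"
  have "taylor_ext (\<lambda>x. coeff (f x) S + coeff (g x) S) X
      = taylor_ext (\<lambda>x. coeff (f x) S) X + taylor_ext (\<lambda>x. coeff (g x) S) X" for S
    by (rule taylor_ext_add[OF assms(2,3) _ _ assms(1)]) (use assms(4,5) in \<open>auto simp: smooth_sfun_def\<close>)
  then show "coeff (seval (\<lambda>x. f x + g x) X) R = coeff (seval f X + seval g X) R"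
    unfolding plus_grass.rep_eq coeff_seval[OF assms(1) P]
    by (simp add: seval_upto_def coeff_basic distrib_right sum.distrib)
qed

lemma seval_scaleR:
  assumes "superpoint X" "open U" "pt_body X \<in> U" "smooth_sfun U f"
  shows "seval (\<lambda>x. c *\<^sub>R f x) X = c *\<^sub>R seval f X"
proof (rule seval_eqI)
  fix P R :: "('a, 'b) gen set"
  assume P: "finite P" "range Theta \<union> R \<subseteq> P"
  have "taylor_ext (\<lambda>x. c * coeff (f x) S) X = c *\<^sub>R taylor_ext (\<lambda>x. coeff (f x) S) X" for S
    by (rule taylor_ext_cmult[OF assms(2,3) _ assms(1)]) (use assms(4) in \<open>auto simp: smooth_sfun_def\<close>)
  then show "coeff (seval (\<lambda>x. c *\<^sub>R f x) X) R = coeff (c *\<^sub>R seval f X) R"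
    unfolding scaleR_grass.rep_eq coeff_seval[OF assms(1) P]
    by (simp add: seval_upto_def coeff_basic flip: scaleR_sum_right)
qed

lemma seval_zero: "superpoint X \<Longrightarrow> seval (\<lambda>_. 0) X = 0"
  by (rule seval_eqI) (simp add: coeff_seval seval_upto_def coeff_basic)

lemma seval_sum:
  assumes "superpoint X" "open U" "pt_body X \<in> U" "\<And>i. i \<in> I \<Longrightarrow> smooth_sfun U (f i)"
  shows "seval (\<lambda>x. \<Sum>i\<in>I. f i x) X = (\<Sum>i\<in>I. seval (f i) X)"
  using assms(4)
proof (induction I rule: infinite_finite_induct)
  case (insert i I)
  then show ?case
    using seval_add[OF assms(1-3), of "f i" "\<lambda>x. \<Sum>i\<in>I. f i x"] assms(2)
    by (simp add: smooth_sfun_sum)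
qed (simp_all add: seval_zero assms(1))

text \<open>The Taylor extension and the substituted monomials are both multiplicative; disjoint
  pairs (S, T) are re-indexed by their union together with its subset \<open>S\<close>.\<close>

lemma seval_mult:
  fixes f g :: "('n::{finite,linorder}, 'l::linorder) sfun"
  assumes "superpoint X" "open U" "pt_body X \<in> U" "smooth_sfun U f" "smooth_sfun U g"
  shows "seval (\<lambda>x. f x * g x) X = seval f X * seval g X"
proof (rule seval_eqI)
  fix P R :: "('n, 'l) gen set"
  assume P: "finite P" "range Theta \<union> R \<subseteq> P"
  let ?t = "\<lambda>h S. taylor_ext (\<lambda>x. coeff (h x) S) X" and ?m = "subst_monomial X"
  have sm: "smooth_fun U (\<lambda>x. coeff (f x) S)" "smooth_fun U (\<lambda>x. coeff (g x) S)" for S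
    using assms(4,5) by (simp_all add: smooth_sfun_def)
  have tm: "taylor_ext (\<lambda>x. coeff (f x * g x) S) X = (\<Sum>T\<in>Pow S. gsign T (S - T) *\<^sub>R (?t f T * ?t g (S - T)))" for S
  proof -
    have "taylor_ext (\<lambda>x. coeff (f x * g x) S) X
        = taylor_ext (\<lambda>x. \<Sum>T\<in>Pow S. gsign T (S - T) * (coeff (f x) T * coeff (g x) (S - T))) X"
      unfolding coeff_mult by (simp add: mult.assoc)
    also have "\<dots> = (\<Sum>T\<in>Pow S. taylor_ext (\<lambda>x. gsign T (S - T) * (coeff (f x) T * coeff (g x) (S - T))) X)"
      by (rule taylor_ext_sum[OF assms(2,3) _ assms(1)]) (intro smooth_fun_mult smooth_fun_const sm assms(2))
    also have "\<dots> = (\<Sum>T\<in>Pow S. gsign T (S - T) *\<^sub>R (?t f T * ?t g (S - T)))"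
      by (rule sum.cong[OF refl], subst taylor_ext_cmult[OF assms(2,3) smooth_fun_mult[OF assms(2) sm] assms(1)],
          subst taylor_ext_mult[OF assms(2,3) sm assms(1)]) simp
    finally show ?thesis .
  qed
  have mm: "?t f S * ?m S * (?t g T * ?m T) = (if S \<inter> T = {} then
      gsign S T *\<^sub>R (?t f S * ?t g T) * ?m (S \<union> T) else 0)" if "S \<subseteq> P" "T \<subseteq> P" for S T
  proof -
    have "finite S" "finite T" using that P by (auto intro: finite_subset)
    note m = subst_monomial_mult[OF assms(1) this]
    have "?t f S * ?m S * (?t g T * ?m T) = ?t f S * ?t g T * (?m S * ?m T)"
    proof -
      have "?m S * ?t g T = ?t g T * ?m S"
        by (rule even_commute[OF even_taylor_ext[OF assms(1)], symmetric])
      then have "?t f S * (?m S * ?t g T) * ?m T = ?t f S * (?t g T * ?m S) * ?m T" by (rule arg_cong)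
      then show ?thesis by (simp only: mult.assoc)
    qed
    then show ?thesis unfolding m by simp
  qed
  have "coeff (seval f X * seval g X) R = coeff (seval_upto P f X * seval_upto P g X) R"
    by (rule coeff_mult_cong; rule coeff_seval[OF assms(1) P(1)]) (use P in auto)
  also have "seval_upto P f X * seval_upto P g X = (\<Sum>(S, T)\<in>Pow P \<times> Pow P. ?t f S * ?m S * (?t g T * ?m T))"
    unfolding seval_upto_def sum_product sum.cartesian_product ..
  also have "\<dots> = (\<Sum>(S, T)\<in>Pow P \<times> Pow P. if S \<inter> T = {} then
      gsign S T *\<^sub>R (?t f S * ?t g T) * ?m (S \<union> T) else 0)"
    by (rule sum.cong) (auto simp: mm)
  also have "\<dots> = (\<Sum>(S, T)\<in>{(S, T). S \<subseteq> P \<and> T \<subseteq> P \<and> S \<inter> T = {}}. gsign S T *\<^sub>R (?t f S * ?t g T) * ?m (S \<union> T))"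
    by (rule sum.mono_neutral_cong_right) (use P in \<open>auto split: if_splits\<close>)
  also have "\<dots> = (\<Sum>(S, T)\<in>(SIGMA S:Pow P. Pow S). gsign T (S - T) *\<^sub>R (?t f T * ?t g (S - T)) * ?m S)"
  proof (rule sum.reindex_bij_witness[of _ "\<lambda>(S, T). (T, S - T)" "\<lambda>(S, T). (S \<union> T, S)"])
    fix x assume "x \<in> {(S, T). S \<subseteq> P \<and> T \<subseteq> P \<and> S \<inter> T = {}}"
    then obtain S T where x: "x = (S, T)" "S \<subseteq> P" "T \<subseteq> P" "S \<inter> T = {}" by blast
    then have e: "S \<union> T - S = T" by blast
    show "(case case x of (S, T) \<Rightarrow> (S \<union> T, S) of (S, T) \<Rightarrow> (T, S - T)) = x"
      "(case case x of (S, T) \<Rightarrow> (S \<union> T, S) of (S, T) \<Rightarrow> gsign T (S - T) *\<^sub>R (?t f T * ?t g (S - T)) * ?m S)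
        = (case x of (S, T) \<Rightarrow> gsign S T *\<^sub>R (?t f S * ?t g T) * ?m (S \<union> T))"
      unfolding x(1) prod.case e by (rule refl)+
    show "(case x of (S, T) \<Rightarrow> (S \<union> T, S)) \<in> (SIGMA S:Pow P. Pow S)"
      unfolding x(1) prod.case using x by blast
  next
    fix x assume "x \<in> (SIGMA S:Pow P. Pow S)"
    then obtain S T where x: "x = (S, T)" "S \<subseteq> P" "T \<subseteq> S" by blast
    then have e: "T \<union> (S - T) = S" by blast
    show "(case case x of (S, T) \<Rightarrow> (T, S - T) of (S, T) \<Rightarrow> (S \<union> T, S)) = x"
      unfolding x(1) prod.case e ..
    show "(case x of (S, T) \<Rightarrow> (T, S - T)) \<in> {(S, T). S \<subseteq> P \<and> T \<subseteq> P \<and> S \<inter> T = {}}"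
      unfolding x(1) prod.case using x by blast
  qed
  also have "\<dots> = (\<Sum>S\<in>Pow P. \<Sum>T\<in>Pow S. gsign T (S - T) *\<^sub>R (?t f T * ?t g (S - T)) * ?m S)"
    by (rule sum.Sigma[symmetric]) (use P in \<open>auto intro: finite_subset\<close>)
  also have "\<dots> = seval_upto P (\<lambda>x. f x * g x) X"
    unfolding seval_upto_def tm sum_distrib_right ..
  finally show "coeff (seval (\<lambda>x. f x * g x) X) R = coeff (seval f X * seval g X) R"
    using coeff_seval[OF assms(1) P] by simp
qed

text \<open>A coefficient function at a set of the wrong parity vanishes on \<open>U\<close>, and so
  does its Taylor extension.\<close>

lemma has_parity_seval:
  fixes f :: "('n::{finite,linorder}, 'l::linorder) sfun"
  assumes "superpoint X" "open U" "pt_body X \<in> U" "\<And>x. x \<in> U \<Longrightarrow> has_parity p (f x)"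
  shows "has_parity p (seval f X)"
proof -
  have "has_parity p (seval_upto P f X)" if P: "finite P" for P
    unfolding seval_upto_def
  proof (rule has_parity_sum)
    fix S assume S: "S \<in> Pow P"
    show "has_parity p (taylor_ext (\<lambda>x. coeff (f x) S) X * subst_monomial X S)"
    proof (cases "card S mod 2 = p mod 2")
      case True
      have "has_parity (0 + card S) (taylor_ext (\<lambda>x. coeff (f x) S) X * subst_monomial X S)"
        by (intro has_parity_mult even_taylor_ext parity_subst_monomial assms(1)) (use S P in \<open>auto intro: finite_subset\<close>)
      then show ?thesis unfolding has_parity_cong[OF True, symmetric] by simp
    next
      case False
      have "taylor_ext (\<lambda>x. coeff (f x) S) X = taylor_ext (\<lambda>x. 0) X"
        by (rule taylor_ext_cong[OF assms(2,3)]) (use False assms(4) in \<open>auto simp: has_parity_def\<close>)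
      then show ?thesis by simp
    qed
  qed
  note par = this
  show ?thesis
    unfolding has_parity_def
  proof (intro allI impI)
    fix R
    assume R: "coeff (seval f X) R \<noteq> 0"
    then have fin: "finite (range Theta \<union> R)" using coeff_infinite by auto
    from R show "card R mod 2 = p mod 2"
      using par[OF fin] unfolding coeff_seval[OF assms(1) fin order_refl] has_parity_def by blast
  qed
qed

lemma body_seval:
  fixes f :: "('n::{finite,linorder}, 'l::linorder) sfun"
  assumes "superpoint X"
  shows "body (seval f X) = body (f (pt_body X))"
proof -
  have "body (seval f X) = body (seval_upto (range Theta) f X)"
    unfolding body_def by (rule coeff_seval[OF assms]) auto
  also have "\<dots> = (\<Sum>S\<in>Pow (range Theta). coeff (f (pt_body X)) S * body (subst_monomial X S))"
    by (simp add: seval_upto_def body_taylor_ext)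
  also have "\<dots> = (\<Sum>S\<in>{{}}. coeff (f (pt_body X)) S * body (subst_monomial X S))"
  proof (rule sum.mono_neutral_right)
    show "\<forall>S\<in>Pow (range Theta) - {{}}. coeff (f (pt_body X)) S * body (subst_monomial X S) = 0"
      using body_subst_monomial[OF assms finite_subset[OF _ finite_imageI[OF finite]]] by auto
  qed auto
  finally show ?thesis by (simp add: subst_monomial_empty) (simp add: body_def)
qed

lemma smooth_seval:
  fixes \<phi> :: "('n::{finite,linorder}, 'l::linorder) smap"
  assumes "open V" "is_smap V U \<phi>" "smooth_sfun U f"
  shows "smooth_sfun V (\<lambda>y. seval f (at_pt \<phi> y))"
  unfolding smooth_sfun_def
proof
  fix R :: "('n, 'l) gen set"
  show "smooth_fun V (\<lambda>y. coeff (seval f (at_pt \<phi> y)) R)"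
  proof (cases "finite R")
    case True
    have "smooth_sfun V (\<lambda>y. seval_upto (range Theta \<union> R) f (at_pt \<phi> y))"
      unfolding seval_upto_def
      by (intro smooth_sfun_sum smooth_sfun_mult smooth_taylor_ext[OF assms(1,2)] smooth_subst_monomial[OF assms(1,2)]
          assms(1)) (use assms(3) True in \<open>auto simp: smooth_sfun_def intro: finite_subset\<close>)
    then have "smooth_fun V (\<lambda>y. coeff (seval_upto (range Theta \<union> R) f (at_pt \<phi> y)) R)"
      by (simp add: smooth_sfun_def)
    then show ?thesis
      by (rule smooth_fun_cong[OF assms(1), rotated])
        (use coeff_seval[OF is_smap_superpoint[OF assms(2)], of _ "range Theta \<union> R" R f] True in simp)
  qed (simp add: coeff_infinite smooth_fun_const assms(1))
qed

lemma sum_UNIV_sum: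
  "(\<Sum>B\<in>UNIV. f B) = (\<Sum>i\<in>UNIV. f (Inl i)) + (\<Sum>i\<in>UNIV. f (Inr i))"
  for f :: "'a::finite + 'b::finite \<Rightarrow> 'c::comm_monoid_add"
  unfolding UNIV_Plus_UNIV[symmetric] by (subst sum.Plus) (simp_all add: comp_def)

text \<open>The chain rule for left derivatives. For a single monomial the product rule separates
  the derivatives of its coefficient function, which give the even \<open>B\<close>, from those of
  its odd factors, which give the odd \<open>B\<close>.\<close>

theorem sder_seval:
  fixes \<phi> :: "('n::{finite,linorder}, 'l::linorder) smap"
  assumes "open V" "y \<in> V" "is_smap V U \<phi>" "open U" "smooth_sfun U f"
  shows "sder A (\<lambda>y. seval f (at_pt \<phi> y)) y = (\<Sum>B\<in>UNIV. sder A (\<phi> B) y * seval (sder B f) (at_pt \<phi> y))"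
proof (rule grass_eqI)
  fix R :: "('n, 'l) gen set"
  assume R: "finite R"
  let ?X = "at_pt \<phi> y"
  have X: "superpoint ?X" by (rule is_smap_superpoint[OF assms(3,2)])
  \<comment> \<open>All odd coordinates belong to \<open>P\<close>, so adjoining some
    \<open>Theta i\<close> to \<open>R\<close> does not leave it.\<close>
  define P where "P = range Theta \<union> R"
  have P: "finite P" "range Theta \<union> R \<subseteq> P" using R by (auto simp: P_def)
  have fin: "finite S" if "S \<subseteq> P" for S using that P by (auto intro: finite_subset)
  let ?T = "\<lambda>S. taylor_ext (\<lambda>x. coeff (f x) S) ?X" and ?m = "subst_monomial ?X"
  have sm: "smooth_fun U (\<lambda>x. coeff (f x) S)" for S
    using assms(5) by (simp add: smooth_sfun_def)
  have smt: "smooth_sfun V (\<lambda>y. taylor_ext (\<lambda>x. coeff (f x) S) (at_pt \<phi> y))" for S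
    by (rule smooth_taylor_ext[OF assms(1,3) sm])
  have smm: "smooth_sfun V (\<lambda>y. subst_monomial (at_pt \<phi> y) S)" if "S \<subseteq> P" for S
    by (rule smooth_subst_monomial[OF assms(1,3) fin[OF that]])
  have ev: "has_parity 0 (?T S)" for S by (rule even_taylor_ext[OF X])
  have one: "sder A (\<lambda>y. taylor_ext (\<lambda>x. coeff (f x) S) (at_pt \<phi> y) * subst_monomial (at_pt \<phi> y) S) y
      = (\<Sum>j\<in>UNIV. sder A (\<phi> (Inl j)) y * (taylor_ext (pd j (\<lambda>x. coeff (f x) S)) ?X * ?m S))
       + (\<Sum>a | Theta a \<in> S. sder A (\<phi> (Inr a)) y * (gsign {Theta a} S *\<^sub>R (?T S * ?m (S - {Theta a}))))"
    if S: "S \<subseteq> P" for S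
  proof -
    have c: "?T S * (gsign {Theta a} S *\<^sub>R (d * m)) = d * (gsign {Theta a} S *\<^sub>R (?T S * m))" for a d m
      using even_commute[OF ev, of S d] by (simp flip: mult.assoc)
    show ?thesis
      unfolding sder_mult[OF assms(1,2) smt smm[OF S]] twist_even[OF ev]
        sder_taylor_ext[OF assms(1-4) sm] sder_subst_monomial[OF assms(1-3) fin[OF S]]
        sum_distrib_left sum_distrib_right c mult.assoc ..
  qed
  have "coeff (sder A (\<lambda>y. seval f (at_pt \<phi> y)) y) R
      = coeff (sder A (\<lambda>y. seval_upto P f (at_pt \<phi> y)) y) R"
  proof (cases A)
    case (Inl i)
    show ?thesis unfolding Inl coeff_sder_Inl
      by (rule pd_cong[OF assms(1,2)]) (rule coeff_seval[OF is_smap_superpoint[OF assms(3)] P])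
  next
    case (Inr i)
    have "range Theta \<union> insert (Theta i) R \<subseteq> P" using P by auto
    then show ?thesis unfolding Inr sder.simps coeff_odd_pd using coeff_seval[OF X P(1)] by simp
  qed
  also have "sder A (\<lambda>y. seval_upto P f (at_pt \<phi> y)) y
     = (\<Sum>S\<in>Pow P. sder A (\<lambda>y. taylor_ext (\<lambda>x. coeff (f x) S) (at_pt \<phi> y) * subst_monomial (at_pt \<phi> y) S) y)"
    unfolding seval_upto_def by (rule sder_sum[OF assms(1,2)]) (auto intro: smooth_sfun_mult[OF assms(1)] smt smm)
  also have "\<dots> = (\<Sum>S\<in>Pow P. \<Sum>j\<in>UNIV. sder A (\<phi> (Inl j)) y * (taylor_ext (pd j (\<lambda>x. coeff (f x) S)) ?X * ?m S))
      + (\<Sum>S\<in>Pow P. \<Sum>a | Theta a \<in> S. sder A (\<phi> (Inr a)) y * (gsign {Theta a} S *\<^sub>R (?T S * ?m (S - {Theta a}))))"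
    unfolding sum.distrib[symmetric] by (rule sum.cong) (use one in auto)
  also have "(\<Sum>S\<in>Pow P. \<Sum>j\<in>UNIV. sder A (\<phi> (Inl j)) y * (taylor_ext (pd j (\<lambda>x. coeff (f x) S)) ?X * ?m S))
     = (\<Sum>j\<in>UNIV. sder A (\<phi> (Inl j)) y * seval_upto P (sder (Inl j) f) ?X)"
    unfolding seval_upto_def coeff_sder_Inl sum_distrib_left by (rule sum.swap)
  also have "(\<Sum>S\<in>Pow P. \<Sum>a | Theta a \<in> S. sder A (\<phi> (Inr a)) y * (gsign {Theta a} S *\<^sub>R (?T S * ?m (S - {Theta a}))))
     = (\<Sum>a\<in>UNIV. sder A (\<phi> (Inr a)) y * seval_upto P (sder (Inr a) f) ?X)"
  proof -
    have "(\<Sum>S\<in>Pow P. \<Sum>a | Theta a \<in> S. sder A (\<phi> (Inr a)) y * (gsign {Theta a} S *\<^sub>R (?T S * ?m (S - {Theta a}))))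
       = (\<Sum>a\<in>UNIV. \<Sum>S | S \<in> Pow P \<and> Theta a \<in> S. sder A (\<phi> (Inr a)) y * (gsign {Theta a} S *\<^sub>R (?T S * ?m (S - {Theta a}))))"
      using sum.swap_restrict[of "Pow P" UNIV "\<lambda>S a. sder A (\<phi> (Inr a)) y * (gsign {Theta a} S *\<^sub>R (?T S * ?m (S - {Theta a})))"
          "\<lambda>S a. Theta a \<in> S"] P(1) by simp
    also have "\<dots> = (\<Sum>a\<in>UNIV. sder A (\<phi> (Inr a)) y * seval_upto P (sder (Inr a) f) ?X)"
    proof (rule sum.cong[OF refl])
      fix a :: 'n
      let ?g = "Theta a :: ('n, 'l) gen"
      have g: "?g \<in> P" by (simp add: P_def)
      have d: "taylor_ext (\<lambda>x. coeff (odd_pd a (f x)) S) ?X = (if ?g \<in> S then 0 else gsign {?g} S *\<^sub>R ?T (insert ?g S))" for S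
        using taylor_ext_cmult[OF assms(4) is_smap_body[OF assms(3,2)] sm X] by (simp add: coeff_odd_pd)
      \<comment> \<open>Deleting \<open>?g\<close> from a monomial is inverse to adjoining it; after
        re-indexing, the coefficients are those of the odd derivative.\<close>
      have "(\<Sum>S | S \<in> Pow P \<and> ?g \<in> S. gsign {?g} S *\<^sub>R (?T S * ?m (S - {?g})))
          = (\<Sum>S | S \<in> Pow P \<and> ?g \<notin> S. gsign {?g} S *\<^sub>R (?T (insert ?g S) * ?m S))"
      proof (rule sum.reindex_bij_witness[of _ "insert ?g" "\<lambda>S. S - {?g}"])
        fix S assume "S \<in> {S. S \<in> Pow P \<and> ?g \<in> S}"
        then have S: "S = insert ?g (S - {?g})" "finite (S - {?g})" using fin by auto
        have "gsign {?g} (insert ?g (S - {?g})) = gsign {?g} {?g} * gsign {?g} (S - {?g})"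
          by (rule gsign_insert_right) (use S in auto)
        then have "gsign {?g} (S - {?g}) = gsign {?g} S" using S(1) by (simp add: gsign_singletons)
        then show "gsign {?g} (S - {?g}) *\<^sub>R (?T (insert ?g (S - {?g})) * ?m (S - {?g}))
            = gsign {?g} S *\<^sub>R (?T S * ?m (S - {?g}))" using S(1) by simp
      qed (use g in auto)
      also have "\<dots> = seval_upto P (sder (Inr a) f) ?X"
        unfolding seval_upto_def sder.simps d by (rule sum.mono_neutral_cong_left) (use P in auto)
      finally show "(\<Sum>S | S \<in> Pow P \<and> ?g \<in> S. sder A (\<phi> (Inr a)) y * (gsign {?g} S *\<^sub>R (?T S * ?m (S - {?g}))))
          = sder A (\<phi> (Inr a)) y * seval_upto P (sder (Inr a) f) ?X"
        unfolding sum_distrib_left[symmetric] by simp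
    qed
    finally show ?thesis .
  qed
  also have "(\<Sum>j\<in>UNIV. sder A (\<phi> (Inl j)) y * seval_upto P (sder (Inl j) f) ?X)
      + (\<Sum>a\<in>UNIV. sder A (\<phi> (Inr a)) y * seval_upto P (sder (Inr a) f) ?X)
      = (\<Sum>B\<in>UNIV. sder A (\<phi> B) y * seval_upto P (sder B f) ?X)"
    by (rule sum_UNIV_sum[symmetric])
  also have "coeff \<dots> R = coeff (\<Sum>B\<in>UNIV. sder A (\<phi> B) y * seval (sder B f) ?X) R"
    unfolding coeff_sum
    by (intro sum.cong coeff_mult_cong refl coeff_seval[OF X P(1), symmetric]) (use P in auto)
  finally show "coeff (sder A (\<lambda>y. seval f (at_pt \<phi> y)) y) R
    = coeff (\<Sum>B\<in>UNIV. sder A (\<phi> B) y * seval (sder B f) (at_pt \<phi> y)) R" .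
qed

section \<open>Matrices over a Grassmann algebra\<close>

text \<open>\<open>Q = 1 - N M\<close> is idempotent with vanishing body, hence of arbitrarily high degree.\<close>

lemma matrix_left_right_inverse_grass:
  fixes M N :: "'k::finite \<Rightarrow> 'k \<Rightarrow> 'g::linorder grass"
  assumes MN: "\<And>i j. (\<Sum>k\<in>UNIV. M i k * N k j) = (if i = j then 1 else 0)"
  shows "(\<Sum>k\<in>UNIV. N i k * M k j) = (if i = j then 1 else 0)"
proof -
  define P where "P i j = (\<Sum>k\<in>UNIV. N i k * M k j)" for i j
  define Q where "Q i j = (if i = j then 1 else 0) - P i j" for i j
  have PP: "(\<Sum>k\<in>UNIV. P i k * P k j) = P i j" for i j
  proof -
    have "(\<Sum>k\<in>UNIV. P i k * P k j) = (\<Sum>k\<in>UNIV. \<Sum>m\<in>UNIV. \<Sum>l\<in>UNIV. N i m * (M m k * N k l) * M l j)"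
      unfolding P_def by (simp add: sum_product mult.assoc)
    also have "\<dots> = (\<Sum>m\<in>UNIV. \<Sum>l\<in>UNIV. \<Sum>k\<in>UNIV. N i m * (M m k * N k l) * M l j)"
      by (subst sum.swap, rule sum.cong[OF refl], rule sum.swap)
    also have "\<dots> = (\<Sum>m\<in>UNIV. \<Sum>l\<in>UNIV. N i m * (\<Sum>k\<in>UNIV. M m k * N k l) * M l j)"
      by (simp add: sum_distrib_left sum_distrib_right)
    also have "\<dots> = (\<Sum>m\<in>UNIV. \<Sum>l\<in>UNIV. if m = l then N i l * M l j else 0)"
      unfolding MN by (intro sum.cong) auto
    finally show ?thesis by (simp add: P_def)
  qed
  have QQ: "(\<Sum>k\<in>UNIV. Q i k * Q k j) = Q i j" for i j
  proof -
    have "Q i k * Q k j = (if k = j then (if i = j then 1 else 0) - P i k else 0)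
        - (if k = i then P k j else 0) + P i k * P k j" for k
      by (simp add: Q_def algebra_simps)
    then show ?thesis
      by (simp add: sum.distrib sum_subtractf PP) (simp add: Q_def)
  qed
  \<comment> \<open>For the real square matrices of bodies a one-sided inverse is two-sided.\<close>
  have bQ: "body (Q i j) = 0" for i j
  proof -
    define M0 N0 where "M0 = (\<chi> i j. body (M i j))" and "N0 = (\<chi> i j. body (N i j))"
    have "M0 ** N0 = mat 1"
      unfolding M0_def N0_def matrix_matrix_mult_def mat_def
      using arg_cong[OF MN, of body] by (simp add: vec_eq_iff if_distrib)
    then have "N0 ** M0 = mat 1" by (rule matrix_left_right_inverse1)
    then have "(N0 ** M0) $ i $ j = mat 1 $ i $ j" by simp
    then show ?thesis
      by (simp add: M0_def N0_def matrix_matrix_mult_def mat_def Q_def P_def)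
  qed
  have "Q i j = 0" for i j
  proof (rule grass_eqI)
    fix S :: "'g set"
    assume "finite S"
    then show "coeff (Q i j) S = coeff 0 S"
    proof (induction "card S" arbitrary: S i j rule: less_induct)
      case less
      have "coeff (Q i j) S = (\<Sum>k\<in>UNIV. \<Sum>T\<in>Pow S. gsign T (S - T) * coeff (Q i k) T * coeff (Q k j) (S - T))"
        by (subst QQ[symmetric]) (simp only: coeff_sum coeff_mult)
      also have "\<dots> = 0"
      proof (intro sum.neutral ballI)
        fix k T assume T: "T \<in> Pow S"
        show "gsign T (S - T) * coeff (Q i k) T * coeff (Q k j) (S - T) = 0"
        proof (cases "T = S")
          case True
          then show ?thesis using bQ[of k j] by (simp add: body_def)
        next
          case False
          then have "card T < card S" "finite T"
            using T less.prems by (auto intro: psubset_card_mono finite_subset)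
          then show ?thesis using less.hyps by (simp add: coeff_basic)
        qed
      qed
      finally show ?case by (simp add: coeff_basic)
    qed
  qed
  then show ?thesis by (simp add: Q_def P_def eq_commute[of 0])
qed

lemma gmatrix_inv_eq:
  assumes "is_matrix_inverse M N"
  shows "gmatrix_inv M = N"
proof -
  have N': "is_matrix_inverse M (gmatrix_inv M)"
    unfolding gmatrix_inv_def by (rule someI[of _ N]) (rule assms)
  have MN: "(\<Sum>l\<in>UNIV. M k l * N l j) = (if k = j then 1 else 0)" for k j
    using assms unfolding is_matrix_inverse_def by blast
  have NM: "(\<Sum>k\<in>UNIV. gmatrix_inv M i k * M k l) = (if i = l then 1 else 0)" for i l
    using N' unfolding is_matrix_inverse_def by blast
  have "gmatrix_inv M i j = N i j" for i j
  proof -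
    have "gmatrix_inv M i j = (\<Sum>k\<in>UNIV. gmatrix_inv M i k * (\<Sum>l\<in>UNIV. M k l * N l j))"
      unfolding MN by (simp add: if_distrib cong: if_cong)
    also have "\<dots> = (\<Sum>l\<in>UNIV. (\<Sum>k\<in>UNIV. gmatrix_inv M i k * M k l) * N l j)"
      unfolding sum_distrib_left sum_distrib_right by (subst sum.swap) (simp add: mult.assoc)
    also have "\<dots> = N i j"
      unfolding NM by (simp add: if_distrib[of "\<lambda>x. x * _"] cong: if_cong)
    finally show ?thesis .
  qed
  then show ?thesis by (intro ext)
qed

text \<open>The even elements form a commutative ring, which makes the library's determinants applicable.\<close>

typedef (overloaded) 'g even_grass = "{a :: 'g::linorder grass. has_parity 0 a}"
  morphisms of_even to_even
  by (rule exI[of _ 0]) simp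

setup_lifting type_definition_even_grass

instantiation even_grass :: (linorder) comm_ring_1
begin

lift_definition zero_even_grass :: "'a even_grass" is 0 by simp
lift_definition one_even_grass :: "'a even_grass" is 1 by simp
lift_definition plus_even_grass :: "'a even_grass \<Rightarrow> 'a even_grass \<Rightarrow> 'a even_grass" is "(+)"
  by (rule has_parity_add)
lift_definition minus_even_grass :: "'a even_grass \<Rightarrow> 'a even_grass \<Rightarrow> 'a even_grass" is "(-)"
  by (rule has_parity_diff)
lift_definition uminus_even_grass :: "'a even_grass \<Rightarrow> 'a even_grass" is uminus
  by (rule has_parity_uminus)
lift_definition times_even_grass :: "'a even_grass \<Rightarrow> 'a even_grass \<Rightarrow> 'a even_grass" is "(*)"
  using has_parity_mult[of 0 _ 0] by simp

instance
proof
  fix a b :: "'a even_grass"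
  show "a * b = b * a" by transfer (rule even_commute)
qed (transfer; simp add: algebra_simps)+

end

lemmas of_even_simps = zero_even_grass.rep_eq one_even_grass.rep_eq plus_even_grass.rep_eq
  minus_even_grass.rep_eq uminus_even_grass.rep_eq times_even_grass.rep_eq

lemma even_of_even: "has_parity 0 (of_even a)"
  using of_even[of a] by simp

lemma of_even_to_even: "has_parity 0 a \<Longrightarrow> of_even (to_even a) = a"
  by (simp add: to_even_inverse)

lemma of_even_sum: "of_even (\<Sum>i\<in>I. f i) = (\<Sum>i\<in>I. of_even (f i))"
  by (induction I rule: infinite_finite_induct) (simp_all add: of_even_simps)

lemma of_even_prod_list: "of_even (prod_list xs) = prod_list (map of_even xs)"
  by (induction xs) (simp_all add: of_even_simps)

lemma of_even_of_int: "of_even (of_int k) = of_int k"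
proof -
  have nat: "of_even (of_nat n) = of_nat n" for n
    by (induction n) (simp_all add: of_even_simps)
  show ?thesis by (cases k rule: int_cases2) (simp_all add: nat of_even_simps)
qed

lemma prod_UNIV_prod_list:
  "(\<Prod>i\<in>UNIV. f i) = prod_list (map f (sorted_list_of_set (UNIV :: 'n::{finite,linorder} set)))"
  for f :: "'n::{finite,linorder} \<Rightarrow> 'a::comm_monoid_mult"
  using prod.distinct_set_conv_list[of "sorted_list_of_set (UNIV :: 'n set)" f] by simp

section \<open>Determinants and cofactors of even matrices\<close>

lemma gdet_of_even:
  assumes "\<And>i j. M i j = of_even (N $ i $ j)"
  shows "gdet M = of_even (det N)"
  unfolding gdet_def det_def of_even_sum times_even_grass.rep_eq of_even_of_int prod_UNIV_prod_list
    of_even_prod_list map_map comp_def assms ..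

lemma gdet_to_even:
  assumes "\<And>i j. has_parity 0 (M i j)"
  shows "gdet M = of_even (det (\<chi> i j. to_even (M i j)))"
  by (rule gdet_of_even) (simp add: of_even_to_even assms)

lemma even_gdet: "(\<And>i j. has_parity 0 (M i j)) \<Longrightarrow> has_parity 0 (gdet M)"
  by (simp add: gdet_to_even even_of_even)

lemma gdet_transpose:
  assumes "\<And>i j. has_parity 0 (M i j)"
  shows "gdet (\<lambda>i j. M j i) = gdet M"
proof -
  have "gdet (\<lambda>i j. M j i) = of_even (det (transpose (\<chi> i j. to_even (M i j))))"
    by (rule gdet_of_even) (simp add: transpose_def of_even_to_even assms)
  then show ?thesis by (simp only: det_transpose gdet_to_even[OF assms])
qed

lemma gdet_inverse_mult:
  assumes "\<And>i j. has_parity 0 (M i j)" "\<And>i j. has_parity 0 (N i j)"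
    and MN: "\<And>i j. (\<Sum>k\<in>UNIV. M i k * N k j) = (if i = j then 1 else 0)"
  shows "gdet M * gdet N = 1"
proof -
  let ?M = "\<chi> i j. to_even (M i j)" and ?N = "\<chi> i j. to_even (N i j)"
  have "?M ** ?N = mat 1"
  proof -
    have "of_even ((?M ** ?N) $ i $ j) = of_even (mat 1 $ i $ j)" for i j
      by (simp add: matrix_matrix_mult_def mat_def of_even_sum of_even_simps of_even_to_even assms)
    then show ?thesis by (simp add: vec_eq_iff of_even_inject)
  qed
  then have "det ?M * det ?N = 1" by (simp flip: det_mul)
  then have "of_even (det ?M) * of_even (det ?N) = 1"
    by (metis one_even_grass.rep_eq times_even_grass.rep_eq)
  then show ?thesis by (simp only: gdet_to_even[OF assms(1)] gdet_to_even[OF assms(2)])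
qed

lemma body_of_int: "body (of_int k :: 'g::linorder grass) = of_int k"
  by (metis body_of_real of_real_of_int_eq)

lemma body_prod_list: "body (prod_list xs) = prod_list (map body xs)"
  for xs :: "'g::linorder grass list"
  by (induction xs) simp_all

lemma body_gdet: "body (gdet M) = det (\<chi> i j. body (M i j))"
  unfolding gdet_def det_def body_sum body_mult body_of_int body_prod_list map_map comp_def prod_UNIV_prod_list
  by simp

text \<open>The cofactor as a determinant of full size, with row \<open>i\<close> replaced by a unit
  row: this avoids minors with a smaller index type.\<close>

definition gcofactor :: "('n::{finite,linorder} \<Rightarrow> 'n \<Rightarrow> 'g::linorder grass) \<Rightarrow> 'n \<Rightarrow> 'n \<Rightarrow> 'g grass"
  where "gcofactor M i k = gdet (\<lambda>j l. if j = i then (if l = k then 1 else 0) else M j l)"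

lemma even_gcofactor: "(\<And>i j. has_parity 0 (M i j)) \<Longrightarrow> has_parity 0 (gcofactor M i k)"
  unfolding gcofactor_def by (rule even_gdet) simp

lemma det_linear_row_sum_axis:
  fixes N :: "'a::comm_ring_1^'n^'n"
  shows "(\<Sum>k\<in>UNIV. c k * det (\<chi> j. if j = i then axis k 1 else N $ j)) = det (\<chi> j. if j = i then (\<chi> k. c k) else N $ j)"
proof -
  have c: "(\<chi> k. c k) = (\<Sum>k\<in>UNIV. c k *s axis k 1)"
    by (simp add: vec_eq_iff axis_def if_distrib[of "\<lambda>x. c _ * x"] cong: if_cong)
  have "det (\<chi> j. if j = i then (\<chi> k. c k) else N $ j)
      = det (\<chi> j. if j = i then (\<Sum>k\<in>UNIV. c k *s axis k 1) else N $ j)" unfolding c ..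
  also have "\<dots> = (\<Sum>k\<in>UNIV. det (\<chi> j. if j = i then c k *s axis k 1 else N $ j))"
    by (rule det_linear_row_sum) simp
  also have "\<dots> = (\<Sum>k\<in>UNIV. c k * det (\<chi> j. if j = i then axis k 1 else N $ j))"
    by (simp add: det_row_mul)
  finally show ?thesis by simp
qed

text \<open>Expansion along a row: the sum is the determinant with row \<open>i\<close> replaced by
  row \<open>l\<close>, which has two equal rows unless \<open>l = i\<close>.\<close>

lemma mult_gcofactor:
  assumes ev: "\<And>i j. has_parity 0 (M i j)"
  shows "(\<Sum>k\<in>UNIV. M l k * gcofactor M i k) = (if l = i then gdet M else 0)"
proof -
  define N where "N = (\<chi> i j. to_even (M i j))"
  have M: "M i j = of_even (N $ i $ j)" for i j by (simp add: N_def of_even_to_even ev)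
  have "gcofactor M i k = of_even (det (\<chi> j. if j = i then axis k 1 else N $ j))" for k
    unfolding gcofactor_def by (rule gdet_of_even) (simp add: M axis_def of_even_simps)
  then have "(\<Sum>k\<in>UNIV. M l k * gcofactor M i k)
      = of_even (\<Sum>k\<in>UNIV. N $ l $ k * det (\<chi> j. if j = i then axis k 1 else N $ j))"
    by (simp add: M of_even_sum of_even_simps)
  also have "(\<Sum>k\<in>UNIV. N $ l $ k * det (\<chi> j. if j = i then axis k 1 else N $ j))
      = det (\<chi> j. if j = i then N $ l else N $ j)"
    unfolding det_linear_row_sum_axis vec_lambda_eta ..
  also have "\<dots> = (if l = i then det N else 0)"
  proof (cases "l = i")
    case True
    then have "(\<chi> j. if j = i then N $ l else N $ j) = N" by (simp add: vec_eq_iff)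
    then show ?thesis using True by simp
  next
    case False
    then show ?thesis
      using det_identical_rows[of i l "\<chi> j. if j = i then N $ l else N $ j"] by (simp add: row_def)
  qed
  also have "of_even (if l = i then det N else 0) = (if l = i then gdet M else 0)"
    using gdet_of_even[of M N, OF M] by (simp add: of_even_simps)
  finally show ?thesis .
qed

text \<open>Cramer's rule; the inverse carries the cofactors with transposed indices.\<close>

lemma gdet_inverse:
  assumes ev: "\<And>i j. has_parity 0 (M i j)" and "body (gdet M) \<noteq> 0"
  obtains s where "has_parity 0 s" "gdet M * s = 1" "s * gdet M = 1" "ginv (gdet M) = s"
    "is_matrix_inverse M (\<lambda>k i. s * gcofactor M i k)"
proof -
  obtain s where s: "has_parity 0 s" "gdet M * s = 1" "s * gdet M = 1"
    using even_inverse_exists[OF even_gdet[OF ev] assms(2)] by blast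
  have "(\<Sum>k\<in>UNIV. M l k * (s * gcofactor M i k)) = (if l = i then 1 else 0)" for l i
  proof -
    have "M l k * (s * gcofactor M i k) = s * (M l k * gcofactor M i k)" for k
      using even_commute[OF s(1), of "M l k"] by (simp flip: mult.assoc)
    then have "(\<Sum>k\<in>UNIV. M l k * (s * gcofactor M i k)) = s * (\<Sum>k\<in>UNIV. M l k * gcofactor M i k)"
      by (simp only: sum_distrib_left)
    also have "(\<Sum>k\<in>UNIV. M l k * gcofactor M i k) = (if l = i then gdet M else 0)"
      by (rule mult_gcofactor[OF ev])
    finally show ?thesis using s(3) by simp
  qed
  from this matrix_left_right_inverse_grass[OF this]
  have "is_matrix_inverse M (\<lambda>k i. s * gcofactor M i k)" unfolding is_matrix_inverse_def by blast
  with that s ginv_eq[OF s(2,3)] show ?thesis by blast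
qed

section \<open>The derivative of a determinant\<close>

lemma smooth_prod_list:
  fixes f :: "'a \<Rightarrow> ('n::{finite,linorder}, 'l::linorder) sfun"
  assumes "open V" "\<And>i. smooth_sfun V (f i)"
  shows "smooth_sfun V (\<lambda>y. prod_list (map (\<lambda>i. f i y) xs))"
  by (induction xs) (simp_all add: smooth_sfun_const smooth_sfun_mult assms)

lemma smooth_gdet:
  fixes M :: "'m::{finite,linorder} \<Rightarrow> 'm \<Rightarrow> ('n::{finite,linorder}, 'l::linorder) sfun"
  assumes "open V" "\<And>i j. smooth_sfun V (M i j)"
  shows "smooth_sfun V (\<lambda>y. gdet (\<lambda>i j. M i j y))"
  unfolding gdet_def
  by (intro smooth_sfun_sum smooth_sfun_mult smooth_sfun_const smooth_prod_list assms)

text \<open>All factors are even, so a derivative of either parity can be moved behind the product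
  without a sign.\<close>

lemma sder_prod_list:
  fixes f :: "'a \<Rightarrow> ('n::{finite,linorder}, 'l::linorder) sfun"
  assumes "open V" "y \<in> V" "\<And>i. smooth_sfun V (f i)" "\<And>i. has_parity 0 (f i y)" "distinct xs"
  shows "sder Z (\<lambda>y. prod_list (map (\<lambda>i. f i y) xs)) y
    = (\<Sum>i\<in>set xs. prod_list (map (\<lambda>j. if j = i then 1 else f j y) xs) * sder Z (f i) y)"
  using assms(5)
proof (induction xs)
  case (Cons a xs)
  let ?p = "\<lambda>i xs. prod_list (map (\<lambda>j. if j = i then 1 else f j y) xs)"
  have a: "?p a xs = prod_list (map (\<lambda>i. f i y) xs)"
    using Cons.prems by (intro arg_cong[of _ _ prod_list] map_cong) auto
  have i: "?p i (a # xs) = f a y * ?p i xs" if "i \<in> set xs" for i using that Cons.prems by auto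
  have "sder Z (\<lambda>y. prod_list (map (\<lambda>i. f i y) (a # xs))) y
      = sder Z (f a) y * prod_list (map (\<lambda>i. f i y) xs) + f a y * sder Z (\<lambda>y. prod_list (map (\<lambda>i. f i y) xs)) y"
    using sder_mult[OF assms(1,2,3) smooth_prod_list[OF assms(1,3)], where A = Z]
    by (simp add: twist_even[OF assms(4)])
  also have "sder Z (f a) y * prod_list (map (\<lambda>i. f i y) xs) = ?p a (a # xs) * sder Z (f a) y"
    using even_commute[OF even_prod_list, of xs "\<lambda>i. f i y"] assms(4) by (simp add: a)
  also have "f a y * sder Z (\<lambda>y. prod_list (map (\<lambda>i. f i y) xs)) y = (\<Sum>i\<in>set xs. ?p i (a # xs) * sder Z (f i) y)"
  proof -
    have "f a y * (?p i xs * sder Z (f i) y) = ?p i (a # xs) * sder Z (f i) y" if "i \<in> set xs" for i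
      unfolding i[OF that] by (simp only: mult.assoc)
    then show ?thesis using Cons by (simp only: sum_distrib_left distinct.simps) (rule sum.cong; simp)
  qed
  finally show ?case using Cons.prems by simp
qed simp

lemma prod_list_zero: "0 \<in> set xs \<Longrightarrow> prod_list xs = 0"
  for xs :: "'a::semiring_1 list"
  by (induction xs) auto

text \<open>Jacobi's formula: the permutations with \<open>p i = k\<close> collect into the cofactor
  of the entry (i, k).\<close>

lemma sder_gdet:
  fixes M :: "'m::{finite,linorder} \<Rightarrow> 'm \<Rightarrow> ('n::{finite,linorder}, 'l::linorder) sfun"
  assumes "open V" "y \<in> V" "\<And>i j. smooth_sfun V (M i j)" "\<And>i j. has_parity 0 (M i j y)"
  shows "sder Z (\<lambda>y. gdet (\<lambda>i j. M i j y)) y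
    = (\<Sum>i\<in>UNIV. \<Sum>k\<in>UNIV. gcofactor (\<lambda>i j. M i j y) i k * sder Z (M i k) y)"
proof -
  let ?L = "sorted_list_of_set (UNIV :: 'm set)" and ?S = "{p. p permutes (UNIV :: 'm set)}"
  let ?c = "\<lambda>p i. of_int (sign p) * prod_list (map (\<lambda>j. if j = i then 1 else M j (p j) y) ?L)"
  have sg: "of_int (sign p) = (of_real (of_int (sign p)) :: ('n, 'l) gen grass)" for p :: "'m \<Rightarrow> 'm" by simp
  have tw: "twist k (of_int (sign p) :: ('n, 'l) gen grass) = of_int (sign p)" for k and p :: "'m \<Rightarrow> 'm"
    unfolding sg by (rule twist_even[OF has_parity_of_real])
  have sp: "smooth_sfun V (\<lambda>y. prod_list (map (\<lambda>i. M i (p i) y) ?L))" for p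
    by (rule smooth_prod_list[OF assms(1,3)])
  have "sder Z (\<lambda>y. gdet (\<lambda>i j. M i j y)) y
      = (\<Sum>p\<in>?S. sder Z (\<lambda>y. of_int (sign p) * prod_list (map (\<lambda>i. M i (p i) y) ?L)) y)"
    unfolding gdet_def by (rule sder_sum[OF assms(1,2)]) (intro smooth_sfun_mult smooth_sfun_const sp assms(1))
  also have "\<dots> = (\<Sum>p\<in>?S. \<Sum>i\<in>UNIV. ?c p i * sder Z (M i (p i)) y)"
  proof (rule sum.cong[OF refl])
    fix p :: "'m \<Rightarrow> 'm"
    have "sder Z (\<lambda>_. of_int (sign p) :: ('n, 'l) gen grass) y = 0" unfolding sg by (rule sder_const)
    moreover have "sder Z (\<lambda>y. prod_list (map (\<lambda>i. M i (p i) y) ?L)) y = (\<Sum>i\<in>set ?L.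
        prod_list (map (\<lambda>j. if j = i then 1 else M j (p j) y) ?L) * sder Z (M i (p i)) y)"
      by (rule sder_prod_list[OF assms(1,2,3,4)]) simp
    ultimately show "sder Z (\<lambda>y. of_int (sign p) * prod_list (map (\<lambda>i. M i (p i) y) ?L)) y
        = (\<Sum>i\<in>UNIV. ?c p i * sder Z (M i (p i)) y)"
      using sder_mult[OF assms(1,2) smooth_sfun_const[OF assms(1)] sp, where A = Z]
      by (simp add: tw sum_distrib_left mult.assoc)
  qed
  also have "\<dots> = (\<Sum>i\<in>UNIV. \<Sum>p\<in>?S. ?c p i * sder Z (M i (p i)) y)"
    by (rule sum.swap)
  also have "\<dots> = (\<Sum>i\<in>UNIV. \<Sum>k\<in>UNIV. gcofactor (\<lambda>i j. M i j y) i k * sder Z (M i k) y)"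
  proof (rule sum.cong[OF refl])
    fix i :: 'm
    \<comment> \<open>In the cofactor, row \<open>i\<close> is a unit row, so only permutations with
      \<open>p i = k\<close> survive.\<close>
    have *: "of_int (sign p) * prod_list (map (\<lambda>j. if j = i then (if p j = k then 1 else 0) else M j (p j) y) ?L)
        = (if p i = k then ?c p i else 0)" for p k
    proof (cases "p i = k")
      case True
      then have "(\<lambda>j. if j = i then (if p j = k then 1 else 0) else M j (p j) y) = (\<lambda>j. if j = i then 1 else M j (p j) y)"
        by auto
      then show ?thesis using True by simp
    next
      case False
      then have "0 \<in> set (map (\<lambda>j. if j = i then (if p j = k then 1 else 0) else M j (p j) y) ?L)"
        by (auto simp: image_iff intro!: exI[of _ i])
      then have "prod_list (map (\<lambda>j. if j = i then (if p j = k then 1 else 0) else M j (p j) y) ?L) = 0"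
        by (rule prod_list_zero)
      then show ?thesis using False by simp
    qed
    have "(\<Sum>k\<in>UNIV. gcofactor (\<lambda>i j. M i j y) i k * sder Z (M i k) y)
        = (\<Sum>k\<in>UNIV. \<Sum>p\<in>?S. if p i = k then ?c p i * sder Z (M i k) y else 0)"
      unfolding gcofactor_def gdet_def * sum_distrib_right by (intro sum.cong) auto
    also have "\<dots> = (\<Sum>p\<in>?S. \<Sum>k\<in>UNIV. if p i = k then ?c p i * sder Z (M i k) y else 0)"
      by (rule sum.swap)
    also have "\<dots> = (\<Sum>p\<in>?S. ?c p i * sder Z (M i (p i)) y)" by simp
    finally show "(\<Sum>p\<in>?S. ?c p i * sder Z (M i (p i)) y)
        = (\<Sum>k\<in>UNIV. gcofactor (\<lambda>i j. M i j y) i k * sder Z (M i k) y)" ..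
  qed
  finally show ?thesis .
qed

declare sder.simps [simp del]

section \<open>Canonical transformations\<close>

lemma sum_antisym_sym:
  fixes N M :: "'i::finite \<Rightarrow> 'i \<Rightarrow> 'a::real_algebra"
  assumes "\<And>k l. N k l = - N l k" "\<And>k l. M k l = M l k"
  shows "(\<Sum>k\<in>UNIV. \<Sum>l\<in>UNIV. N k l * M k l) = 0"
proof (rule eq_uminus_self)
  have "(\<Sum>k\<in>UNIV. \<Sum>l\<in>UNIV. N k l * M k l) = (\<Sum>l\<in>UNIV. \<Sum>k\<in>UNIV. N k l * M k l)"
    by (rule sum.swap)
  also have "\<dots> = (\<Sum>l\<in>UNIV. \<Sum>k\<in>UNIV. - (N l k * M l k))"
    by (intro sum.cong refl) (use assms in \<open>metis mult_minus_left\<close>)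
  finally show "(\<Sum>k\<in>UNIV. \<Sum>l\<in>UNIV. N k l * M k l) = - (\<Sum>k\<in>UNIV. \<Sum>l\<in>UNIV. N k l * M k l)"
    by (simp only: sum_negf)
qed

lemma sum_sym_antisym:
  fixes N M :: "'i::finite \<Rightarrow> 'i \<Rightarrow> 'a::real_algebra"
  assumes "\<And>k l. M k l = M l k" "\<And>k l. N k l = - N l k"
  shows "(\<Sum>k\<in>UNIV. \<Sum>l\<in>UNIV. M k l * N k l) = 0"
proof (rule eq_uminus_self)
  have "(\<Sum>k\<in>UNIV. \<Sum>l\<in>UNIV. M k l * N k l) = (\<Sum>l\<in>UNIV. \<Sum>k\<in>UNIV. M k l * N k l)"
    by (rule sum.swap)
  also have "\<dots> = (\<Sum>l\<in>UNIV. \<Sum>k\<in>UNIV. - (M l k * N l k))"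
    by (intro sum.cong refl) (use assms in \<open>metis mult_minus_right\<close>)
  finally show "(\<Sum>k\<in>UNIV. \<Sum>l\<in>UNIV. M k l * N k l) = - (\<Sum>k\<in>UNIV. \<Sum>l\<in>UNIV. M k l * N k l)"
    by (simp only: sum_negf)
qed

lemma sum_rotate3:
  fixes f :: "'i::finite \<Rightarrow> 'j::finite \<Rightarrow> 'k::finite \<Rightarrow> 'a::comm_monoid_add"
  shows "(\<Sum>b\<in>UNIV. \<Sum>k\<in>UNIV. \<Sum>l\<in>UNIV. f b k l) = (\<Sum>k\<in>UNIV. \<Sum>l\<in>UNIV. \<Sum>b\<in>UNIV. f b k l)"
  by (subst sum.swap) (intro sum.cong refl sum.swap)

lemma sum_rotate5:
  fixes f :: "'i::finite \<Rightarrow> 'i \<Rightarrow> 'i \<Rightarrow> 'i \<Rightarrow> 'i \<Rightarrow> 'a::comm_monoid_add"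
  shows "(\<Sum>i\<in>UNIV. \<Sum>j\<in>UNIV. \<Sum>b\<in>UNIV. \<Sum>k\<in>UNIV. \<Sum>l\<in>UNIV. f i j b k l)
    = (\<Sum>k\<in>UNIV. \<Sum>l\<in>UNIV. \<Sum>i\<in>UNIV. \<Sum>j\<in>UNIV. \<Sum>b\<in>UNIV. f i j b k l)"
proof -
  have "(\<Sum>i\<in>UNIV. \<Sum>j\<in>UNIV. \<Sum>b\<in>UNIV. \<Sum>k\<in>UNIV. \<Sum>l\<in>UNIV. f i j b k l)
      = (\<Sum>i\<in>UNIV. \<Sum>j\<in>UNIV. \<Sum>k\<in>UNIV. \<Sum>l\<in>UNIV. \<Sum>b\<in>UNIV. f i j b k l)"
    by (intro sum.cong refl sum_rotate3)
  also have "\<dots> = (\<Sum>i\<in>UNIV. \<Sum>k\<in>UNIV. \<Sum>l\<in>UNIV. \<Sum>j\<in>UNIV. \<Sum>b\<in>UNIV. f i j b k l)"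
    by (intro sum.cong refl sum_rotate3)
  also have "\<dots> = (\<Sum>k\<in>UNIV. \<Sum>l\<in>UNIV. \<Sum>i\<in>UNIV. \<Sum>j\<in>UNIV. \<Sum>b\<in>UNIV. f i j b k l)"
    by (rule sum_rotate3)
  finally show ?thesis .
qed

text \<open>An odd \<open>b\<close> changes sign on passing the odd part of \<open>f\<close> only,
  and \<open>gi\<close> undoes exactly this.\<close>

lemma odd_mult_gi: "has_parity 1 b \<Longrightarrow> b * gi f = f * b"
proof -
  assume b: "has_parity 1 b"
  define e q where "e = (1 / 2) *\<^sub>R (f + gi f)" and "q = (1 / 2) *\<^sub>R (f - gi f)"
  have eq: "has_parity 0 e" "has_parity 1 q" "f = e + q" "gi f = e - q"
    by (simp_all add: has_parity_iff e_def q_def algebra_simps flip: scaleR_add_left)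
  show ?thesis
    unfolding eq(4) using even_commute[OF eq(1), of b] odd_anticommute[OF b eq(2)]
    by (simp add: eq(3) algebra_simps)
qed

text \<open>After expansion each of the four terms contracts a symmetric with an antisymmetric pair of indices;
  \<open>AD\<close> merges the two mixed terms.\<close>

lemma contraction_zero:
  fixes S R :: "'i::finite \<Rightarrow> 'i \<Rightarrow> 'i \<Rightarrow> 'g::linorder grass" and A B C D :: "'i \<Rightarrow> 'i \<Rightarrow> 'g grass"
  assumes pA: "\<And>i b. has_parity 0 (A i b)" and pB: "\<And>i b. has_parity 1 (B i b)"
    and pD: "\<And>i b. has_parity 0 (D i b)"
    and pS: "\<And>i j k. has_parity 1 (S i j k)" and pR: "\<And>i j k. has_parity 0 (R i j k)"
    and AD: "\<And>i j. (\<Sum>b\<in>UNIV. A i b * D j b + B i b * C j b) = (if i = j then 1 else 0)"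
    and AB: "\<And>i j. (\<Sum>b\<in>UNIV. A i b * B j b) = (\<Sum>b\<in>UNIV. B i b * A j b)"
    and CD: "\<And>i j. (\<Sum>b\<in>UNIV. C i b * D j b + D i b * C j b) = 0"
    and S: "\<And>i j k. S i j k = - S i k j" and R: "\<And>i j k. R i k j = R k i j"
  shows "(\<Sum>i\<in>UNIV. \<Sum>j\<in>UNIV. \<Sum>b\<in>UNIV. (\<Sum>k\<in>UNIV. S i j k * B k b + R i k j * D k b)
    * (\<Sum>l\<in>UNIV. S j i l * A l b + R j l i * C l b)) = 0"
proof -
  have cA: "A i b * x = x * A i b" and cD: "D i b * x = x * D i b" and cR: "R i j k * x = x * R i j k" for i b j k x
    by (intro even_commute pA pD pR)+
  have BS: "B k b * S i j l = - (S i j l * B k b)" for k b i j l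
    by (rule odd_anticommute[OF pB pS])
  have SS: "S i j k * S i' j' k' = - (S i' j' k' * S i j k)" for i j k i' j' k'
    by (rule odd_anticommute[OF pS pS])
  have e: "(S i j k * B k b + R i k j * D k b) * (S j i l * A l b + R j l i * C l b)
     = - (S i j k * S j i l * (B k b * A l b)) + S i j k * R j l i * (B k b * C l b)
       + (S j i l * R i k j * (A l b * D k b)) + R i k j * R j l i * (D k b * C l b)" for i j b k l
  proof -
    have "S i j k * B k b * (S j i l * A l b) = - (S i j k * S j i l * (B k b * A l b))"
      using BS[of k b j i l] by (metis (no_types) minus_mult_left minus_mult_right mult.assoc)
    moreover have "S i j k * B k b * (R j l i * C l b) = S i j k * R j l i * (B k b * C l b)"
      using cR[of j l i "B k b"] by (metis (no_types) mult.assoc)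
    moreover have "R i k j * D k b * (S j i l * A l b) = S j i l * R i k j * (A l b * D k b)"
    proof -
      have "R i k j * D k b * (S j i l * A l b) = R i k j * (D k b * (S j i l * A l b))" by (rule mult.assoc)
      also have "\<dots> = R i k j * (S j i l * A l b * D k b)" unfolding cD[of k b "S j i l * A l b"] ..
      also have "\<dots> = (S j i l * A l b * D k b) * R i k j" by (rule cR)
      also have "\<dots> = S j i l * ((A l b * D k b) * R i k j)" by (simp only: mult.assoc)
      also have "\<dots> = S j i l * (R i k j * (A l b * D k b))" unfolding cR[of i k j "A l b * D k b"] ..
      finally show ?thesis by (simp only: mult.assoc)
    qed
    moreover have "R i k j * D k b * (R j l i * C l b) = R i k j * R j l i * (D k b * C l b)"
      using cR[of j l i "D k b"] by (metis (no_types) mult.assoc)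
    ultimately show ?thesis by (simp only: distrib_left distrib_right add.assoc) (simp only: add_ac)
  qed
  let ?N = "\<lambda>k l. \<Sum>i\<in>UNIV. \<Sum>j\<in>UNIV. S i j k * S j i l"
  let ?M = "\<lambda>k l. \<Sum>i\<in>UNIV. \<Sum>j\<in>UNIV. R i k j * R j l i"
  let ?Q = "\<lambda>k l. \<Sum>i\<in>UNIV. \<Sum>j\<in>UNIV. S i j k * R j l i"
  \<comment> \<open>Exchanging the two odd factors gives the sign; renaming \<open>i\<close> and
    \<open>j\<close> restores the order of the indices.\<close>
  have N: "?N k l = - ?N l k" for k l
  proof -
    have "?N k l = (\<Sum>i\<in>UNIV. \<Sum>j\<in>UNIV. - (S j i l * S i j k))"
      by (intro sum.cong refl SS)
    also have "\<dots> = - (\<Sum>j\<in>UNIV. \<Sum>i\<in>UNIV. S j i l * S i j k)"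
      by (subst sum.swap) (simp only: sum_negf)
    finally show ?thesis .
  qed
  have M: "?M k l = ?M l k" for k l
  proof -
    have "?M k l = (\<Sum>i\<in>UNIV. \<Sum>j\<in>UNIV. R j l i * R i k j)"
      by (intro sum.cong refl cR)
    then show ?thesis by (subst sum.swap) simp
  qed
  have BA: "(\<Sum>b\<in>UNIV. B k b * A l b) = (\<Sum>b\<in>UNIV. B l b * A k b)" for k l
    using AB[of k l] by (simp only: cA)
  have DC: "(\<Sum>b\<in>UNIV. D k b * C l b) = - (\<Sum>b\<in>UNIV. D l b * C k b)" for k l
    using CD[of k l] by (simp add: sum.distrib flip: cD) (simp add: eq_neg_iff_add_eq_0 add.commute cD)
  have "(\<Sum>i\<in>UNIV. \<Sum>j\<in>UNIV. \<Sum>b\<in>UNIV. (\<Sum>k\<in>UNIV. S i j k * B k b + R i k j * D k b)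
    * (\<Sum>l\<in>UNIV. S j i l * A l b + R j l i * C l b))
    = (\<Sum>i\<in>UNIV. \<Sum>j\<in>UNIV. \<Sum>b\<in>UNIV. \<Sum>k\<in>UNIV. \<Sum>l\<in>UNIV. - (S i j k * S j i l * (B k b * A l b))
       + S i j k * R j l i * (B k b * C l b) + (S j i l * R i k j * (A l b * D k b)) + R i k j * R j l i * (D k b * C l b))"
    unfolding sum_product e ..
  also have "\<dots> = (\<Sum>k\<in>UNIV. \<Sum>l\<in>UNIV. \<Sum>i\<in>UNIV. \<Sum>j\<in>UNIV. \<Sum>b\<in>UNIV. - (S i j k * S j i l * (B k b * A l b))
       + S i j k * R j l i * (B k b * C l b) + (S j i l * R i k j * (A l b * D k b)) + R i k j * R j l i * (D k b * C l b))"
    by (rule sum_rotate5)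
  also have "\<dots> = - (\<Sum>k\<in>UNIV. \<Sum>l\<in>UNIV. ?N k l * (\<Sum>b\<in>UNIV. B k b * A l b))
     + (\<Sum>k\<in>UNIV. \<Sum>l\<in>UNIV. ?Q k l * (\<Sum>b\<in>UNIV. B k b * C l b))
     + (\<Sum>k\<in>UNIV. \<Sum>l\<in>UNIV. (\<Sum>i\<in>UNIV. \<Sum>j\<in>UNIV. S j i l * R i k j) * (\<Sum>b\<in>UNIV. A l b * D k b))
     + (\<Sum>k\<in>UNIV. \<Sum>l\<in>UNIV. ?M k l * (\<Sum>b\<in>UNIV. D k b * C l b))"
    unfolding sum.distrib sum_negf sum_distrib_right unfolding sum_distrib_left ..
  also have "(\<Sum>k\<in>UNIV. \<Sum>l\<in>UNIV. ?N k l * (\<Sum>b\<in>UNIV. B k b * A l b)) = 0"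
    by (rule sum_antisym_sym[OF N BA])
  also have "(\<Sum>k\<in>UNIV. \<Sum>l\<in>UNIV. ?M k l * (\<Sum>b\<in>UNIV. D k b * C l b)) = 0"
    by (rule sum_sym_antisym[OF M DC])
  \<comment> \<open>Renaming \<open>k\<close>, \<open>l\<close> and \<open>i\<close>,
    \<open>j\<close> brings the second mixed term to the coefficients \<open>?Q\<close> of the
    first.\<close>
  also have "(\<Sum>k\<in>UNIV. \<Sum>l\<in>UNIV. (\<Sum>i\<in>UNIV. \<Sum>j\<in>UNIV. S j i l * R i k j) * (\<Sum>b\<in>UNIV. A l b * D k b))
     = (\<Sum>k\<in>UNIV. \<Sum>l\<in>UNIV. ?Q k l * (\<Sum>b\<in>UNIV. A k b * D l b))"
    by (subst sum.swap, subst (3) sum.swap) (rule refl)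
  also have "- 0 + (\<Sum>k\<in>UNIV. \<Sum>l\<in>UNIV. ?Q k l * (\<Sum>b\<in>UNIV. B k b * C l b))
      + (\<Sum>k\<in>UNIV. \<Sum>l\<in>UNIV. ?Q k l * (\<Sum>b\<in>UNIV. A k b * D l b)) + 0
     = (\<Sum>k\<in>UNIV. \<Sum>l\<in>UNIV. ?Q k l * (\<Sum>b\<in>UNIV. A k b * D l b + B k b * C l b))"
    by (simp add: sum.distrib distrib_left add.commute)
  also have "\<dots> = (\<Sum>k\<in>UNIV. ?Q k k)"
    unfolding AD by (simp add: if_distrib cong: if_cong)
  also have "\<dots> = (\<Sum>i\<in>UNIV. \<Sum>j\<in>UNIV. \<Sum>k\<in>UNIV. S i j k * R j k i)"
    by (rule sum_rotate3)
  \<comment> \<open>In the remaining pair \<open>j\<close>, \<open>k\<close> the factor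
    \<open>S\<close> is antisymmetric and \<open>R\<close> is symmetric.\<close>
  also have "\<dots> = 0"
    by (rule sum.neutral, rule ballI) (rule sum_antisym_sym; (rule S | rule R))
  finally show ?thesis .
qed

text \<open>The three equations are the components of the invariance of the form: \<open>AD\<close>
  pairs an even with an odd direction, \<open>AB\<close> two even ones and \<open>CD\<close> two odd
  ones. \<open>A\<close> to \<open>D\<close> are parameters fixed by \<open>defines\<close>, so that
  the equations can be stated in blocks.\<close>

locale canonical_smap =
  fixes V :: "(real ^ 'n::{finite,linorder}) set" and \<phi> :: "('n, 'l::linorder) smap"
    and A B C D :: "'n \<Rightarrow> 'n \<Rightarrow> ('n, 'l) sfun"
  defines "A \<equiv> \<lambda>i b. sder (Inl i) (\<phi> (Inl b))" and "B \<equiv> \<lambda>i b. sder (Inl i) (\<phi> (Inr b))"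
    and "C \<equiv> \<lambda>i b. sder (Inr i) (\<phi> (Inl b))" and "D \<equiv> \<lambda>i b. sder (Inr i) (\<phi> (Inr b))"
  assumes V: "open V"
    and smooth: "\<And>E. smooth_sfun V (\<phi> E)"
    and parity: "\<And>E y. y \<in> V \<Longrightarrow> has_parity (cpar E) (\<phi> E y)"
    and AD: "\<And>i j y. y \<in> V \<Longrightarrow> (\<Sum>b\<in>UNIV. A i b y * D j b y + B i b y * C j b y) = (if i = j then 1 else 0)"
    and AB: "\<And>i j y. y \<in> V \<Longrightarrow> (\<Sum>b\<in>UNIV. A i b y * B j b y) = (\<Sum>b\<in>UNIV. B i b y * A j b y)"
    and CD: "\<And>i j y. y \<in> V \<Longrightarrow> (\<Sum>b\<in>UNIV. C i b y * D j b y + D i b y * C j b y) = 0"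
begin

lemma smooths: "smooth_sfun V (A i b)" "smooth_sfun V (B i b)" "smooth_sfun V (C i b)" "smooth_sfun V (D i b)"
  unfolding A_def B_def C_def D_def by (intro smooth_sfun_sder V smooth)+

lemma parities:
  assumes "y \<in> V"
  shows "has_parity 0 (A i b y)" "has_parity 1 (B i b y)" "has_parity 1 (C i b y)" "has_parity 0 (D i b y)"
proof -
  have "has_parity (cpar (Inl b) + cpar (Inl i)) (A i b y)" "has_parity (cpar (Inr b) + cpar (Inl i)) (B i b y)"
    "has_parity (cpar (Inl b) + cpar (Inr i)) (C i b y)" "has_parity (cpar (Inr b) + cpar (Inr i)) (D i b y)"
    unfolding A_def B_def C_def D_def by (intro has_parity_sder[OF V assms] parity; assumption)+
  moreover have "has_parity 2 (D i b y) = has_parity 0 (D i b y)" by (rule has_parity_cong) simp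
  ultimately show "has_parity 0 (A i b y)" "has_parity 1 (B i b y)" "has_parity 1 (C i b y)" "has_parity 0 (D i b y)"
    by (simp_all add: numeral_2_eq_2)
qed

lemma commA: "y \<in> V \<Longrightarrow> A i b y * x = x * A i b y"
  and commD: "y \<in> V \<Longrightarrow> D i b y * x = x * D i b y"
  by (erule even_commute[OF parities(1)], erule even_commute[OF parities(4)])

text \<open>The hypotheses of the locale say that \<open>K\<close> is a right inverse of the
  Jacobian; these equations say that it is also a left inverse.\<close>

lemma inverse:
  assumes y: "y \<in> V"
  shows "(\<Sum>i\<in>UNIV. D i b y * A i a y - B i b y * C i a y) = (if b = a then 1 else 0)"
    and "(\<Sum>i\<in>UNIV. D i b y * B i a y - B i b y * D i a y) = 0"
    and "(\<Sum>i\<in>UNIV. C i b y * A i a y + A i b y * C i a y) = 0"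
    and "(\<Sum>i\<in>UNIV. C i b y * B i a y + A i b y * D i a y) = (if b = a then 1 else 0)"
proof -
  define J where "J E F = sder E (\<phi> F) y" for E F
  define K where "K F E = (case F of Inl b \<Rightarrow> (case E of Inl i \<Rightarrow> D i b y | Inr i \<Rightarrow> - B i b y)
    | Inr b \<Rightarrow> (case E of Inl i \<Rightarrow> C i b y | Inr i \<Rightarrow> A i b y))" for F E
  have J: "J (Inl i) (Inl b) = A i b y" "J (Inl i) (Inr b) = B i b y" "J (Inr i) (Inl b) = C i b y" "J (Inr i) (Inr b) = D i b y" for i b
    by (simp_all add: J_def A_def B_def C_def D_def)
  have K: "K (Inl b) (Inl i) = D i b y" "K (Inl b) (Inr i) = - B i b y" "K (Inr b) (Inl i) = C i b y" "K (Inr b) (Inr i) = A i b y" for i b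
    by (simp_all add: K_def)
  have "(\<Sum>F\<in>UNIV. J E F * K F G) = (if E = G then 1 else 0)" for E G
  proof (cases E; cases G)
    fix i j assume "E = Inl i" "G = Inl j"
    then show ?thesis using AD[OF y, of i j] by (simp add: sum_UNIV_sum J K sum.distrib)
  next
    fix i j assume "E = Inl i" "G = Inr j"
    then show ?thesis using AB[OF y, of i j] by (simp add: sum_UNIV_sum J K sum.distrib sum_negf)
  next
    fix i j assume "E = Inr i" "G = Inl j"
    then show ?thesis using CD[OF y, of i j] by (simp add: sum_UNIV_sum J K sum.distrib)
  next
    fix i j assume EG: "E = Inr i" "G = Inr j"
    have "- (C i b y * B j b y) = B j b y * C i b y" for b
      using odd_anticommute[OF parities(3)[OF y] parities(2)[OF y], of i b j b] by simp
    then show ?thesis using AD[OF y, of j i] EG commA[OF y]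
      by (simp add: sum_UNIV_sum J K sum.distrib add.commute eq_commute[of i])
  qed
  then have KJ: "(\<Sum>F\<in>UNIV. K E F * J F G) = (if E = G then 1 else 0)" for E G
    by (rule matrix_left_right_inverse_grass)
  show "(\<Sum>i\<in>UNIV. D i b y * A i a y - B i b y * C i a y) = (if b = a then 1 else 0)"
    using KJ[of "Inl b" "Inl a"] by (simp add: sum_UNIV_sum J K sum_subtractf sum_negf)
  show "(\<Sum>i\<in>UNIV. D i b y * B i a y - B i b y * D i a y) = 0"
    using KJ[of "Inl b" "Inr a"] by (simp add: sum_UNIV_sum J K sum_subtractf sum_negf)
  show "(\<Sum>i\<in>UNIV. C i b y * A i a y + A i b y * C i a y) = 0"
    using KJ[of "Inr b" "Inl a"] by (simp add: sum_UNIV_sum J K sum.distrib)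
  show "(\<Sum>i\<in>UNIV. C i b y * B i a y + A i b y * D i a y) = (if b = a then 1 else 0)"
    using KJ[of "Inr b" "Inr a"] by (simp add: sum_UNIV_sum J K sum.distrib)
qed

text \<open>The derivative \<open>\<partial>/\<partial>x\<^sup>b\<close> of the target coordinates, written in the source coordinates.\<close>

definition nd :: "'n \<Rightarrow> ('n, 'l) sfun \<Rightarrow> ('n, 'l) sfun"
  where "nd b f = (\<lambda>y. \<Sum>i\<in>UNIV. D i b y * sder (Inl i) f y - B i b y * sder (Inr i) f y)"

text \<open>\<open>nd b\<close> is an even derivation: the sign caused by its odd coefficient
  \<open>B\<close> is compensated by \<open>odd_mult_gi\<close>. So the Leibniz rule has no signs,
  for inhomogeneous functions too.\<close>

lemma nd_mult:
  assumes "y \<in> V" "smooth_sfun V f" "smooth_sfun V g"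
  shows "nd b (\<lambda>y. f y * g y) y = nd b f y * g y + f y * nd b g y"
proof -
  have "D i b y * (f y * x) = f y * (D i b y * x)" for i x
    using commD[OF assms(1), of i b "f y"] by (simp flip: mult.assoc)
  moreover have "B i b y * (gi (f y) * x) = f y * (B i b y * x)" for i x
    using odd_mult_gi[OF parities(2)[OF assms(1)], of i b "f y"] by (simp flip: mult.assoc)
  ultimately show ?thesis
    unfolding nd_def sder_mult[OF V assms]
    by (simp add: twist_def sum_distrib_left sum_distrib_right sum.distrib sum_subtractf algebra_simps)
qed

lemma nd_sum:
  assumes "y \<in> V" "\<And>i. i \<in> I \<Longrightarrow> smooth_sfun V (f i)"
  shows "nd b (\<lambda>y. \<Sum>i\<in>I. f i y) y = (\<Sum>i\<in>I. nd b (f i) y)"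
proof -
  have sd: "sder Z (\<lambda>y. \<Sum>i\<in>I. f i y) y = (\<Sum>i\<in>I. sder Z (f i) y)" for Z
    by (rule sder_sum[OF V assms(1)]) (rule assms(2))
  have "nd b (\<lambda>y. \<Sum>i\<in>I. f i y) y
      = (\<Sum>i\<in>UNIV. \<Sum>k\<in>I. D i b y * sder (Inl i) (f k) y - B i b y * sder (Inr i) (f k) y)"
    unfolding nd_def sd sum_distrib_left sum_subtractf ..
  also have "\<dots> = (\<Sum>k\<in>I. nd b (f k) y)"
    unfolding nd_def by (rule sum.swap)
  finally show ?thesis .
qed

lemma nd_add:
  assumes "y \<in> V" "smooth_sfun V f" "smooth_sfun V g"
  shows "nd b (\<lambda>y. f y + g y) y = nd b f y + nd b g y"
  unfolding nd_def sder_add[OF assms] by (simp add: algebra_simps sum.distrib sum_subtractf)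

lemma nd_uminus:
  assumes "y \<in> V" "smooth_sfun V f"
  shows "nd b (\<lambda>y. - f y) y = - nd b f y"
  unfolding nd_def sder_uminus[OF assms] by (simp add: algebra_simps sum_subtractf)

lemma nd_cong: "y \<in> V \<Longrightarrow> (\<And>y. y \<in> V \<Longrightarrow> f y = g y) \<Longrightarrow> nd b f y = nd b g y"
  unfolding nd_def using sder_cong[OF V, of y f g] by simp

lemma nd_const: "nd b (\<lambda>_. of_real c) y = 0"
  unfolding nd_def by simp

lemma smooth_nd: "smooth_sfun V f \<Longrightarrow> smooth_sfun V (nd b f)"
  unfolding nd_def by (intro smooth_sfun_sum smooth_sfun_diff smooth_sfun_mult smooths smooth_sfun_sder V)

lemma parity_nd:
  assumes "\<And>y. y \<in> V \<Longrightarrow> has_parity p (f y)" "y \<in> V"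
  shows "has_parity p (nd b f y)"
  unfolding nd_def
proof (intro has_parity_sum has_parity_diff)
  fix i
  have "has_parity (0 + (p + cpar (Inl i))) (D i b y * sder (Inl i) f y)"
    by (intro has_parity_mult parities has_parity_sder[OF V assms(2,1)] assms)
  then show "has_parity p (D i b y * sder (Inl i) f y)" by simp
  have "has_parity (1 + (p + cpar (Inr i))) (B i b y * sder (Inr i) f y)"
    by (intro has_parity_mult parities has_parity_sder[OF V assms(2,1)] assms)
  moreover have "has_parity (1 + (p + cpar (Inr i))) (B i b y * sder (Inr i) f y)
      = has_parity p (B i b y * sder (Inr i) f y)" by (rule has_parity_cong) simp
  ultimately show "has_parity p (B i b y * sder (Inr i) f y)" by blast
qed

text \<open>\<open>P\<close> and \<open>Q\<close> stand for the even and odd first derivatives of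
  one function, so that the right side is its odd Laplacian; only the symmetry of their derivatives
  is used, which allows \<open>L\<close> in their place. After expanding \<open>nd\<close>, the
  antisymmetric products of \<open>C\<close> and \<open>D\<close> meet symmetric derivatives and the
  symmetric products of \<open>A\<close> and \<open>B\<close> antisymmetric ones; the rest is
  collected by \<open>AD\<close>.\<close>

lemma second_order:
  assumes y: "y \<in> V"
    and P: "\<And>i j. sder (Inl i) (P j) y = sder (Inl j) (P i) y"
    and Q: "\<And>i j. sder (Inr i) (Q j) y = - sder (Inr j) (Q i) y"
    and PQ: "\<And>i j. sder (Inr i) (P j) y = sder (Inl j) (Q i) y"
  shows "(\<Sum>b\<in>UNIV. \<Sum>j\<in>UNIV. C j b y * nd b (P j) y + A j b y * nd b (Q j) y) = (\<Sum>j\<in>UNIV. sder (Inl j) (Q j) y)"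
proof -
  let ?s = "\<lambda>f. \<Sum>i\<in>UNIV. \<Sum>j\<in>UNIV. f i j :: ('n, 'l) gen grass"
  have e: "C j b y * nd b (P j) y + A j b y * nd b (Q j) y
    = (\<Sum>i\<in>UNIV. C j b y * D i b y * sder (Inl i) (P j) y - C j b y * B i b y * sder (Inr i) (P j) y
       + (A j b y * D i b y * sder (Inl i) (Q j) y - A j b y * B i b y * sder (Inr i) (Q j) y))" for b j
    unfolding nd_def by (simp add: sum_distrib_left right_diff_distrib mult.assoc sum.distrib)
  have "(\<Sum>b\<in>UNIV. \<Sum>j\<in>UNIV. C j b y * nd b (P j) y + A j b y * nd b (Q j) y)
     = (\<Sum>j\<in>UNIV. \<Sum>i\<in>UNIV. \<Sum>b\<in>UNIV. C j b y * D i b y * sder (Inl i) (P j) y - C j b y * B i b y * sder (Inr i) (P j) y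
       + (A j b y * D i b y * sder (Inl i) (Q j) y - A j b y * B i b y * sder (Inr i) (Q j) y))"
    unfolding e by (rule sum_rotate3)
  also have "\<dots> = (\<Sum>j\<in>UNIV. \<Sum>i\<in>UNIV. (\<Sum>b\<in>UNIV. C j b y * D i b y) * sder (Inl i) (P j) y)
      - (\<Sum>j\<in>UNIV. \<Sum>i\<in>UNIV. (\<Sum>b\<in>UNIV. C j b y * B i b y) * sder (Inr i) (P j) y)
      + ((\<Sum>j\<in>UNIV. \<Sum>i\<in>UNIV. (\<Sum>b\<in>UNIV. A j b y * D i b y) * sder (Inl i) (Q j) y)
      - (\<Sum>j\<in>UNIV. \<Sum>i\<in>UNIV. (\<Sum>b\<in>UNIV. A j b y * B i b y) * sder (Inr i) (Q j) y))"
    unfolding sum.distrib sum_subtractf sum_distrib_right ..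
  also have "(\<Sum>j\<in>UNIV. \<Sum>i\<in>UNIV. (\<Sum>b\<in>UNIV. C j b y * D i b y) * sder (Inl i) (P j) y) = 0"
  proof (rule sum_antisym_sym)
    fix k l
    show "(\<Sum>b\<in>UNIV. C k b y * D l b y) = - (\<Sum>b\<in>UNIV. C l b y * D k b y)"
      using CD[OF y, of k l] unfolding sum.distrib commD[OF y] by (simp add: eq_neg_iff_add_eq_0)
  qed (rule P)
  also have "(\<Sum>j\<in>UNIV. \<Sum>i\<in>UNIV. (\<Sum>b\<in>UNIV. A j b y * B i b y) * sder (Inr i) (Q j) y) = 0"
  proof (rule sum_sym_antisym)
    fix k l
    show "(\<Sum>b\<in>UNIV. A k b y * B l b y) = (\<Sum>b\<in>UNIV. A l b y * B k b y)"
      using AB[OF y, of k l] unfolding commA[OF y] .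
  qed (rule Q)
  also have "(\<Sum>j\<in>UNIV. \<Sum>i\<in>UNIV. (\<Sum>b\<in>UNIV. C j b y * B i b y) * sder (Inr i) (P j) y)
     = - (\<Sum>j\<in>UNIV. \<Sum>i\<in>UNIV. (\<Sum>b\<in>UNIV. B j b y * C i b y) * sder (Inl i) (Q j) y)"
  proof -
    have "(\<Sum>b\<in>UNIV. C j b y * B i b y) = - (\<Sum>b\<in>UNIV. B i b y * C j b y)" for i j
      unfolding sum_negf[symmetric] by (intro sum.cong refl odd_anticommute parities y)
    then show ?thesis unfolding PQ by (subst sum.swap) (simp add: sum_negf)
  qed
  also have "0 - - (\<Sum>j\<in>UNIV. \<Sum>i\<in>UNIV. (\<Sum>b\<in>UNIV. B j b y * C i b y) * sder (Inl i) (Q j) y)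
      + ((\<Sum>j\<in>UNIV. \<Sum>i\<in>UNIV. (\<Sum>b\<in>UNIV. A j b y * D i b y) * sder (Inl i) (Q j) y) - 0)
     = (\<Sum>j\<in>UNIV. \<Sum>i\<in>UNIV. (\<Sum>b\<in>UNIV. A j b y * D i b y + B j b y * C i b y) * sder (Inl i) (Q j) y)"
    by (simp add: sum.distrib distrib_right add.commute)
  also have "\<dots> = (\<Sum>j\<in>UNIV. sder (Inl j) (Q j) y)"
    unfolding AD[OF y] by (simp add: if_distrib[of "\<lambda>x. x * _"] cong: if_cong)
  finally show ?thesis .
qed

text \<open>\<open>L Z\<close> turns out to be the logarithmic derivative of the square root of the Berezinian
  (lemma \<open>sder_r\<close> below).\<close>

definition L :: "'n + 'n \<Rightarrow> ('n, 'l) sfun"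
  where "L Z = (\<lambda>y. \<Sum>b\<in>UNIV. nd b (sder Z (\<phi> (Inl b))) y)"

lemma smooth_L: "smooth_sfun V (L Z)"
  unfolding L_def by (intro smooth_sfun_sum smooth_nd smooth_sfun_sder smooth V)

lemma parity_L:
  assumes "y \<in> V"
  shows "has_parity (cpar Z) (L Z y)"
  unfolding L_def
proof (intro has_parity_sum parity_nd assms)
  fix b y assume "y \<in> V"
  then have "has_parity (cpar (Inl b) + cpar Z) (sder Z (\<phi> (Inl b)) y)"
    by (intro has_parity_sder[OF V _ parity])
  then show "has_parity (cpar Z) (sder Z (\<phi> (Inl b)) y)" by simp
qed

lemma comm:
  assumes "y \<in> V" "smooth_sfun V f"
  shows "sder (Inl i) (sder (Inl j) f) y = sder (Inl j) (sder (Inl i) f) y"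
    "sder (Inr i) (sder (Inl j) f) y = sder (Inl j) (sder (Inr i) f) y"
    "sder (Inr i) (sder (Inr j) f) y = - sder (Inr j) (sder (Inr i) f) y"
  using sder_commute[OF V assms, of "Inl i" "Inl j"] sder_commute[OF V assms, of "Inr i" "Inl j"]
    sder_commute[OF V assms, of "Inr i" "Inr j"] by simp_all

text \<open>The rows of J^-1 J = 1 that belong to odd target coordinates are differentiated by
  \<open>nd b\<close> and summed over \<open>b\<close>: the derivatives of the inverse add up to
  \<open>L\<close>, those of J to \<open>Delta\<close> by \<open>second_order\<close>.\<close>

lemma divergence:
  assumes y: "y \<in> V"
  shows "(\<Sum>i\<in>UNIV. L (Inr i) y * sder (Inl i) (\<phi> G) y + L (Inl i) y * sder (Inr i) (\<phi> G) y)
    = - Delta (\<phi> G) y"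
proof -
  let ?P = "\<lambda>i. sder (Inl i) (\<phi> G)" and ?Q = "\<lambda>i. sder (Inr i) (\<phi> G)"
  have sm: "smooth_sfun V (?P i)" "smooth_sfun V (?Q i)" for i
    by (intro smooth_sfun_sder V smooth)+
  have so: "(\<Sum>b\<in>UNIV. \<Sum>j\<in>UNIV. C j b y * nd b (?P j) y + A j b y * nd b (?Q j) y) = Delta (\<phi> G) y"
    unfolding Delta_def by (rule second_order[OF y]) (intro comm[OF y smooth])+
  have "0 = (\<Sum>j\<in>UNIV. nd b (C j b) y * ?P j y + C j b y * nd b (?P j) y
      + (nd b (A j b) y * ?Q j y + A j b y * nd b (?Q j) y))" for b
  proof -
    \<comment> \<open>The constant is 0 against an even coordinate and a Kronecker delta against an
      odd one; \<open>nd b\<close> kills both.\<close>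
    obtain c where c: "\<And>y. y \<in> V \<Longrightarrow> (\<Sum>j\<in>UNIV. C j b y * ?P j y + A j b y * ?Q j y) = of_real c"
    proof (cases G)
      case (Inl a)
      then show ?thesis using inverse(3)[of _ b a] that[of 0] by (simp add: A_def C_def)
    next
      case (Inr a)
      then show ?thesis using inverse(4)[of _ b a] that[of "if b = a then 1 else 0"]
        by (simp add: A_def B_def C_def D_def)
    qed
    have "0 = nd b (\<lambda>y. \<Sum>j\<in>UNIV. C j b y * ?P j y + A j b y * ?Q j y) y"
      using nd_cong[OF y c] nd_const by simp
    also have "\<dots> = (\<Sum>j\<in>UNIV. nd b (\<lambda>y. C j b y * ?P j y + A j b y * ?Q j y) y)"
      by (rule nd_sum[OF y]) (intro smooth_sfun_add smooth_sfun_mult smooths sm V)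
    also have "\<dots> = (\<Sum>j\<in>UNIV. nd b (C j b) y * ?P j y + C j b y * nd b (?P j) y
      + (nd b (A j b) y * ?Q j y + A j b y * nd b (?Q j) y))"
      by (intro sum.cong refl)
        (simp only: nd_add[OF y smooth_sfun_mult[OF V smooths(3) sm(1)] smooth_sfun_mult[OF V smooths(1) sm(2)]]
          nd_mult[OF y smooths(3) sm(1)] nd_mult[OF y smooths(1) sm(2)])
    finally show ?thesis .
  qed
  then have "0 = (\<Sum>b\<in>UNIV. \<Sum>j\<in>UNIV. nd b (C j b) y * ?P j y + C j b y * nd b (?P j) y
      + (nd b (A j b) y * ?Q j y + A j b y * nd b (?Q j) y))"
    by (metis (no_types, lifting) sum.neutral)
  also have "\<dots> = (\<Sum>b\<in>UNIV. \<Sum>j\<in>UNIV. nd b (C j b) y * ?P j y + nd b (A j b) y * ?Q j y)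
      + (\<Sum>b\<in>UNIV. \<Sum>j\<in>UNIV. C j b y * nd b (?P j) y + A j b y * nd b (?Q j) y)"
    by (simp only: sum.distrib) (simp only: add_ac)
  also have "(\<Sum>b\<in>UNIV. \<Sum>j\<in>UNIV. nd b (C j b) y * ?P j y + nd b (A j b) y * ?Q j y)
      = (\<Sum>j\<in>UNIV. L (Inr j) y * ?P j y + L (Inl j) y * ?Q j y)"
    unfolding L_def sum_distrib_right sum.distrib[symmetric] C_def[symmetric] A_def[symmetric]
    by (subst sum.swap) (simp add: A_def C_def)
  finally show ?thesis unfolding so by (simp add: eq_neg_iff_add_eq_0)
qed

end

text \<open>The equation \<open>f s = 1\<close> determines the coefficients of \<open>s\<close> recursively.\<close>

lemma smooth_grass_inverse:
  fixes f s :: "('n::{finite,linorder}, 'l::linorder) sfun"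
  assumes "open V" "smooth_sfun V f" "\<And>y. y \<in> V \<Longrightarrow> f y * s y = 1"
  shows "smooth_sfun V s"
proof -
  have b: "coeff (f y) {} \<noteq> 0" if "y \<in> V" for y
  proof -
    have "body (f y) * body (s y) = 1"
      using arg_cong[OF assms(3)[OF that], of body] by simp
    then show ?thesis by (auto simp: body_def)
  qed
  have "smooth_fun V (\<lambda>y. coeff (s y) S)" for S
  proof (cases "finite S")
    case True
    then show ?thesis
    proof (induction "card S" arbitrary: S rule: less_induct)
      case less
      have "smooth_fun V (\<lambda>y. inverse (coeff (f y) {}) * (coeff 1 S
          + (- 1) * (\<Sum>T\<in>Pow S - {{}}. gsign T (S - T) * coeff (f y) T * coeff (s y) (S - T))))"
      proof (intro smooth_fun_mult smooth_fun_inverse smooth_fun_add smooth_fun_sum smooth_fun_const assms(1) b)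
        fix T assume T: "T \<in> Pow S - {{}}"
        then have "card (S - T) < card S"
          using less.prems by (intro psubset_card_mono) auto
        then show "smooth_fun V (\<lambda>y. coeff (s y) (S - T))" using less by auto
      qed (use assms(2) in \<open>auto simp: smooth_sfun_def\<close>)
      then show ?case
      proof (rule smooth_fun_cong[OF assms(1), rotated])
        fix y assume y: "y \<in> V"
        have "coeff 1 S = coeff (f y * s y) S" using assms(3)[OF y] by simp
        also have "\<dots> = coeff (f y) {} * coeff (s y) S
            + (\<Sum>T\<in>Pow S - {{}}. gsign T (S - T) * coeff (f y) T * coeff (s y) (S - T))"
          unfolding coeff_mult using less.prems by (subst sum.remove[of _ "{}"]) auto
        finally have "coeff 1 S + (- 1) * (\<Sum>T\<in>Pow S - {{}}. gsign T (S - T) * coeff (f y) T * coeff (s y) (S - T))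
            = coeff (f y) {} * coeff (s y) S" by simp
        then show "inverse (coeff (f y) {}) * (coeff 1 S
          + (- 1) * (\<Sum>T\<in>Pow S - {{}}. gsign T (S - T) * coeff (f y) T * coeff (s y) (S - T))) = coeff (s y) S"
          using b[OF y] by simp
      qed
    qed
  qed (simp add: coeff_infinite smooth_fun_const assms(1))
  then show ?thesis by (simp add: smooth_sfun_def)
qed

context canonical_smap
begin

section \<open>Second derivatives in the frame of the Jacobian\<close>

lemma sder_sum_mult:
  assumes "y \<in> V" "\<And>b. smooth_sfun V (F b)" "\<And>b. smooth_sfun V (G b)" "\<And>b. smooth_sfun V (H b)" "\<And>b. smooth_sfun V (K b)"
  shows "sder Z (\<lambda>y. \<Sum>b\<in>UNIV. F b y * G b y + H b y * K b y) y
    = (\<Sum>b\<in>UNIV. sder Z (F b) y * G b y + twist (cpar Z) (F b y) * sder Z (G b) y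
        + (sder Z (H b) y * K b y + twist (cpar Z) (H b y) * sder Z (K b) y))"
proof -
  have "sder Z (\<lambda>y. \<Sum>b\<in>UNIV. F b y * G b y + H b y * K b y) y
      = (\<Sum>b\<in>UNIV. sder Z (\<lambda>y. F b y * G b y + H b y * K b y) y)"
    by (rule sder_sum[OF V assms(1)]) (intro smooth_sfun_add smooth_sfun_mult assms V)
  also have "\<dots> = (\<Sum>b\<in>UNIV. sder Z (F b) y * G b y + twist (cpar Z) (F b y) * sder Z (G b) y
        + (sder Z (H b) y * K b y + twist (cpar Z) (H b y) * sder Z (K b) y))"
    by (intro sum.cong refl)
      (simp only: sder_add[OF assms(1) smooth_sfun_mult[OF V assms(2,3)] smooth_sfun_mult[OF V assms(4,5)]]
        sder_mult[OF V assms(1,2,3)] sder_mult[OF V assms(1,4,5)])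
  finally show ?thesis .
qed

text \<open>A regrouping that never exchanges factors. With columns of the Jacobian for \<alpha> and
  \<beta> the inner sums on the right become entries of J^-1 J.\<close>

lemma frame_expansion:
  fixes u v \<alpha> \<beta> :: "'n \<Rightarrow> ('n, 'l) gen grass"
  shows "(\<Sum>k\<in>UNIV. (\<Sum>c\<in>UNIV. u c * D k c y + v c * C k c y) * \<alpha> k + (\<Sum>c\<in>UNIV. v c * A k c y - u c * B k c y) * \<beta> k)
    = (\<Sum>c\<in>UNIV. u c * (\<Sum>k\<in>UNIV. D k c y * \<alpha> k - B k c y * \<beta> k) + v c * (\<Sum>k\<in>UNIV. C k c y * \<alpha> k + A k c y * \<beta> k))"
proof -
  have "(\<Sum>k\<in>UNIV. (\<Sum>c\<in>UNIV. u c * D k c y + v c * C k c y) * \<alpha> k + (\<Sum>c\<in>UNIV. v c * A k c y - u c * B k c y) * \<beta> k)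
      = (\<Sum>k\<in>UNIV. \<Sum>c\<in>UNIV. u c * (D k c y * \<alpha> k - B k c y * \<beta> k) + v c * (C k c y * \<alpha> k + A k c y * \<beta> k))"
    unfolding sum_distrib_right sum.distrib[symmetric]
    by (intro sum.cong refl) (simp add: algebra_simps)
  also have "\<dots> = (\<Sum>c\<in>UNIV. \<Sum>k\<in>UNIV. u c * (D k c y * \<alpha> k - B k c y * \<beta> k) + v c * (C k c y * \<alpha> k + A k c y * \<beta> k))"
    by (rule sum.swap)
  also have "\<dots> = (\<Sum>c\<in>UNIV. u c * (\<Sum>k\<in>UNIV. D k c y * \<alpha> k - B k c y * \<beta> k) + v c * (\<Sum>k\<in>UNIV. C k c y * \<alpha> k + A k c y * \<beta> k))"
    unfolding sum_distrib_left sum.distrib[symmetric] ..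
  finally show ?thesis .
qed

lemma parities_sder:
  assumes "y \<in> V"
  shows "has_parity 1 (sder (Inl i) (C j b) y)" "has_parity 0 (sder (Inl i) (D j b) y)"
proof -
  have "has_parity (1 + cpar (Inl i)) (sder (Inl i) (C j b) y)"
    by (rule has_parity_sder[OF V assms]) (rule parities(3))
  moreover have "has_parity (0 + cpar (Inl i)) (sder (Inl i) (D j b) y)"
    by (rule has_parity_sder[OF V assms]) (rule parities(4))
  ultimately show "has_parity 1 (sder (Inl i) (C j b) y)" "has_parity 0 (sder (Inl i) (D j b) y)"
    by simp_all
qed

lemma jacobian_blocks:
  "sder (Inl i) (\<phi> (Inl b)) = A i b" "sder (Inl i) (\<phi> (Inr b)) = B i b"
  "sder (Inr i) (\<phi> (Inl b)) = C i b" "sder (Inr i) (\<phi> (Inr b)) = D i b"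
  by (simp_all add: A_def B_def C_def D_def)

lemma twist_0: "twist 0 a = a"
  by (simp add: twist_def)

text \<open>Multiplying the derivatives of the blocks \<open>C\<close> and \<open>D\<close> by J^-1
  yields their frame components \<open>S\<close> and \<open>R\<close>. Differentiating
  \<open>CD\<close> makes \<open>S\<close> antisymmetric in its last two indices; differentiating
  \<open>AD\<close>, together with the symmetry of second derivatives, makes \<open>R\<close>
  symmetric in its first two. Then \<open>contraction_zero\<close> applies.\<close>

lemma mixed_contraction:
  assumes y: "y \<in> V"
  shows "(\<Sum>i\<in>UNIV. \<Sum>j\<in>UNIV. \<Sum>b\<in>UNIV. sder (Inl i) (D j b) y * sder (Inl j) (C i b) y) = 0"
proof -
  define S where "S i j k = (\<Sum>b\<in>UNIV. sder (Inl i) (C j b) y * D k b y + sder (Inl i) (D j b) y * C k b y)" for i j k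
  define R where "R i k j = (\<Sum>b\<in>UNIV. sder (Inl i) (D j b) y * A k b y - sder (Inl i) (C j b) y * B k b y)" for i j k
  note pd = parities_sder[OF y]
  have dC: "(\<Sum>k\<in>UNIV. S i j k * A k b y + R i k j * C k b y) = sder (Inl i) (C j b) y" for i j b
    unfolding S_def R_def frame_expansion inverse[OF y] by (simp add: if_distrib[of "(*) _"] cong: if_cong)
  have dD: "(\<Sum>k\<in>UNIV. S i j k * B k b y + R i k j * D k b y) = sder (Inl i) (D j b) y" for i j b
    unfolding S_def R_def frame_expansion inverse[OF y] by (simp add: if_distrib[of "(*) _"] cong: if_cong)
  have z: "sder Z (\<lambda>y. \<Sum>b\<in>UNIV. C j b y * D k b y + D j b y * C k b y) y = 0" for Z j k
    using sder_cong[OF V y, of "\<lambda>y. \<Sum>b\<in>UNIV. C j b y * D k b y + D j b y * C k b y" "\<lambda>_. 0" Z] CD by simp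
  have z': "sder Z (\<lambda>y. \<Sum>b\<in>UNIV. A k b y * D j b y + B k b y * C j b y) y = 0" for Z j k
    using sder_cong[OF V y, of "\<lambda>y. \<Sum>b\<in>UNIV. A k b y * D j b y + B k b y * C j b y" "\<lambda>_. of_real (if k = j then 1 else 0)" Z] AD
    by simp
  have SS: "S i j k = - S i k j" for i j k
  proof -
    have "S i j k + S i k j = (\<Sum>b\<in>UNIV. sder (Inl i) (C j b) y * D k b y + C j b y * sder (Inl i) (D k b) y
        + (sder (Inl i) (D j b) y * C k b y + D j b y * sder (Inl i) (C k b) y))"
      unfolding S_def sum.distrib[symmetric]
      by (intro sum.cong refl) (simp add: commD[OF y] even_commute[OF pd(2), of i k _ "C j _ y"] add_ac)
    also have "\<dots> = sder (Inl i) (\<lambda>y. \<Sum>b\<in>UNIV. C j b y * D k b y + D j b y * C k b y) y"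
      by (subst sder_sum_mult[OF y smooths(3,4,4,3)]) (simp only: cpar.simps twist_0)
    finally show ?thesis by (simp add: z eq_neg_iff_add_eq_0)
  qed
  have RR: "R i k j = R k i j" for i k j
  proof -
    \<comment> \<open>The derivative moves from \<open>C\<close> and \<open>D\<close> to
      \<open>A\<close> and \<open>B\<close>, where \<open>i\<close> and \<open>k\<close> are the two
      differentiation indices of \<phi>.\<close>
    have "R i k j = - (\<Sum>b\<in>UNIV. sder (Inl i) (A k b) y * D j b y + sder (Inl i) (B k b) y * C j b y)" for i k
    proof -
      have "R i k j = (\<Sum>b\<in>UNIV. A k b y * sder (Inl i) (D j b) y + B k b y * sder (Inl i) (C j b) y)"
        unfolding R_def
        by (intro sum.cong refl) (simp add: commA[OF y] odd_anticommute[OF parities(2)[OF y] pd(1)])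
      then have "R i k j + (\<Sum>b\<in>UNIV. sder (Inl i) (A k b) y * D j b y + sder (Inl i) (B k b) y * C j b y)
          = (\<Sum>b\<in>UNIV. sder (Inl i) (A k b) y * D j b y + A k b y * sder (Inl i) (D j b) y
             + (sder (Inl i) (B k b) y * C j b y + B k b y * sder (Inl i) (C j b) y))"
        by (simp add: sum.distrib)
      also have "\<dots> = sder (Inl i) (\<lambda>y. \<Sum>b\<in>UNIV. A k b y * D j b y + B k b y * C j b y) y"
        by (subst sder_sum_mult[OF y smooths(1,4,2,3)]) (simp only: cpar.simps twist_0)
      finally show ?thesis by (simp add: z' eq_neg_iff_add_eq_0)
    qed
    moreover have "sder (Inl i) (A k b) y = sder (Inl k) (A i b) y" "sder (Inl i) (B k b) y = sder (Inl k) (B i b) y" for b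
      unfolding A_def B_def by (rule comm[OF y smooth])+
    ultimately show ?thesis by simp
  qed
  have pS: "has_parity 1 (S i j k)" and pR: "has_parity 0 (R i j k)" for i j k
  proof -
    have "has_parity (1 + 0) (sder (Inl i) (C j b) y * D k b y)" "has_parity (0 + 1) (sder (Inl i) (D j b) y * C k b y)" for b
      by (intro has_parity_mult pd parities y)+
    then show "has_parity 1 (S i j k)" unfolding S_def by (intro has_parity_sum has_parity_add) simp_all
    have "has_parity (0 + 0) (sder (Inl i) (D k b) y * A j b y)" "has_parity (1 + 1) (sder (Inl i) (C k b) y * B j b y)" for b
      by (intro has_parity_mult pd parities y)+
    moreover have "has_parity (1 + 1) x = has_parity 0 x" for x :: "('n, 'l) gen grass" by (rule has_parity_cong) simp
    ultimately show "has_parity 0 (R i j k)" unfolding R_def by (intro has_parity_sum has_parity_diff) simp_all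
  qed
  have "(\<Sum>i\<in>UNIV. \<Sum>j\<in>UNIV. \<Sum>b\<in>UNIV. (\<Sum>k\<in>UNIV. S i j k * B k b y + R i k j * D k b y)
    * (\<Sum>l\<in>UNIV. S j i l * A l b y + R j l i * C l b y)) = 0"
    by (rule contraction_zero[OF parities(1)[OF y] parities(2)[OF y] parities(4)[OF y] pS pR AD[OF y] AB[OF y] CD[OF y] SS RR])
  then show ?thesis unfolding dC dD .
qed

text \<open>\<open>nd b\<close> has variable coefficients; the extra sum is its commutator with the
  derivative in x^i.\<close>

lemma sder_nd:
  assumes y: "y \<in> V" and f: "smooth_sfun V f"
  shows "sder (Inl i) (nd b f) y = nd b (sder (Inl i) f) y
    + (\<Sum>j\<in>UNIV. sder (Inl i) (D j b) y * sder (Inl j) f y - sder (Inl i) (B j b) y * sder (Inr j) f y)"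
proof -
  have sm: "smooth_sfun V (\<lambda>y. - B j b y)" "smooth_sfun V (sder Z f)" for j Z
    by (intro smooth_sfun_uminus smooths V smooth_sfun_sder f)+
  have "sder (Inl i) (nd b f) y = sder (Inl i) (\<lambda>y. \<Sum>j\<in>UNIV. D j b y * sder (Inl j) f y + - B j b y * sder (Inr j) f y) y"
    unfolding nd_def by simp
  also have "\<dots> = (\<Sum>j\<in>UNIV. sder (Inl i) (D j b) y * sder (Inl j) f y + D j b y * sder (Inl i) (sder (Inl j) f) y
     + (- sder (Inl i) (B j b) y * sder (Inr j) f y + - B j b y * sder (Inl i) (sder (Inr j) f) y))"
    by (subst sder_sum_mult[OF y smooths(4) sm(2) sm(1) sm(2)])
      (simp only: cpar.simps twist_0 sder_uminus[OF y smooths(2)])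
  also have "\<dots> = nd b (sder (Inl i) f) y
    + (\<Sum>j\<in>UNIV. sder (Inl i) (D j b) y * sder (Inl j) f y - sder (Inl i) (B j b) y * sder (Inr j) f y)"
    unfolding nd_def comm(1)[OF y f, of _ i] comm(2)[OF y f, of _ i] sum.distrib[symmetric]
    by (intro sum.cong refl) (simp add: algebra_simps comm(1)[OF y f, of i])
  finally show ?thesis .
qed

text \<open>The sum \<open>E\<close> of the derivatives of \<open>L (Inr i)\<close> is computed from
  the definition of \<open>L\<close>. Up to commutators that vanish, it is the sum of
  \<open>nd b\<close> applied to the odd Laplacians of the even coordinates.
  \<open>divergence\<close> rewrites these through \<open>L\<close>, and the product rule returns
  \<open>- E\<close>, by \<open>second_order\<close>, minus twice the quadratic term.\<close>

lemma laplace_log_volume: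
  assumes y: "y \<in> V"
    and P: "\<And>i j. sder (Inl i) (L (Inl j)) y = sder (Inl j) (L (Inl i)) y"
    and Q: "\<And>i j. sder (Inr i) (L (Inr j)) y = - sder (Inr j) (L (Inr i)) y"
    and PQ: "\<And>i j. sder (Inr i) (L (Inl j)) y = sder (Inl j) (L (Inr i)) y"
  shows "(\<Sum>i\<in>UNIV. L (Inl i) y * L (Inr i) y + sder (Inl i) (L (Inr i)) y) = 0"
proof -
  define E where "E = (\<Sum>i\<in>UNIV. sder (Inl i) (L (Inr i)) y)"
  define LL where "LL = (\<Sum>i\<in>UNIV. L (Inl i) y * L (Inr i) y)"
  have sC: "smooth_sfun V (sder (Inl i) (C j b))" for i j b by (intro smooth_sfun_sder smooths V)
  have so: "(\<Sum>b\<in>UNIV. \<Sum>j\<in>UNIV. C j b y * nd b (L (Inl j)) y + A j b y * nd b (L (Inr j)) y) = E"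
    unfolding E_def by (rule second_order[OF y P Q PQ])
  have ndD: "nd b (Delta (\<phi> (Inl b))) y
     = - (\<Sum>i\<in>UNIV. nd b (L (Inr i)) y * A i b y + L (Inr i) y * nd b (A i b) y
          + (nd b (L (Inl i)) y * C i b y + L (Inl i) y * nd b (C i b) y))" for b
  proof -
    have "Delta (\<phi> (Inl b)) y' = - (\<Sum>i\<in>UNIV. L (Inr i) y' * A i b y' + L (Inl i) y' * C i b y')" if "y' \<in> V" for y'
      unfolding A_def C_def divergence[OF that] by simp
    then have "nd b (Delta (\<phi> (Inl b))) y = nd b (\<lambda>y. - (\<Sum>i\<in>UNIV. L (Inr i) y * A i b y + L (Inl i) y * C i b y)) y"
      by (rule nd_cong[OF y])
    also have "\<dots> = - nd b (\<lambda>y. \<Sum>i\<in>UNIV. L (Inr i) y * A i b y + L (Inl i) y * C i b y) y"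
      by (rule nd_uminus[OF y]) (intro smooth_sfun_sum smooth_sfun_add smooth_sfun_mult smooth_L smooths V)
    also have "nd b (\<lambda>y. \<Sum>i\<in>UNIV. L (Inr i) y * A i b y + L (Inl i) y * C i b y) y
        = (\<Sum>i\<in>UNIV. nd b (\<lambda>y. L (Inr i) y * A i b y + L (Inl i) y * C i b y) y)"
      by (rule nd_sum[OF y]) (intro smooth_sfun_add smooth_sfun_mult smooth_L smooths V)
    also have "\<dots> = (\<Sum>i\<in>UNIV. nd b (L (Inr i)) y * A i b y + L (Inr i) y * nd b (A i b) y
          + (nd b (L (Inl i)) y * C i b y + L (Inl i) y * nd b (C i b) y))"
      by (intro sum.cong refl)
        (simp only: nd_add[OF y smooth_sfun_mult[OF V smooth_L smooths(1)] smooth_sfun_mult[OF V smooth_L smooths(3)]]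
          nd_mult[OF y smooth_L smooths(1)] nd_mult[OF y smooth_L smooths(3)])
    finally show ?thesis .
  qed
  have "E = (\<Sum>i\<in>UNIV. \<Sum>b\<in>UNIV. sder (Inl i) (nd b (C i b)) y)"
    unfolding E_def L_def jacobian_blocks
    by (intro sum.cong refl sder_sum[OF V y] smooth_nd smooths)
  also have "\<dots> = (\<Sum>i\<in>UNIV. \<Sum>b\<in>UNIV. nd b (sder (Inl i) (C i b)) y)
      + (\<Sum>i\<in>UNIV. \<Sum>b\<in>UNIV. \<Sum>j\<in>UNIV. sder (Inl i) (D j b) y * sder (Inl j) (C i b) y)
      - (\<Sum>i\<in>UNIV. \<Sum>b\<in>UNIV. \<Sum>j\<in>UNIV. sder (Inl i) (B j b) y * sder (Inr j) (C i b) y)"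
    unfolding sder_nd[OF y smooths(3)] sum.distrib sum_subtractf by simp
  also have "(\<Sum>i\<in>UNIV. \<Sum>b\<in>UNIV. \<Sum>j\<in>UNIV. sder (Inl i) (D j b) y * sder (Inl j) (C i b) y) = 0"
  proof -
    have "(\<Sum>i\<in>UNIV. \<Sum>b\<in>UNIV. \<Sum>j\<in>UNIV. sder (Inl i) (D j b) y * sder (Inl j) (C i b) y)
        = (\<Sum>i\<in>UNIV. \<Sum>j\<in>UNIV. \<Sum>b\<in>UNIV. sder (Inl i) (D j b) y * sder (Inl j) (C i b) y)"
      by (intro sum.cong refl sum.swap)
    then show ?thesis using mixed_contraction[OF y] by simp
  qed
  \<comment> \<open>Second derivatives in x, symmetric in \<open>i\<close> and \<open>j\<close>,
    meet second derivatives in \<theta>, which are antisymmetric.\<close>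
  also have "(\<Sum>i\<in>UNIV. \<Sum>b\<in>UNIV. \<Sum>j\<in>UNIV. sder (Inl i) (B j b) y * sder (Inr j) (C i b) y) = 0"
  proof -
    have "(\<Sum>i\<in>UNIV. \<Sum>b\<in>UNIV. \<Sum>j\<in>UNIV. sder (Inl i) (B j b) y * sder (Inr j) (C i b) y)
        = (\<Sum>b\<in>UNIV. \<Sum>i\<in>UNIV. \<Sum>j\<in>UNIV. sder (Inl i) (B j b) y * sder (Inr j) (C i b) y)"
      by (rule sum.swap)
    also have "\<dots> = 0"
    proof (rule sum.neutral, rule ballI, rule sum_sym_antisym)
      fix b k l
      show "sder (Inl k) (B l b) y = sder (Inl l) (B k b) y" unfolding B_def by (rule comm[OF y smooth])
      show "sder (Inr l) (C k b) y = - sder (Inr k) (C l b) y" unfolding C_def by (rule comm[OF y smooth])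
    qed
    finally show ?thesis .
  qed
  also have "(\<Sum>i\<in>UNIV. \<Sum>b\<in>UNIV. nd b (sder (Inl i) (C i b)) y) = (\<Sum>b\<in>UNIV. nd b (Delta (\<phi> (Inl b))) y)"
    unfolding Delta_def jacobian_blocks by (subst sum.swap) (simp add: nd_sum[OF y sC])
  also have "\<dots> = - (\<Sum>b\<in>UNIV. \<Sum>i\<in>UNIV. C i b y * nd b (L (Inl i)) y + A i b y * nd b (L (Inr i)) y)
      - (\<Sum>b\<in>UNIV. \<Sum>i\<in>UNIV. L (Inl i) y * nd b (C i b) y + L (Inr i) y * nd b (A i b) y)"
  proof -
    have pn: "has_parity 0 (nd b (L (Inl i)) y)" for b i
      using parity_nd[of 0 "L (Inl i)", OF _ y] parity_L[of _ "Inl i"] by simp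
    have "nd b (L (Inr i)) y * A i b y + L (Inr i) y * nd b (A i b) y + (nd b (L (Inl i)) y * C i b y + L (Inl i) y * nd b (C i b) y)
        = (C i b y * nd b (L (Inl i)) y + A i b y * nd b (L (Inr i)) y) + (L (Inl i) y * nd b (C i b) y + L (Inr i) y * nd b (A i b) y)" for b i
      unfolding commA[OF y, of i b "nd b (L (Inr i)) y"] even_commute[OF pn, of b i "C i b y"] by (simp only: add_ac)
    then show ?thesis unfolding ndD by (simp only: sum.distrib sum_negf minus_add_distrib diff_conv_add_uminus) 
  qed
  also have "(\<Sum>b\<in>UNIV. \<Sum>i\<in>UNIV. L (Inl i) y * nd b (C i b) y + L (Inr i) y * nd b (A i b) y)
     = (\<Sum>i\<in>UNIV. L (Inl i) y * L (Inr i) y + L (Inr i) y * L (Inl i) y)"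
  proof -
    have "(\<Sum>b\<in>UNIV. nd b (C i b) y) = L (Inr i) y" "(\<Sum>b\<in>UNIV. nd b (A i b) y) = L (Inl i) y" for i
      by (simp_all add: L_def A_def C_def)
    then show ?thesis
      by (subst sum.swap) (simp add: sum.distrib flip: sum_distrib_left)
  qed
  also have "\<dots> = LL + LL"
  proof -
    have "L (Inr i) y * L (Inl i) y = L (Inl i) y * L (Inr i) y" for i
      using even_commute[of "L (Inl i) y" "L (Inr i) y"] parity_L[OF y, of "Inl i"] by simp
    then show ?thesis by (simp add: LL_def sum.distrib)
  qed
  \<comment> \<open>\<open>E\<close> occurs on both sides with opposite signs, so
    \<open>LL + E\<close> equals its own negative.\<close>
  finally have "E = - E - (LL + LL) + 0 - 0" unfolding so .
  then have "LL + E = - (LL + E)" by (simp add: algebra_simps)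
  then have "LL + E = 0" by (rule eq_uminus_self)
  then show ?thesis by (simp add: LL_def E_def sum.distrib)
qed

section \<open>The Berezinian of a canonical transformation\<close>

definition r :: "('n, 'l) sfun"
  where "r y = ginv (gdet (\<lambda>i b. D i b y))"

text \<open>The inverse of \<open>D\<close> by Cramer's rule, column index first. The cofactors
  reappear when the determinant is differentiated in \<open>sder_r\<close>.\<close>

definition Y :: "'n \<Rightarrow> 'n \<Rightarrow> ('n, 'l) sfun"
  where "Y a i y = r y * gcofactor (\<lambda>i b. D i b y) i a"

text \<open>On bodies the odd blocks vanish, and \<open>AD\<close> makes the real matrices of
  \<open>A\<close> and \<open>D\<close> inverse to each other up to transposition.\<close>

lemma body_gdet_D:
  assumes y: "y \<in> V"
  shows "body (gdet (\<lambda>i b. D i b y)) \<noteq> 0"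
proof -
  define A0 D0 where "A0 = (\<chi> i b. body (A i b y))" and "D0 = (\<chi> i b. body (D i b y))"
  have "(\<Sum>b\<in>UNIV. body (A i b y) * body (D j b y)) = (if i = j then 1 else 0)" for i j
    using arg_cong[OF AD[OF y, of i j], of body]
    by (simp add: body_odd[OF parities(2)[OF y]] body_odd[OF parities(3)[OF y]])
  then have "A0 ** transpose D0 = mat 1"
    by (simp add: A0_def D0_def matrix_matrix_mult_def transpose_def mat_def vec_eq_iff)
  then have "det A0 * det D0 = 1" by (metis det_I det_mul det_transpose)
  then show ?thesis by (auto simp: body_gdet D0_def)
qed

lemma r_inverse:
  assumes y: "y \<in> V"
  shows "has_parity 0 (r y)" "gdet (\<lambda>i b. D i b y) * r y = 1" "r y * gdet (\<lambda>i b. D i b y) = 1"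
    "is_matrix_inverse (\<lambda>i b. D i b y) (\<lambda>a i. Y a i y)"
proof -
  obtain s where "has_parity 0 s" "gdet (\<lambda>i b. D i b y) * s = 1" "s * gdet (\<lambda>i b. D i b y) = 1"
    "ginv (gdet (\<lambda>i b. D i b y)) = s" "is_matrix_inverse (\<lambda>i b. D i b y) (\<lambda>k i. s * gcofactor (\<lambda>i b. D i b y) i k)"
    by (rule gdet_inverse[of "\<lambda>i b. D i b y", OF parities(4)[OF y] body_gdet_D[OF y]])
  then show "has_parity 0 (r y)" "gdet (\<lambda>i b. D i b y) * r y = 1" "r y * gdet (\<lambda>i b. D i b y) = 1"
    "is_matrix_inverse (\<lambda>i b. D i b y) (\<lambda>a i. Y a i y)"
    by (simp_all add: r_def Y_def)
qed

lemma DY: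
  assumes "y \<in> V"
  shows "(\<Sum>b\<in>UNIV. D i b y * Y b j y) = (if i = j then 1 else 0)"
    and "(\<Sum>i\<in>UNIV. Y a i y * D i b y) = (if a = b then 1 else 0)"
  using r_inverse(4)[OF assms] unfolding is_matrix_inverse_def by blast+

lemma even_Y: "y \<in> V \<Longrightarrow> has_parity 0 (Y a i y)"
proof -
  assume y: "y \<in> V"
  have "has_parity (0 + 0) (Y a i y)"
    unfolding Y_def by (intro has_parity_mult r_inverse(1)[OF y] even_gcofactor parities(4)[OF y])
  then show ?thesis by simp
qed

lemma commY: "y \<in> V \<Longrightarrow> x * Y a i y = Y a i y * x"
  by (rule even_commute[OF even_Y, symmetric])

lemma YD: "y \<in> V \<Longrightarrow> (\<Sum>b\<in>UNIV. Y b k y * D i b y) = (if i = k then 1 else 0)"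
  using DY(1)[of y i k] by (simp add: commD)

text \<open>The product B D^-1, which meets \<open>C\<close> in the Schur complement.\<close>

definition \<Gamma> :: "'n \<Rightarrow> 'n \<Rightarrow> ('n, 'l) sfun"
  where "\<Gamma> i j y = (\<Sum>b\<in>UNIV. B i b y * Y b j y)"

text \<open>In matrix form B^T D = D^T B by \<open>inverse\<close>, so \<Gamma>^T D = B. As also
  \<Gamma> D = B by definition, \<Gamma> is symmetric, which is \<open>\<Gamma>_sym\<close>.\<close>

lemma \<Gamma>_D:
  assumes y: "y \<in> V"
  shows "(\<Sum>i\<in>UNIV. \<Gamma> i k y * D i a y) = B k a y"
proof -
  have K: "(\<Sum>i\<in>UNIV. D i b y * B i a y) = (\<Sum>i\<in>UNIV. B i b y * D i a y)" for b a
    using inverse(2)[OF y, of b a] by (simp add: sum_subtractf)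
  have "(\<Sum>i\<in>UNIV. \<Gamma> i k y * D i a y) = (\<Sum>i\<in>UNIV. \<Sum>b\<in>UNIV. Y b k y * (B i b y * D i a y))"
    unfolding \<Gamma>_def sum_distrib_right
    by (intro sum.cong refl) (simp only: commY[OF y, of "B _ _ y"] mult.assoc)
  also have "\<dots> = (\<Sum>b\<in>UNIV. Y b k y * (\<Sum>i\<in>UNIV. B i b y * D i a y))"
    unfolding sum_distrib_left by (rule sum.swap)
  also have "\<dots> = (\<Sum>b\<in>UNIV. \<Sum>i\<in>UNIV. Y b k y * D i b y * B i a y)"
    unfolding K[symmetric] sum_distrib_left mult.assoc ..
  also have "\<dots> = (\<Sum>i\<in>UNIV. (\<Sum>b\<in>UNIV. Y b k y * D i b y) * B i a y)"
    unfolding sum_distrib_right by (rule sum.swap)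
  also have "\<dots> = B k a y"
    unfolding YD[OF y] by (simp add: if_distrib[of "\<lambda>x. x * _"] cong: if_cong)
  finally show ?thesis .
qed

lemma \<Gamma>_sym:
  assumes y: "y \<in> V"
  shows "\<Gamma> l k y = \<Gamma> k l y"
proof -
  have "\<Gamma> k l y = (\<Sum>a\<in>UNIV. \<Sum>i\<in>UNIV. \<Gamma> i k y * (D i a y * Y a l y))"
    unfolding \<Gamma>_def[of k l] \<Gamma>_D[OF y, symmetric] sum_distrib_right mult.assoc ..
  also have "\<dots> = (\<Sum>i\<in>UNIV. \<Gamma> i k y * (\<Sum>a\<in>UNIV. D i a y * Y a l y))"
    unfolding sum_distrib_left by (rule sum.swap)
  also have "\<dots> = \<Gamma> l k y"
    unfolding DY(1)[OF y] by (simp add: if_distrib[of "(*) _"] cong: if_cong)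
  finally show ?thesis ..
qed

text \<open>The relation D^T A - B^T C = 1 multiplied by the inverse of D^T. It identifies the Schur
  complement of \<open>D\<close> with the transpose of \<open>Y\<close>.\<close>

lemma A_Y:
  assumes y: "y \<in> V"
  shows "A k a y = Y a k y + (\<Sum>i\<in>UNIV. \<Gamma> i k y * C i a y)"
proof -
  have "Y a k y = (\<Sum>b\<in>UNIV. Y b k y * (\<Sum>i\<in>UNIV. D i b y * A i a y - B i b y * C i a y))"
    unfolding inverse(1)[OF y] by (simp add: if_distrib[of "(*) _"] cong: if_cong)
  also have "\<dots> = (\<Sum>i\<in>UNIV. \<Sum>b\<in>UNIV. Y b k y * (D i b y * A i a y - B i b y * C i a y))"
    unfolding sum_distrib_left by (rule sum.swap)
  also have "\<dots> = (\<Sum>i\<in>UNIV. (\<Sum>b\<in>UNIV. Y b k y * D i b y) * A i a y) - (\<Sum>i\<in>UNIV. \<Gamma> i k y * C i a y)"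
    unfolding \<Gamma>_def commY[OF y, of "B _ _ y"] sum_distrib_right sum_subtractf[symmetric] right_diff_distrib mult.assoc ..
  also have "(\<Sum>i\<in>UNIV. (\<Sum>b\<in>UNIV. Y b k y * D i b y) * A i a y) = A k a y"
    unfolding YD[OF y] by (simp add: if_distrib[of "\<lambda>x. x * _"] cong: if_cong)
  finally show ?thesis by simp
qed

lemma DC_antisym:
  assumes y: "y \<in> V"
  shows "(\<Sum>b\<in>UNIV. D k b y * C l b y) = - (\<Sum>b\<in>UNIV. D l b y * C k b y)"
  using CD[OF y, of k l] unfolding sum.distrib commD[OF y] by (simp add: eq_neg_iff_add_eq_0 add.commute)

text \<open>\<open>B\<close> is written through \<Gamma> and \<open>D\<close>; the symmetric
  \<Gamma> then meets the antisymmetric products of \<open>D\<close> and \<open>C\<close>.\<close>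

lemma trace_BC:
  assumes y: "y \<in> V"
  shows "(\<Sum>i\<in>UNIV. \<Sum>b\<in>UNIV. B i b y * C i b y) = 0"
proof -
  have "(\<Sum>i\<in>UNIV. \<Sum>b\<in>UNIV. B i b y * C i b y) = (\<Sum>i\<in>UNIV. \<Sum>b\<in>UNIV. \<Sum>j\<in>UNIV. \<Gamma> j i y * (D j b y * C i b y))"
    unfolding \<Gamma>_D[OF y, symmetric] sum_distrib_right mult.assoc ..
  also have "\<dots> = (\<Sum>i\<in>UNIV. \<Sum>j\<in>UNIV. \<Gamma> j i y * (\<Sum>b\<in>UNIV. D j b y * C i b y))"
    unfolding sum_distrib_left by (intro sum.cong refl sum.swap)
  also have "\<dots> = 0"
    by (rule sum_sym_antisym) (rule \<Gamma>_sym[OF y], rule DC_antisym[OF y])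
  finally show ?thesis .
qed

lemma Ber_eq:
  assumes y: "y \<in> V"
  shows "Ber (super_jacobian \<phi> y) = r y * r y"
proof -
  have inv: "gmatrix_inv (\<lambda>i j. D i j y) = (\<lambda>a i. Y a i y)"
    by (rule gmatrix_inv_eq[OF r_inverse(4)[OF y]])
  have schur: "A i j y - (\<Sum>k\<in>UNIV. \<Sum>l\<in>UNIV. B i k y * Y k l y * C l j y) = Y j i y" for i j
  proof -
    have "(\<Sum>k\<in>UNIV. \<Sum>l\<in>UNIV. B i k y * Y k l y * C l j y) = (\<Sum>l\<in>UNIV. \<Gamma> i l y * C l j y)"
      unfolding \<Gamma>_def sum_distrib_right by (rule sum.swap)
    then show ?thesis using A_Y[OF y, of i j] \<Gamma>_sym[OF y, of i] by simp
  qed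
  have ev: "has_parity 0 (Y j i y)" for i j by (rule even_Y[OF y])
  have "gdet (\<lambda>i j. Y j i y) = gdet (\<lambda>i j. Y i j y)"
    by (rule gdet_transpose[of "\<lambda>i j. Y i j y"]) (rule ev)
  also have "\<dots> = r y"
  proof -
    have g: "gdet (\<lambda>i j. Y i j y) * gdet (\<lambda>i j. D i j y) = 1"
      by (rule gdet_inverse_mult[OF ev parities(4)[OF y] DY(2)[OF y]])
    have "gdet (\<lambda>i j. Y i j y) = gdet (\<lambda>i j. Y i j y) * (gdet (\<lambda>i j. D i j y) * r y)"
      unfolding r_inverse(2)[OF y] by simp
    then show ?thesis unfolding mult.assoc[symmetric] g by simp
  qed
  finally have g: "gdet (\<lambda>i j. Y j i y) = r y" .
  show ?thesis
    unfolding Ber_def super_jacobian_def Let_def jacobian_blocks inv schur g r_def[symmetric] ..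
qed

lemma smooth_r: "smooth_sfun V r"
  by (rule smooth_grass_inverse[OF V smooth_gdet[OF V smooths(4)] r_inverse(2)])

text \<open>By definition \<open>L\<close> is the trace of D dA minus, up to sign, that of B dC.
  Three differentiated identities turn dA into dD: the trace of \<open>AD\<close>,
  \<open>trace_BC\<close>, and \<open>CD\<close> contracted with \<Gamma>. What remains is minus the
  logarithmic derivative of det D.\<close>

lemma L_trace:
  assumes y: "y \<in> V"
  shows "L Z y = - (\<Sum>i\<in>UNIV. \<Sum>b\<in>UNIV. Y b i y * sder Z (D i b) y)"
proof -
  let ?d = "\<lambda>f. sder Z f y" and ?s = "(- 1::real) ^ cpar Z"
  have tB: "twist (cpar Z) (B i b y) = ?s *\<^sub>R B i b y" and tC: "twist (cpar Z) (C i b y) = ?s *\<^sub>R C i b y"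
    and tA: "twist (cpar Z) (A i b y) = A i b y" and tD: "twist (cpar Z) (D i b y) = D i b y" for i b
    using twist_parity[OF parities(2)[OF y], of "cpar Z"] twist_parity[OF parities(3)[OF y], of "cpar Z"]
      twist_even[OF parities(1)[OF y]] twist_even[OF parities(4)[OF y]] by simp_all
  have comm1: "sder (Inl i) (sder Z (\<phi> (Inl b))) y = ?d (A i b)"
    "sder (Inr i) (sder Z (\<phi> (Inl b))) y = ?s *\<^sub>R ?d (C i b)" for i b
    using sder_commute[OF V y smooth, of "Inl i" Z] sder_commute[OF V y smooth, of "Inr i" Z]
    by (simp_all add: jacobian_blocks)
  have L: "L Z y = (\<Sum>i\<in>UNIV. \<Sum>b\<in>UNIV. D i b y * ?d (A i b)) - ?s *\<^sub>R (\<Sum>i\<in>UNIV. \<Sum>b\<in>UNIV. B i b y * ?d (C i b))"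
    unfolding L_def nd_def comm1 by (subst sum.swap) (simp add: sum_subtractf scaleR_sum_right)
  have "(\<Sum>i\<in>UNIV. ?d (\<lambda>y. \<Sum>b\<in>UNIV. A i b y * D i b y + B i b y * C i b y)) = 0"
  proof (rule sum.neutral, rule ballI)
    fix i
    show "?d (\<lambda>y. \<Sum>b\<in>UNIV. A i b y * D i b y + B i b y * C i b y) = 0"
      using sder_cong[OF V y, of "\<lambda>y. \<Sum>b\<in>UNIV. A i b y * D i b y + B i b y * C i b y" "\<lambda>_. 1" Z] AD by simp
  qed
  then have AD': "(\<Sum>i\<in>UNIV. \<Sum>b\<in>UNIV. D i b y * ?d (A i b)) + (\<Sum>i\<in>UNIV. \<Sum>b\<in>UNIV. A i b y * ?d (D i b))
      + (\<Sum>i\<in>UNIV. \<Sum>b\<in>UNIV. ?d (B i b) * C i b y) + ?s *\<^sub>R (\<Sum>i\<in>UNIV. \<Sum>b\<in>UNIV. B i b y * ?d (C i b)) = 0"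
    unfolding sder_sum_mult[OF y smooths(1,4,2,3)] tA tB
    by (simp add: sum.distrib scaleR_sum_right commD[OF y, symmetric] add.assoc)
  have "(\<Sum>i\<in>UNIV. ?d (\<lambda>y. \<Sum>b\<in>UNIV. B i b y * C i b y)) = ?d (\<lambda>y. \<Sum>i\<in>UNIV. \<Sum>b\<in>UNIV. B i b y * C i b y)"
    by (rule sder_sum[OF V y, symmetric]) (intro smooth_sfun_sum smooth_sfun_mult smooths V)
  also have "\<dots> = 0"
    using sder_cong[OF V y, of "\<lambda>y. \<Sum>i\<in>UNIV. \<Sum>b\<in>UNIV. B i b y * C i b y" "\<lambda>_. 0" Z] trace_BC by simp
  also have "(\<Sum>i\<in>UNIV. ?d (\<lambda>y. \<Sum>b\<in>UNIV. B i b y * C i b y))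
      = (\<Sum>i\<in>UNIV. \<Sum>b\<in>UNIV. ?d (B i b) * C i b y) + ?s *\<^sub>R (\<Sum>i\<in>UNIV. \<Sum>b\<in>UNIV. B i b y * ?d (C i b))"
  proof -
    have "?d (\<lambda>y. \<Sum>b\<in>UNIV. B i b y * C i b y) = (\<Sum>b\<in>UNIV. ?d (B i b) * C i b y + ?s *\<^sub>R (B i b y * ?d (C i b)))" for i
    proof -
      have "?d (\<lambda>y. \<Sum>b\<in>UNIV. B i b y * C i b y) = (\<Sum>b\<in>UNIV. ?d (\<lambda>y. B i b y * C i b y))"
        by (rule sder_sum[OF V y]) (intro smooth_sfun_mult smooths V)
      then show ?thesis unfolding sder_mult[OF V y smooths(2,3)] tB by simp
    qed
    then show ?thesis by (simp add: sum.distrib scaleR_sum_right)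
  qed
  finally have BC': "(\<Sum>i\<in>UNIV. \<Sum>b\<in>UNIV. ?d (B i b) * C i b y) + ?s *\<^sub>R (\<Sum>i\<in>UNIV. \<Sum>b\<in>UNIV. B i b y * ?d (C i b)) = 0" .
  \<comment> \<open>Half of the derivative of \<open>CD\<close>: adding the transposed half gives
    the derivative of 0, so \<open>U\<close> is antisymmetric and its contraction with the symmetric
    \<Gamma> vanishes.\<close>
  define U where "U i j = (\<Sum>b\<in>UNIV. D i b y * ?d (C j b)) + ?s *\<^sub>R (\<Sum>b\<in>UNIV. C j b y * ?d (D i b))" for i j
  have U: "U i j = - U j i" for i j
  proof -
    have pD: "has_parity (cpar Z) (?d (D i b))" for i b
      using has_parity_sder[OF V y, of 0 "D i b" Z] parities(4) by simp
    have dDC: "?d (D i b) * C j b' y = ?s *\<^sub>R (C j b' y * ?d (D i b))" for i b j b'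
      using supercommute[OF pD parities(3)[OF y]] by simp
    have "0 = ?d (\<lambda>y. \<Sum>b\<in>UNIV. C j b y * D i b y + D j b y * C i b y)"
      using sder_cong[OF V y, of "\<lambda>y. \<Sum>b\<in>UNIV. C j b y * D i b y + D j b y * C i b y" "\<lambda>_. 0" Z] CD by simp
    also have "\<dots> = U i j + U j i"
      unfolding sder_sum_mult[OF y smooths(3,4,4,3)] tC tD dDC U_def
      by (simp add: sum.distrib scaleR_sum_right commD[OF y, symmetric])
    finally show ?thesis by (simp add: eq_neg_iff_add_eq_0)
  qed
  have "0 = (\<Sum>i\<in>UNIV. \<Sum>j\<in>UNIV. \<Gamma> i j y * U i j)"
    by (rule sum_sym_antisym[symmetric]) (rule \<Gamma>_sym[OF y], rule U)
  also have "\<dots> = (\<Sum>i\<in>UNIV. \<Sum>j\<in>UNIV. \<Sum>b\<in>UNIV. \<Gamma> i j y * D i b y * ?d (C j b))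
      + ?s *\<^sub>R (\<Sum>i\<in>UNIV. \<Sum>j\<in>UNIV. \<Sum>b\<in>UNIV. \<Gamma> i j y * C j b y * ?d (D i b))"
    unfolding U_def by (simp add: distrib_left sum.distrib scaleR_sum_right sum_distrib_left mult.assoc)
  also have "(\<Sum>i\<in>UNIV. \<Sum>j\<in>UNIV. \<Sum>b\<in>UNIV. \<Gamma> i j y * D i b y * ?d (C j b)) = (\<Sum>j\<in>UNIV. \<Sum>b\<in>UNIV. B j b y * ?d (C j b))"
    unfolding \<Gamma>_D[OF y, symmetric] sum_distrib_right by (rule sum_rotate3)
  also have "(\<Sum>i\<in>UNIV. \<Sum>j\<in>UNIV. \<Sum>b\<in>UNIV. \<Gamma> i j y * C j b y * ?d (D i b))
      = (\<Sum>i\<in>UNIV. \<Sum>b\<in>UNIV. (\<Sum>j\<in>UNIV. \<Gamma> j i y * C j b y) * ?d (D i b))"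
  proof -
    have "(\<Sum>i\<in>UNIV. \<Sum>j\<in>UNIV. \<Sum>b\<in>UNIV. \<Gamma> i j y * C j b y * ?d (D i b))
        = (\<Sum>i\<in>UNIV. \<Sum>b\<in>UNIV. \<Sum>j\<in>UNIV. \<Gamma> i j y * C j b y * ?d (D i b))"
      by (intro sum.cong refl sum.swap)
    also have "\<dots> = (\<Sum>i\<in>UNIV. \<Sum>b\<in>UNIV. \<Sum>j\<in>UNIV. \<Gamma> j i y * C j b y * ?d (D i b))"
      by (intro sum.cong refl) (rule arg_cong[OF \<Gamma>_sym[OF y], of "\<lambda>x. x * C _ _ y * ?d (D _ _)"])
    finally show ?thesis unfolding sum_distrib_right .
  qed
  finally have \<Gamma>U: "(\<Sum>j\<in>UNIV. \<Sum>b\<in>UNIV. B j b y * ?d (C j b))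
      + ?s *\<^sub>R (\<Sum>i\<in>UNIV. \<Sum>b\<in>UNIV. (\<Sum>j\<in>UNIV. \<Gamma> j i y * C j b y) * ?d (D i b)) = 0" ..
  have ss: "?s * ?s = 1" by (simp flip: power_mult_distrib)
  have "?s *\<^sub>R (\<Sum>j\<in>UNIV. \<Sum>b\<in>UNIV. B j b y * ?d (C j b))
      + (\<Sum>i\<in>UNIV. \<Sum>b\<in>UNIV. (\<Sum>j\<in>UNIV. \<Gamma> j i y * C j b y) * ?d (D i b)) = 0"
    using arg_cong[OF \<Gamma>U, of "\<lambda>x. ?s *\<^sub>R x"] by (simp add: scaleR_add_right ss)
  moreover have "(\<Sum>i\<in>UNIV. \<Sum>b\<in>UNIV. A i b y * ?d (D i b)) = (\<Sum>i\<in>UNIV. \<Sum>b\<in>UNIV. Y b i y * ?d (D i b))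
      + (\<Sum>i\<in>UNIV. \<Sum>b\<in>UNIV. (\<Sum>j\<in>UNIV. \<Gamma> j i y * C j b y) * ?d (D i b))"
    unfolding A_Y[OF y] distrib_right sum.distrib ..
  \<comment> \<open>Here \<open>p\<close>, \<open>q\<close>, \<open>t + w\<close>, \<open>v\<close>
    are the traces of D dA, B dC, A dD and dB C, with their signs; \<open>A_Y\<close> splits the
    third into a part \<open>t\<close> with \<open>Y\<close> and a part \<open>w\<close> with
    \<Gamma> C.\<close>
  moreover have "p - q = - t" if "p + (t + w) + v + q = 0" "v + q = 0" "q + w = 0" for p q t v w :: "('n, 'l) gen grass"
  proof -
    have "p - q = (p + (t + w) + v + q) - t - (q + w) - (v + q)"
      by (simp add: algebra_simps)
    then show ?thesis unfolding that by simp
  qed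
  ultimately show ?thesis unfolding L using AD' BC' by simp
qed

text \<open>The product of det D and \<open>r\<close> is constant. Jacobi's formula gives the
  derivative of det D, in which \<open>L_trace\<close> recognises \<open>L\<close>.\<close>

lemma sder_r:
  assumes y: "y \<in> V"
  shows "sder Z r y = r y * L Z y"
proof -
  let ?g = "\<lambda>y. gdet (\<lambda>i b. D i b y)"
  have sm: "smooth_sfun V ?g" by (rule smooth_gdet[OF V smooths(4)])
  have "?g y * Y b i y = gcofactor (\<lambda>i b. D i b y) i b" for i b
    unfolding Y_def using r_inverse(2)[OF y] by (simp flip: mult.assoc)
  then have "sder Z ?g y = ?g y * (\<Sum>i\<in>UNIV. \<Sum>b\<in>UNIV. Y b i y * sder Z (D i b) y)"
    unfolding sder_gdet[OF V y smooths(4) parities(4)[OF y]] sum_distrib_left by (simp flip: mult.assoc)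
  then have dg: "sder Z ?g y = - (?g y * L Z y)"
    unfolding L_trace[OF y] by simp
  have "sder Z (\<lambda>y. ?g y * r y) y = 0"
    using sder_cong[OF V y, of "\<lambda>y. ?g y * r y" "\<lambda>_. 1" Z] r_inverse(2) by simp
  then have "sder Z ?g y * r y + ?g y * sder Z r y = 0"
    unfolding sder_mult[OF V y sm smooth_r] twist_even[OF even_gdet[OF parities(4)[OF y]]] .
  then have "?g y * sder Z r y = ?g y * (L Z y * r y)"
    unfolding dg by (simp add: mult.assoc)
  then have "r y * (?g y * sder Z r y) = r y * (?g y * (L Z y * r y))" by simp
  then have "sder Z r y = L Z y * r y"
    by (simp add: r_inverse(3)[OF y] flip: mult.assoc)
  then show ?thesis using even_commute[OF r_inverse(1)[OF y]] by simp
qed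

text \<open>Second derivatives of \<open>r\<close> supercommute. The terms quadratic in
  \<open>L\<close> supercommute as well and cancel, as does the invertible factor
  \<open>r\<close>.\<close>

lemma L_closed:
  assumes y: "y \<in> V"
  shows "sder Z (L W) y = (- 1) ^ (cpar Z * cpar W) *\<^sub>R sder W (L Z) y"
proof -
  let ?c = "(- 1::real) ^ (cpar Z * cpar W)"
  have dd: "sder Z (sder W r) y = r y * (L Z y * L W y + sder Z (L W) y)" for Z W
  proof -
    have "sder Z (sder W r) y = sder Z (\<lambda>y. r y * L W y) y"
      by (rule sder_cong[OF V y sder_r])
    then show ?thesis
      unfolding sder_mult[OF V y smooth_r smooth_L] sder_r[OF y] twist_even[OF r_inverse(1)[OF y]]
      by (simp add: distrib_left mult.assoc)
  qed
  have "r y * (L Z y * L W y + sder Z (L W) y) = r y * (?c *\<^sub>R (L W y * L Z y + sder W (L Z) y))"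
    using sder_commute[OF V y smooth_r, of Z W] unfolding dd by simp
  then have "gdet (\<lambda>i b. D i b y) * (r y * (L Z y * L W y + sder Z (L W) y))
      = gdet (\<lambda>i b. D i b y) * (r y * (?c *\<^sub>R (L W y * L Z y + sder W (L Z) y)))" by simp
  then have "L Z y * L W y + sder Z (L W) y = ?c *\<^sub>R (L W y * L Z y) + ?c *\<^sub>R sder W (L Z) y"
    by (simp only: r_inverse(2)[OF y] scaleR_add_right mult_1_left flip: mult.assoc)
  then show ?thesis using supercommute[OF parity_L[OF y] parity_L[OF y], of Z W] by simp
qed

lemma laplace_r:
  assumes y: "y \<in> V"
  shows "(\<Sum>i\<in>UNIV. L (Inl i) y * L (Inr i) y + sder (Inl i) (L (Inr i)) y) = 0"
proof (rule laplace_log_volume[OF y])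
  fix i j
  show "sder (Inl i) (L (Inl j)) y = sder (Inl j) (L (Inl i)) y"
    "sder (Inr i) (L (Inr j)) y = - sder (Inr j) (L (Inr i)) y"
    "sder (Inr i) (L (Inl j)) y = sder (Inl j) (L (Inr i)) y"
    using L_closed[OF y, of "Inl i" "Inl j"] L_closed[OF y, of "Inr i" "Inr j"] L_closed[OF y, of "Inr i" "Inl j"]
    by simp_all
qed

section \<open>The odd Laplacian under a canonical transformation\<close>

text \<open>The second-order chain rule. Its quadratic part contracts the second derivatives of
  \<open>F\<close> with \<open>N\<close>: for two even or two odd coordinates the symmetries are
  opposite and the sum vanishes; the two mixed parts add up to a Kronecker delta by
  \<open>inverse\<close>.\<close>

lemma Delta_seval:
  assumes y: "y \<in> V" and \<phi>: "is_smap V U \<phi>" and U: "open U" and F: "smooth_sfun U F"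
  shows "Delta (\<lambda>u. seval F (at_pt \<phi> u)) y
    = (\<Sum>E\<in>UNIV. Delta (\<phi> E) y * seval (sder E F) (at_pt \<phi> y)) + seval (Delta F) (at_pt \<phi> y)"
proof -
  let ?f = "\<lambda>E y. seval (sder E F) (at_pt \<phi> y)" and ?h = "\<lambda>E G. seval (sder E (sder G F)) (at_pt \<phi> y)"
  have sF: "smooth_sfun U (sder E F)" for E by (rule smooth_sfun_sder[OF U F])
  have sf: "smooth_sfun V (?f E)" for E by (rule smooth_seval[OF V \<phi> sF])
  have sJ: "smooth_sfun V (sder Z (\<phi> E))" for Z E by (rule smooth_sfun_sder[OF V smooth])
  have X: "superpoint (at_pt \<phi> y)" "pt_body (at_pt \<phi> y) \<in> U"
    using is_smap_superpoint[OF \<phi> y] is_smap_body[OF \<phi> y] .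
  have hc: "?h E G = (- 1) ^ (cpar E * cpar G) *\<^sub>R ?h G E" for E G
  proof -
    have "?h E G = seval (\<lambda>x. (- 1) ^ (cpar E * cpar G) *\<^sub>R sder G (sder E F) x) (at_pt \<phi> y)"
      by (rule seval_cong[OF U X(2)]) (rule sder_commute[OF U _ F])
    then show ?thesis by (simp add: seval_scaleR[OF X(1) U X(2) smooth_sfun_sder[OF U sF]])
  qed
  have 1: "sder (Inl i) (sder (Inr i) (\<lambda>u. seval F (at_pt \<phi> u))) y
      = (\<Sum>E\<in>UNIV. sder (Inl i) (sder (Inr i) (\<phi> E)) y * ?f E y)
        + (\<Sum>E\<in>UNIV. \<Sum>G\<in>UNIV. sder (Inr i) (\<phi> E) y * sder (Inl i) (\<phi> G) y * ?h G E)" for i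
  proof -
    have "sder (Inl i) (sder (Inr i) (\<lambda>u. seval F (at_pt \<phi> u))) y
        = sder (Inl i) (\<lambda>y. \<Sum>E\<in>UNIV. sder (Inr i) (\<phi> E) y * ?f E y) y"
      by (rule sder_cong[OF V y]) (rule sder_seval[OF V _ \<phi> U F])
    also have "\<dots> = (\<Sum>E\<in>UNIV. sder (Inl i) (\<lambda>y. sder (Inr i) (\<phi> E) y * ?f E y) y)"
      by (rule sder_sum[OF V y]) (intro smooth_sfun_mult V sJ sf)
    also have "\<dots> = (\<Sum>E\<in>UNIV. sder (Inl i) (sder (Inr i) (\<phi> E)) y * ?f E y
        + sder (Inr i) (\<phi> E) y * (\<Sum>G\<in>UNIV. sder (Inl i) (\<phi> G) y * ?h G E))"
      unfolding sder_mult[OF V y sJ sf] sder_seval[OF V y \<phi> U sF] by (simp add: twist_0)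
    finally show ?thesis by (simp add: sum.distrib sum_distrib_left mult.assoc)
  qed
  define N where "N E G = (\<Sum>i\<in>UNIV. sder (Inr i) (\<phi> E) y * sder (Inl i) (\<phi> G) y)" for E G
  have N: "N (Inl b) (Inl a) = (\<Sum>i\<in>UNIV. C i b y * A i a y)" "N (Inl b) (Inr a) = (\<Sum>i\<in>UNIV. C i b y * B i a y)"
    "N (Inr b) (Inl a) = (\<Sum>i\<in>UNIV. D i b y * A i a y)" "N (Inr b) (Inr a) = (\<Sum>i\<in>UNIV. D i b y * B i a y)" for a b
    by (simp_all add: N_def jacobian_blocks)
  have "(\<Sum>i\<in>UNIV. \<Sum>E\<in>UNIV. \<Sum>G\<in>UNIV. sder (Inr i) (\<phi> E) y * sder (Inl i) (\<phi> G) y * ?h G E)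
      = (\<Sum>E\<in>UNIV. \<Sum>G\<in>UNIV. N E G * ?h G E)"
    unfolding N_def sum_distrib_right by (rule sum_rotate3)
  also have "\<dots> = (\<Sum>b\<in>UNIV. \<Sum>a\<in>UNIV. N (Inl b) (Inl a) * ?h (Inl a) (Inl b)) + (\<Sum>b\<in>UNIV. \<Sum>a\<in>UNIV. N (Inl b) (Inr a) * ?h (Inr a) (Inl b))
      + ((\<Sum>b\<in>UNIV. \<Sum>a\<in>UNIV. N (Inr b) (Inl a) * ?h (Inl a) (Inr b)) + (\<Sum>b\<in>UNIV. \<Sum>a\<in>UNIV. N (Inr b) (Inr a) * ?h (Inr a) (Inr b)))"
    by (simp add: sum_UNIV_sum sum.distrib)
  also have "(\<Sum>b\<in>UNIV. \<Sum>a\<in>UNIV. N (Inl b) (Inl a) * ?h (Inl a) (Inl b)) = 0"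
  proof (rule sum_antisym_sym)
    fix k l
    show "N (Inl k) (Inl l) = - N (Inl l) (Inl k)"
      unfolding N using inverse(3)[OF y, of k l] by (simp add: sum.distrib commA[OF y] eq_neg_iff_add_eq_0)
    show "?h (Inl l) (Inl k) = ?h (Inl k) (Inl l)" using hc[of "Inl l" "Inl k"] by simp
  qed
  also have "(\<Sum>b\<in>UNIV. \<Sum>a\<in>UNIV. N (Inr b) (Inr a) * ?h (Inr a) (Inr b)) = 0"
  proof (rule sum_sym_antisym)
    fix k l
    show "N (Inr k) (Inr l) = N (Inr l) (Inr k)"
      unfolding N using inverse(2)[OF y, of k l] by (simp add: sum_subtractf commD[OF y])
    show "?h (Inr l) (Inr k) = - ?h (Inr k) (Inr l)" using hc[of "Inr l" "Inr k"] by simp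
  qed
  also have "(\<Sum>b\<in>UNIV. \<Sum>a\<in>UNIV. N (Inl b) (Inr a) * ?h (Inr a) (Inl b)) = (\<Sum>b\<in>UNIV. \<Sum>a\<in>UNIV. N (Inl b) (Inr a) * ?h (Inl b) (Inr a))"
    using hc[of "Inr _" "Inl _"] by (intro sum.cong refl) simp
  also have "(\<Sum>b\<in>UNIV. \<Sum>a\<in>UNIV. N (Inr b) (Inl a) * ?h (Inl a) (Inr b)) = (\<Sum>b\<in>UNIV. \<Sum>a\<in>UNIV. N (Inr a) (Inl b) * ?h (Inl b) (Inr a))"
    by (rule sum.swap)
  also have "0 + (\<Sum>b\<in>UNIV. \<Sum>a\<in>UNIV. N (Inl b) (Inr a) * ?h (Inl b) (Inr a)) + ((\<Sum>b\<in>UNIV. \<Sum>a\<in>UNIV. N (Inr a) (Inl b) * ?h (Inl b) (Inr a)) + 0)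
      = (\<Sum>b\<in>UNIV. \<Sum>a\<in>UNIV. (N (Inl b) (Inr a) + N (Inr a) (Inl b)) * ?h (Inl b) (Inr a))"
    by (simp add: distrib_right sum.distrib)
  also have "\<dots> = (\<Sum>b\<in>UNIV. \<Sum>a\<in>UNIV. (if b = a then 1 else 0) * ?h (Inl b) (Inr a))"
  proof -
    have "N (Inl b) (Inr a) + N (Inr a) (Inl b) = (if b = a then 1 else 0)" for a b
      unfolding N inverse(4)[OF y, symmetric] by (simp add: sum.distrib commA[OF y])
    then show ?thesis by simp
  qed
  also have "\<dots> = (\<Sum>b\<in>UNIV. ?h (Inl b) (Inr b))"
    by (simp add: if_distrib[of "\<lambda>x. x * _"] cong: if_cong)
  also have "\<dots> = seval (Delta F) (at_pt \<phi> y)"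
    unfolding Delta_def by (rule seval_sum[OF X(1) U X(2), symmetric]) (rule smooth_sfun_sder[OF U sF])
  finally have 2: "(\<Sum>i\<in>UNIV. \<Sum>E\<in>UNIV. \<Sum>G\<in>UNIV. sder (Inr i) (\<phi> E) y * sder (Inl i) (\<phi> G) y * ?h G E)
      = seval (Delta F) (at_pt \<phi> y)" .
  have "(\<Sum>i\<in>UNIV. \<Sum>E\<in>UNIV. sder (Inl i) (sder (Inr i) (\<phi> E)) y * ?f E y) = (\<Sum>E\<in>UNIV. Delta (\<phi> E) y * ?f E y)"
    unfolding Delta_def sum_distrib_right by (rule sum.swap)
  then show ?thesis
    unfolding Delta_def[of "\<lambda>u. seval F (at_pt \<phi> u)"] 1 sum.distrib 2 by simp
qed

text \<open>With the factor \<open>r\<close> taken out, the zeroth-order terms vanish by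
  \<open>laplace_r\<close>, the first-order terms cancel those of \<open>Delta_seval\<close> by
  \<open>divergence\<close>, and only the second-order part survives.\<close>

theorem Delta_r_seval:
  assumes y: "y \<in> V" and \<phi>: "is_smap V U \<phi>" and U: "open U" and F: "smooth_sfun U F"
  shows "Delta (\<lambda>u. r u * seval F (at_pt \<phi> u)) y = r y * seval (Delta F) (at_pt \<phi> y)"
proof -
  let ?f = "\<lambda>u. seval F (at_pt \<phi> u)" and ?fE = "\<lambda>E. seval (sder E F) (at_pt \<phi> y)"
  have sf: "smooth_sfun V ?f" by (rule smooth_seval[OF V \<phi> F])
  have sd: "smooth_sfun V (sder E ?f)" for E by (rule smooth_sfun_sder[OF V sf])
  have tr: "twist p (r y) = r y" if "y \<in> V" for p y by (rule twist_even[OF r_inverse(1)[OF that]])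
  have summand: "sder (Inl i) (sder (Inr i) (\<lambda>u. r u * ?f u)) y
    = r y * ((L (Inl i) y * L (Inr i) y + sder (Inl i) (L (Inr i)) y) * ?f y
       + (L (Inr i) y * sder (Inl i) ?f y + L (Inl i) y * sder (Inr i) ?f y) + sder (Inl i) (sder (Inr i) ?f) y)" for i
  proof -
    have sg: "smooth_sfun V (\<lambda>u. L (Inr i) u * ?f u)" by (rule smooth_sfun_mult[OF V smooth_L sf])
    have "sder (Inr i) (\<lambda>u. r u * ?f u) u = r u * (L (Inr i) u * ?f u + sder (Inr i) ?f u)" if u: "u \<in> V" for u
      unfolding sder_mult[OF V u smooth_r sf] sder_r[OF u] tr[OF u] by (simp add: distrib_left mult.assoc)
    then have "sder (Inl i) (sder (Inr i) (\<lambda>u. r u * ?f u)) y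
        = sder (Inl i) (\<lambda>u. r u * (L (Inr i) u * ?f u + sder (Inr i) ?f u)) y"
      by (rule sder_cong[OF V y])
    also have "\<dots> = r y * L (Inl i) y * (L (Inr i) y * ?f y + sder (Inr i) ?f y)
        + r y * (sder (Inl i) (L (Inr i)) y * ?f y + L (Inr i) y * sder (Inl i) ?f y + sder (Inl i) (sder (Inr i) ?f) y)"
      unfolding sder_mult[OF V y smooth_r smooth_sfun_add[OF V sg sd]] sder_add[OF y sg sd]
        sder_mult[OF V y smooth_L sf] sder_r[OF y] tr[OF y] by (simp add: twist_0)
    finally show ?thesis by (simp add: algebra_simps)
  qed
  have "(\<Sum>i\<in>UNIV. L (Inr i) y * sder (Inl i) ?f y + L (Inl i) y * sder (Inr i) ?f y)
      = (\<Sum>i\<in>UNIV. \<Sum>E\<in>UNIV. (L (Inr i) y * sder (Inl i) (\<phi> E) y + L (Inl i) y * sder (Inr i) (\<phi> E) y) * ?fE E)"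
    unfolding sder_seval[OF V y \<phi> U F] sum_distrib_left sum.distrib[symmetric]
    by (simp only: distrib_right mult.assoc)
  also have "\<dots> = (\<Sum>E\<in>UNIV. (\<Sum>i\<in>UNIV. L (Inr i) y * sder (Inl i) (\<phi> E) y + L (Inl i) y * sder (Inr i) (\<phi> E) y) * ?fE E)"
    unfolding sum_distrib_right by (rule sum.swap)
  also have "\<dots> = - (\<Sum>E\<in>UNIV. Delta (\<phi> E) y * ?fE E)"
    unfolding divergence[OF y] by (simp add: sum_negf)
  finally have 1: "(\<Sum>i\<in>UNIV. L (Inr i) y * sder (Inl i) ?f y + L (Inl i) y * sder (Inr i) ?f y)
      = - (\<Sum>E\<in>UNIV. Delta (\<phi> E) y * ?fE E)" .
  have "Delta (\<lambda>u. r u * ?f u) y = r y * ((\<Sum>i\<in>UNIV. L (Inl i) y * L (Inr i) y + sder (Inl i) (L (Inr i)) y) * ?f y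
      + (\<Sum>i\<in>UNIV. L (Inr i) y * sder (Inl i) ?f y + L (Inl i) y * sder (Inr i) ?f y) + Delta ?f y)"
    unfolding Delta_def summand sum_distrib_left[symmetric] sum_distrib_right unfolding sum.distrib ..
  also have "\<dots> = r y * seval (Delta F) (at_pt \<phi> y)"
    unfolding laplace_r[OF y] 1 Delta_seval[OF y \<phi> U F] by simp
  finally show ?thesis .
qed

end

section \<open>Charts and overlaps\<close>

lemma chart_inverse:
  assumes "c \<in> charts W"
  shows "inverse_smaps (fst c) (chart_image c) (snd c) (chart_inv c)"
proof -
  have "\<exists>\<psi>. inverse_smaps (fst c) (chart_image c) (snd c) \<psi>"
    using assms unfolding charts_def by blast
  then show ?thesis unfolding chart_inv_def by (rule someI_ex)
qed

text \<open>Taking bodies turns substitution into composition of the underlying maps.\<close>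

lemma smap_body_inverse:
  fixes \<phi> \<psi> :: "('n::{finite,linorder}, 'l::linorder) smap"
  assumes "inverse_smaps V U \<phi> \<psi>"
  shows "x \<in> V \<Longrightarrow> smap_body \<psi> (smap_body \<phi> x) = x" and "y \<in> U \<Longrightarrow> smap_body \<phi> (smap_body \<psi> y) = y"
proof -
  have *: "smap_body g (smap_body f x) = x"
    if "is_smap V U f" "x \<in> V" "\<And>A. seval (g A) (at_pt f x) = coord A x"
    for f g :: "('n, 'l) smap" and x V U
  proof -
    have "body (g (Inl i) (smap_body f x)) = x $ i" for i
      using arg_cong[OF that(3)[of "Inl i"], of body] body_seval[OF is_smap_superpoint[OF that(1,2)], of "g (Inl i)"]
      by (simp add: smap_body_def)
    then show ?thesis unfolding smap_body_def[of g] pt_body_def at_pt_apply by (simp add: vec_eq_iff)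
  qed
  show "x \<in> V \<Longrightarrow> smap_body \<psi> (smap_body \<phi> x) = x" "y \<in> U \<Longrightarrow> smap_body \<phi> (smap_body \<psi> y) = y"
    using assms unfolding inverse_smaps_def by (blast intro: *)+
qed

lemma continuous_smap_body:
  assumes "is_smap V U \<phi>"
  shows "continuous_on V (smap_body \<phi>)"
proof -
  have "continuous_on V (\<lambda>y. body (\<phi> (Inl i) y))" for i
    using smooth_funD[OF smooth_fun_body[OF is_smap_smooth[OF assms]]]
    by (intro continuous_at_imp_continuous_on ballI differentiable_imp_continuous_within)
  then show ?thesis unfolding smap_body_def pt_body_def at_pt_apply by (rule continuous_on_vec_lambda)
qed

text \<open>Written as a preimage under a continuous map, the overlap is seen to be open.\<close>

lemma overlap_eq:
  assumes "c' \<in> charts W"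
  shows "overlap c c' = chart_image c' \<inter> smap_body (chart_inv c') -` fst c"
proof -
  note inv = chart_inverse[OF assms]
  have ran: "smap_body (chart_inv c') y \<in> fst c'" if "y \<in> chart_image c'" for y
    using inv that unfolding inverse_smaps_def is_smap_def by blast
  show ?thesis
  proof (intro equalityI subsetI)
    fix y assume "y \<in> overlap c c'"
    then obtain w where "w \<in> fst c" "w \<in> fst c'" "y = smap_body (snd c') w" unfolding overlap_def by blast
    then show "y \<in> chart_image c' \<inter> smap_body (chart_inv c') -` fst c"
      using smap_body_inverse(1)[OF inv] unfolding chart_image_def by auto
  next
    fix y assume y: "y \<in> chart_image c' \<inter> smap_body (chart_inv c') -` fst c"
    then have "y = smap_body (snd c') (smap_body (chart_inv c') y)"
      using smap_body_inverse(2)[OF inv] by simp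
    then show "y \<in> overlap c c'" unfolding overlap_def using y ran by blast
  qed
qed

lemma open_overlap:
  assumes "c \<in> charts W" "c' \<in> charts W"
  shows "open (overlap c c')"
  unfolding overlap_eq[OF assms(2)]
  using chart_inverse[OF assms(2)] assms continuous_smap_body unfolding inverse_smaps_def charts_def
  by (intro continuous_open_preimage) auto

lemma is_smap_subset:
  assumes "is_smap V U \<phi>" "V' \<subseteq> V" "\<And>y. y \<in> V' \<Longrightarrow> smap_body \<phi> y \<in> U'"
  shows "is_smap V' U' \<phi>"
  using assms smooth_sfun_subset[OF _ assms(2)] unfolding is_smap_def by blast

lemma is_smap_compose:
  fixes \<psi> z :: "('n::{finite,linorder}, 'l::linorder) smap"
  assumes "open V" "open U" "is_smap V U \<psi>" "is_smap U T z"
  shows "is_smap V T (\<lambda>A y. seval (z A) (at_pt \<psi> y))"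
proof -
  have "smap_body (\<lambda>A y. seval (z A) (at_pt \<psi> y)) y = smap_body z (smap_body \<psi> y)" if "y \<in> V" for y
    unfolding smap_body_def pt_body_def at_pt_apply body_seval[OF is_smap_superpoint[OF assms(3) that]] ..
  moreover have "smap_body z (smap_body \<psi> y) \<in> T" if "y \<in> V" for y
    using assms(3,4) that unfolding is_smap_def by blast
  ultimately have "smap_body (\<lambda>A y. seval (z A) (at_pt \<psi> y)) ` V \<subseteq> T"
    by auto
  moreover have "smooth_sfun V (\<lambda>y. seval (z A) (at_pt \<psi> y))" for A
    by (rule smooth_seval[OF assms(1,3) is_smap_smooth[OF assms(4)]])
  moreover have "has_parity (cpar A) (seval (z A) (at_pt \<psi> y))" if "y \<in> V" for A y
    by (rule has_parity_seval[OF is_smap_superpoint[OF assms(3) that] assms(2) is_smap_body[OF assms(3) that]])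
      (rule is_smap_parity[OF assms(4)])
  ultimately show ?thesis unfolding is_smap_def by blast
qed

section \<open>The symplectic form in Darboux coordinates\<close>

definition mmult :: "('k::finite \<Rightarrow> 'k \<Rightarrow> 'a::ring_1) \<Rightarrow> ('k \<Rightarrow> 'k \<Rightarrow> 'a) \<Rightarrow> 'k \<Rightarrow> 'k \<Rightarrow> 'a"
  where "mmult M N = (\<lambda>i j. \<Sum>k\<in>UNIV. M i k * N k j)"

lemma mmult_assoc: "mmult (mmult M N) P = mmult M (mmult N P)"
proof (intro ext)
  fix i j
  have "mmult (mmult M N) P i j = (\<Sum>k\<in>UNIV. \<Sum>l\<in>UNIV. M i l * (N l k * P k j))"
    unfolding mmult_def sum_distrib_right mult.assoc ..
  also have "\<dots> = mmult M (mmult N P) i j"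
    unfolding mmult_def sum_distrib_left by (rule sum.swap)
  finally show "mmult (mmult M N) P i j = mmult M (mmult N P) i j" .
qed

definition mone :: "'k::finite \<Rightarrow> 'k \<Rightarrow> 'a::ring_1"
  where "mone i j = (if i = j then 1 else 0)"

lemma mmult_mone [simp]: "mmult M mone = M" "mmult mone M = M"
  unfolding mmult_def mone_def
  by (simp_all add: if_distrib[of "(*) _"] if_distrib[of "\<lambda>x. x * _"] cong: if_cong)

lemma parity_part_eq:
  "has_parity q a \<Longrightarrow> parity_part p a = (if p mod 2 = q mod 2 then a else 0)"
  for a :: "'g::linorder grass"
  unfolding parity_part_def
  by (rule grass_eqI, subst coeff_Abs) (auto simp: coeff_infinite has_parity_def coeff_basic)

lemma gi_parity: "has_parity p a \<Longrightarrow> gi a = (- 1) ^ p *\<^sub>R a"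
  by (simp add: has_parity_iff)

context
  fixes \<Omega> :: "('n::{finite,linorder}, 'l::linorder) two_form"
    and W :: "(real ^ 'n::{finite,linorder}) set" and w :: "real ^ 'n::{finite,linorder}"
  assumes symp: "odd_symplectic W \<Omega>" and w: "w \<in> W"
begin

private definition "N = gmatrix_inv (\<lambda>A B. \<Omega> A B w)"

private lemma parity_Omega: "has_parity (cpar A + cpar B + 1) (\<Omega> A B w)"
  and sym_Omega: "\<Omega> A B w = - ((- 1) ^ (cpar A * cpar B) *\<^sub>R \<Omega> B A w)"
  using symp w unfolding odd_symplectic_def neg_one_power_mult by blast+

private lemma Omega_N: "(\<Sum>B\<in>UNIV. \<Omega> A B w * N B C) = (if A = C then 1 else 0)"
  and N_Omega: "(\<Sum>B\<in>UNIV. N A B * \<Omega> B C w) = (if A = C then 1 else 0)"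
proof -
  obtain M where M: "is_matrix_inverse (\<lambda>A B. \<Omega> A B w) M"
    using symp w unfolding odd_symplectic_def by blast
  then have "N = M" unfolding N_def by (rule gmatrix_inv_eq)
  with M show "(\<Sum>B\<in>UNIV. \<Omega> A B w * N B C) = (if A = C then 1 else 0)"
    "(\<Sum>B\<in>UNIV. N A B * \<Omega> B C w) = (if A = C then 1 else 0)"
    unfolding is_matrix_inverse_def by blast+
qed

private lemma N_eqI:
  assumes "\<And>A C. (\<Sum>B\<in>UNIV. \<Omega> A B w * N' B C) = (if A = C then 1 else 0)"
  shows "N = N'"
  unfolding N_def
  by (rule gmatrix_inv_eq) (use assms matrix_left_right_inverse_grass[OF assms] in \<open>simp add: is_matrix_inverse_def\<close>)

text \<open>Applying \<open>gi\<close> to \<open>N\<close> with the signs of the expected parity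
  gives another inverse of \<Omega>, and inverses are unique.\<close>

private lemma parity_N: "has_parity (cpar A + cpar B + 1) (N A B)"
proof -
  let ?N' = "\<lambda>A B. (- 1) ^ (cpar A + cpar B + 1) *\<^sub>R gi (N A B)"
  have "N = ?N'"
  proof (rule N_eqI)
    fix A C :: "'n + 'n"
    have "(\<Sum>B\<in>UNIV. \<Omega> A B w * ?N' B C) = (\<Sum>B\<in>UNIV. (- 1) ^ (cpar A + cpar C) *\<^sub>R (gi (\<Omega> A B w) * gi (N B C)))"
    proof (rule sum.cong[OF refl])
      fix B :: "'n + 'n"
      have "(- 1::real) ^ (cpar B + cpar C + 1) = (- 1) ^ (cpar A + cpar C) * (- 1) ^ (cpar A + cpar B + 1)"
        by (cases A; cases B; cases C) simp_all
      then show "\<Omega> A B w * ?N' B C = (- 1) ^ (cpar A + cpar C) *\<^sub>R (gi (\<Omega> A B w) * gi (N B C))"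
        unfolding gi_parity[OF parity_Omega] by simp
    qed
    also have "\<dots> = (- 1) ^ (cpar A + cpar C) *\<^sub>R gi (\<Sum>B\<in>UNIV. \<Omega> A B w * N B C)"
      by (simp add: scaleR_sum_right)
    also have "\<dots> = (if A = C then 1 else 0)"
      unfolding Omega_N by (simp flip: power_mult_distrib power_add mult_2)
    finally show "(\<Sum>B\<in>UNIV. \<Omega> A B w * ?N' B C) = (if A = C then 1 else 0)" .
  qed
  from fun_cong[OF fun_cong[OF this]] have "N A B = (- 1) ^ (cpar A + cpar B + 1) *\<^sub>R gi (N A B)" .
  then have "(- 1) ^ (cpar A + cpar B + 1) *\<^sub>R N A B = ((- 1) ^ (cpar A + cpar B + 1) * (- 1) ^ (cpar A + cpar B + 1)) *\<^sub>R gi (N A B)"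
    by (metis scaleR_scaleR)
  then show ?thesis unfolding has_parity_iff by (simp flip: power_mult_distrib)
qed

text \<open>The supertranspose of \<open>N\<close>, with suitable signs, is again an inverse because
  of the symmetry of \<Omega>.\<close>

private lemma sym_N: "N A B = - ((- 1) ^ ((cpar A + 1) * (cpar B + 1)) *\<^sub>R N B A)"
proof -
  let ?N' = "\<lambda>A B. - ((- 1) ^ ((cpar A + 1) * (cpar B + 1)) *\<^sub>R N B A)"
  have "(\<Sum>B\<in>UNIV. ?N' A B * \<Omega> B C w) = (if A = C then 1 else 0)" for A C
  proof -
    have "(\<Sum>B\<in>UNIV. ?N' A B * \<Omega> B C w) = (\<Sum>B\<in>UNIV. (- 1) ^ (cpar A * cpar C + cpar C) *\<^sub>R (\<Omega> C B w * N B A))"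
    proof (rule sum.cong[OF refl])
      fix B :: "'n + 'n"
      have "N B A * \<Omega> C B w = (- 1) ^ ((cpar B + cpar A + 1) * (cpar C + cpar B + 1)) *\<^sub>R (\<Omega> C B w * N B A)"
        by (rule supercommute[OF parity_N parity_Omega])
      moreover have "(- 1::real) ^ (cpar B * cpar C) * (- 1) ^ ((cpar A + 1) * (cpar B + 1))
          * (- 1) ^ ((cpar B + cpar A + 1) * (cpar C + cpar B + 1)) = (- 1) ^ (cpar A * cpar C + cpar C)"
        by (cases A; cases B; cases C) simp_all
      moreover have "?N' A B * \<Omega> B C w
          = ((- 1) ^ (cpar B * cpar C) * (- 1) ^ ((cpar A + 1) * (cpar B + 1))) *\<^sub>R (N B A * \<Omega> C B w)"
        unfolding sym_Omega[of B C] minus_mult_minus mult_scaleR_left mult_scaleR_right scaleR_scaleR ..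
      ultimately show "?N' A B * \<Omega> B C w = (- 1) ^ (cpar A * cpar C + cpar C) *\<^sub>R (\<Omega> C B w * N B A)"
        by (simp only: scaleR_scaleR)
    qed
    also have "\<dots> = (- 1) ^ (cpar A * cpar C + cpar C) *\<^sub>R (if C = A then 1 else 0)"
      unfolding Omega_N[symmetric] scaleR_sum_right ..
    also have "\<dots> = (if A = C then 1 else 0)"
      by (cases A) auto
    finally show ?thesis .
  qed
  from matrix_left_right_inverse_grass[OF this] have "N = ?N'" by (rule N_eqI)
  from fun_cong[OF fun_cong[OF this]] show ?thesis .
qed

text \<open>With \<open>X\<close> the Jacobian of the Darboux coordinates and \<open>K\<close> its
  inverse, the bracket relations read xh N X = \<epsilon>. As \<open>N\<close> is inverse to
  \<Omega>, they can be solved: xh = \<epsilon> K \<Omega>. Since \<epsilon> only permutes rows up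
  to sign, this determines K \<Omega>, and \<Omega> = X K \<Omega> is expressed by first derivatives
  of the coordinates alone.\<close>

lemma symplectic_form_in_darboux:
  fixes z \<psi> :: "('n, 'l) smap"
  assumes V: "open V" "w \<in> V" and z: "is_smap V U z" and U: "open U" and \<psi>: "is_smap U V \<psi>"
    and inv: "\<And>A x. x \<in> V \<Longrightarrow> seval (\<psi> A) (at_pt z x) = coord A x"
    and br: "\<And>i j. odd_bracket \<Omega> (z (Inl i)) (z (Inl j)) w = 0"
      "\<And>i j. odd_bracket \<Omega> (z (Inr i)) (z (Inr j)) w = 0"
      "\<And>i j. odd_bracket \<Omega> (z (Inl i)) (z (Inr j)) w = (if i = j then 1 else 0)"
  shows "\<Omega> C D w = (\<Sum>i\<in>UNIV. (- 1) ^ cpar D *\<^sub>R (sder C (z (Inr i)) w * sder D (z (Inl i)) w)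
    - sder C (z (Inl i)) w * sder D (z (Inr i)) w)"
proof -
  define X where "X A F = sder A (z F) w" for A F
  define xh where "xh F A = (- 1) ^ (cpar F * cpar A + cpar A) *\<^sub>R X A F" for F A
  define K where "K F A = seval (sder F (\<psi> A)) (at_pt z w)" for F A
  define O' where "O' A B = \<Omega> A B w" for A B
  define \<epsilon> :: "'n + 'n \<Rightarrow> 'n + 'n \<Rightarrow> ('n, 'l) gen grass"
    where "\<epsilon> E F = (case E of Inl i \<Rightarrow> (case F of Inl j \<Rightarrow> 0 | Inr j \<Rightarrow> if i = j then 1 else 0)
      | Inr i \<Rightarrow> (case F of Inl j \<Rightarrow> if i = j then - 1 else 0 | Inr j \<Rightarrow> 0))" for E F
  have pX: "has_parity (cpar F + cpar A) (X A F)" for A F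
    unfolding X_def by (rule has_parity_sder[OF V is_smap_parity[OF z]])
  \<comment> \<open>The chain rule for the composite of \<open>z\<close> with its inverse
    \<psi>.\<close>
  have XK: "mmult X K = mone"
  proof (intro ext)
    fix A B
    have "sder A (\<lambda>x. seval (\<psi> B) (at_pt z x)) w = sder A (coord B) w"
      by (rule sder_cong[OF V]) (rule inv)
    then show "mmult X K A B = mone A B"
      unfolding sder_seval[OF V z U is_smap_smooth[OF \<psi>]] sder_coord mmult_def mone_def X_def K_def .
  qed
  have NO: "mmult N O' = mone"
    unfolding mmult_def mone_def O'_def using N_Omega by (intro ext) simp
  have bracket: "odd_bracket \<Omega> (z E) (z F) w = mmult (mmult xh N) X E F" for E F
  proof -
    have d: "sder A (\<lambda>y. parity_part p (z E y)) w = (if p = cpar E then X A E else 0)" if "p \<in> {0, 1}" for A p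
    proof -
      have "sder A (\<lambda>y. parity_part p (z E y)) w = sder A (\<lambda>y. if p = cpar E then z E y else 0) w"
        by (rule sder_cong[OF V], subst parity_part_eq[OF is_smap_parity[OF z]], assumption)
          (use that in \<open>cases E; auto\<close>)
      then show ?thesis by (simp add: X_def)
    qed
    have sg: "a * (- 1) ^ k = (- 1::real) ^ k *\<^sub>R a" for a :: "('n, 'l) gen grass" and k
      by (cases "even k") simp_all
    have cE: "cpar E \<in> {0, 1}" by (cases E) auto
    have "odd_bracket \<Omega> (z E) (z F) w = (\<Sum>p\<in>{0, 1}. if p = cpar E then \<Sum>A\<in>UNIV. \<Sum>B\<in>UNIV. xh E A * N A B * X B F else 0)"
      unfolding odd_bracket_def N_def[symmetric]
    proof (rule sum.cong[OF refl])
      fix p :: nat assume p: "p \<in> {0, 1}"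
      show "(\<Sum>A\<in>UNIV. \<Sum>B\<in>UNIV. sder A (\<lambda>y. parity_part p (z E y)) w * (- 1) ^ (p * cpar A + cpar A) * N A B * sder B (z F) w)
          = (if p = cpar E then \<Sum>A\<in>UNIV. \<Sum>B\<in>UNIV. xh E A * N A B * X B F else 0)"
        unfolding d[OF p] by (simp add: xh_def X_def sg)
    qed
    also have "\<dots> = (\<Sum>A\<in>UNIV. \<Sum>B\<in>UNIV. xh E A * N A B * X B F)"
      using cE by auto
    also have "\<dots> = (\<Sum>B\<in>UNIV. \<Sum>A\<in>UNIV. xh E A * N A B * X B F)" by (rule sum.swap)
    also have "\<dots> = mmult (mmult xh N) X E F" unfolding mmult_def sum_distrib_right ..
    finally show ?thesis .
  qed
  \<comment> \<open>The hypotheses prescribe the brackets of even with odd coordinates in one order;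
    the opposite order follows from the symmetry of \<open>N\<close>.\<close>
  have br': "mmult (mmult xh N) X (Inr j) (Inl i) = - mmult (mmult xh N) X (Inl i) (Inr j)" for i j
  proof -
    have m: "mmult (mmult xh N) X E F = (\<Sum>B\<in>UNIV. \<Sum>A\<in>UNIV. xh E A * N A B * X B F)" for E F
      unfolding mmult_def sum_distrib_right ..
    have "xh (Inr j) A * N A B * X B (Inl i) = - (xh (Inl i) B * N B A * X A (Inr j))" for A B
    proof -
      define p q n where "p = 1 + cpar A" and "q = cpar B" and "n = cpar B + cpar A + 1"
      have pp: "has_parity p (X A (Inr j))" "has_parity q (X B (Inl i))" "has_parity n (N B A)"
        using pX[of "Inr j" A] pX[of "Inl i" B] parity_N[of B A] by (simp_all add: p_def q_def n_def)
      have "X A (Inr j) * N B A * X B (Inl i) = (- 1) ^ (p * n) *\<^sub>R (N B A * (X A (Inr j) * X B (Inl i)))"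
        unfolding supercommute[OF pp(1,3)] by (simp add: mult.assoc)
      also have "\<dots> = ((- 1) ^ (p * n) * (- 1) ^ (p * q)) *\<^sub>R (N B A * X B (Inl i) * X A (Inr j))"
        unfolding supercommute[OF pp(1,2)] by (simp add: mult.assoc)
      also have "\<dots> = ((- 1) ^ (p * n) * (- 1) ^ (p * q) * (- 1) ^ (n * q)) *\<^sub>R (X B (Inl i) * N B A * X A (Inr j))"
        unfolding supercommute[OF pp(3,2)] by (simp add: mult.assoc)
      finally have rev: "X A (Inr j) * N B A * X B (Inl i)
        = ((- 1) ^ (p * n) * (- 1) ^ (p * q) * (- 1) ^ (n * q)) *\<^sub>R (X B (Inl i) * N B A * X A (Inr j))" .
      have "xh (Inr j) A * N A B * X B (Inl i)
          = - ((- 1) ^ ((cpar A + 1) * (cpar B + 1)) *\<^sub>R (X A (Inr j) * N B A * X B (Inl i)))"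
        unfolding xh_def sym_N[of A B] by (simp flip: mult_2)
      also have "\<dots> = - (((- 1) ^ ((cpar A + 1) * (cpar B + 1)) * ((- 1) ^ (p * n) * (- 1) ^ (p * q) * (- 1) ^ (n * q)))
          *\<^sub>R (X B (Inl i) * N B A * X A (Inr j)))"
        unfolding rev by simp
      also have "(- 1::real) ^ ((cpar A + 1) * (cpar B + 1)) * ((- 1) ^ (p * n) * (- 1) ^ (p * q) * (- 1) ^ (n * q)) = (- 1) ^ cpar B"
        unfolding p_def q_def n_def by (cases A; cases B) simp_all
      finally show ?thesis unfolding xh_def by simp
    qed
    then have "mmult (mmult xh N) X (Inr j) (Inl i) = (\<Sum>B\<in>UNIV. \<Sum>A\<in>UNIV. - (xh (Inl i) B * N B A * X A (Inr j)))"
      unfolding m by simp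
    also have "\<dots> = - mmult (mmult xh N) X (Inl i) (Inr j)"
      unfolding m by (subst sum.swap) (simp add: sum_negf)
    finally show ?thesis .
  qed
  have "mmult (mmult xh N) X = \<epsilon>"
  proof (intro ext)
    fix E F
    show "mmult (mmult xh N) X E F = \<epsilon> E F"
      using br[unfolded bracket] br' by (cases E; cases F) (auto simp: \<epsilon>_def)
  qed
  then have "mmult (mmult (mmult xh N) X) (mmult K O') = mmult \<epsilon> (mmult K O')" by simp
  moreover have "mmult (mmult (mmult xh N) X) (mmult K O') = mmult xh (mmult N (mmult (mmult X K) O'))"
    by (simp only: mmult_assoc)
  ultimately have xh: "xh = mmult \<epsilon> (mmult K O')"
    unfolding XK by (simp add: NO)
  have e: "mmult \<epsilon> M (Inl i) D = M (Inr i) D" "mmult \<epsilon> M (Inr i) D = - M (Inl i) D" for M i D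
    unfolding mmult_def sum_UNIV_sum
    by (simp_all add: \<epsilon>_def if_distrib[of "\<lambda>x. x * _"] cong: if_cong)
  have "\<Omega> C D w = mmult X (mmult K O') C D"
    unfolding mmult_assoc[symmetric] XK by (simp add: O'_def)
  also have "\<dots> = (\<Sum>i\<in>UNIV. X C (Inl i) * mmult K O' (Inl i) D) + (\<Sum>i\<in>UNIV. X C (Inr i) * mmult K O' (Inr i) D)"
    by (subst (1) mmult_def) (rule sum_UNIV_sum)
  also have "\<dots> = (\<Sum>i\<in>UNIV. X C (Inl i) * - xh (Inr i) D) + (\<Sum>i\<in>UNIV. X C (Inr i) * xh (Inl i) D)"
    unfolding xh e by simp
  also have "\<dots> = (\<Sum>i\<in>UNIV. (- 1) ^ cpar D *\<^sub>R (X C (Inr i) * X D (Inl i)) - X C (Inl i) * X D (Inr i))"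
    unfolding xh_def by (simp add: sum_subtractf sum_negf flip: mult_2)
  finally show ?thesis unfolding X_def .
qed

end

section \<open>Transition maps between Darboux charts are canonical\<close>

text \<open>To be used twice with the same \<psi>, the inverse of the second chart: with the first
  chart for \<open>z\<close> the composite is the transition map, with the second chart it is the
  identity. The sign on the right factor is that of the supertransposed Jacobian.\<close>

lemma pullback_form:
  fixes z \<psi> :: "('n::{finite,linorder}, 'l::linorder) smap"
  assumes V: "open V" "y \<in> V" and \<psi>: "is_smap V U \<psi>" and U: "open U" and z: "is_smap U T z"
  shows "(\<Sum>C\<in>UNIV. \<Sum>D\<in>UNIV. sder A (\<psi> C) y
      * seval (\<lambda>w. \<Sum>i\<in>UNIV. (- 1) ^ cpar D *\<^sub>R (sder C (z (Inr i)) w * sder D (z (Inl i)) w)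
          - sder C (z (Inl i)) w * sder D (z (Inr i)) w) (at_pt \<psi> y)
      * ((- 1) ^ (cpar B * cpar D) *\<^sub>R sder B (\<psi> D) y))
    = (\<Sum>i\<in>UNIV. sder A (\<lambda>y. seval (z (Inr i)) (at_pt \<psi> y)) y * sder B (\<lambda>y. seval (z (Inl i)) (at_pt \<psi> y)) y
      - (- 1) ^ cpar B *\<^sub>R (sder A (\<lambda>y. seval (z (Inl i)) (at_pt \<psi> y)) y * sder B (\<lambda>y. seval (z (Inr i)) (at_pt \<psi> y)) y))"
proof -
  let ?X = "at_pt \<psi> y"
  define P where "P E C = sder E (\<psi> C) y" for E C
  define Z where "Z C F = seval (sder C (z F)) ?X" for C F
  have X: "superpoint ?X" "pt_body ?X \<in> U" using is_smap_superpoint[OF \<psi> V(2)] is_smap_body[OF \<psi> V(2)] .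
  have sz: "smooth_sfun U (sder C (z F))" for C F by (intro smooth_sfun_sder U is_smap_smooth[OF z])
  have pP: "has_parity (cpar C + cpar E) (P E C)" for E C
    unfolding P_def by (rule has_parity_sder[OF V is_smap_parity[OF \<psi>]])
  have pZ: "has_parity (cpar F + cpar C) (Z C F)" for C F
    unfolding Z_def by (rule has_parity_seval[OF X(1) U X(2)]) (rule has_parity_sder[OF U _ is_smap_parity[OF z]])
  have ch: "sder E (\<lambda>y. seval (z F) (at_pt \<psi> y)) y = (\<Sum>C\<in>UNIV. P E C * Z C F)" for E F
    unfolding P_def Z_def by (rule sder_seval[OF V \<psi> U is_smap_smooth[OF z]])
  have sv: "seval (\<lambda>w. \<Sum>i\<in>UNIV. (- 1) ^ cpar D *\<^sub>R (sder C (z (Inr i)) w * sder D (z (Inl i)) w)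
          - sder C (z (Inl i)) w * sder D (z (Inr i)) w) ?X
      = (\<Sum>i\<in>UNIV. (- 1) ^ cpar D *\<^sub>R (Z C (Inr i) * Z D (Inl i)) + (- 1) *\<^sub>R (Z C (Inl i) * Z D (Inr i)))" for C D
  proof -
    have sm: "smooth_sfun U (\<lambda>w. (- 1) ^ cpar D *\<^sub>R (sder C (z (Inr i)) w * sder D (z (Inl i)) w))"
      "smooth_sfun U (\<lambda>w. (- 1) *\<^sub>R (sder C (z (Inl i)) w * sder D (z (Inr i)) w))" for i
      by (intro smooth_sfun_scaleR smooth_sfun_mult U sz)+
    have "seval (\<lambda>w. \<Sum>i\<in>UNIV. (- 1) ^ cpar D *\<^sub>R (sder C (z (Inr i)) w * sder D (z (Inl i)) w)
          - sder C (z (Inl i)) w * sder D (z (Inr i)) w) ?X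
        = seval (\<lambda>w. \<Sum>i\<in>UNIV. (- 1) ^ cpar D *\<^sub>R (sder C (z (Inr i)) w * sder D (z (Inl i)) w)
          + (- 1) *\<^sub>R (sder C (z (Inl i)) w * sder D (z (Inr i)) w)) ?X" by simp
    also have "\<dots> = (\<Sum>i\<in>UNIV. seval (\<lambda>w. (- 1) ^ cpar D *\<^sub>R (sder C (z (Inr i)) w * sder D (z (Inl i)) w)
          + (- 1) *\<^sub>R (sder C (z (Inl i)) w * sder D (z (Inr i)) w)) ?X)"
      by (rule seval_sum[OF X(1) U X(2)]) (intro smooth_sfun_add U sm)
    also have "\<dots> = (\<Sum>i\<in>UNIV. (- 1) ^ cpar D *\<^sub>R (Z C (Inr i) * Z D (Inl i)) + (- 1) *\<^sub>R (Z C (Inl i) * Z D (Inr i)))"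
      unfolding Z_def
      by (simp only: seval_add[OF X(1) U X(2) sm] seval_scaleR[OF X(1) U X(2) smooth_sfun_mult[OF U sz sz]]
          seval_mult[OF X(1) U X(2) sz sz])
    finally show ?thesis .
  qed
  \<comment> \<open>Moving \<open>P B D\<close> to the left of the factors \<open>Z D\<close>
    cancels every sign depending on \<open>D\<close>, so that the sum over \<open>D\<close> becomes
    a chain rule.\<close>
  have tail: "((- 1) ^ cpar D *\<^sub>R (Z C (Inr i) * Z D (Inl i)) + (- 1) *\<^sub>R (Z C (Inl i) * Z D (Inr i))) * ((- 1) ^ (cpar B * cpar D) *\<^sub>R P B D)
      = Z C (Inr i) * (P B D * Z D (Inl i)) - (- 1) ^ cpar B *\<^sub>R (Z C (Inl i) * (P B D * Z D (Inr i)))" for C D i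
  proof -
    have "Z D (Inl i) * P B D = (- 1) ^ ((0 + cpar D) * (cpar D + cpar B)) *\<^sub>R (P B D * Z D (Inl i))"
      using supercommute[OF pZ pP, of D "Inl i" B D] by simp
    moreover have "Z D (Inr i) * P B D = (- 1) ^ ((1 + cpar D) * (cpar D + cpar B)) *\<^sub>R (P B D * Z D (Inr i))"
      using supercommute[OF pZ pP, of D "Inr i" B D] by simp
    moreover have "(- 1::real) ^ cpar D * (- 1) ^ (cpar B * cpar D) * (- 1) ^ ((0 + cpar D) * (cpar D + cpar B)) = 1"
      "(- 1::real) ^ (cpar B * cpar D) * (- 1) ^ ((1 + cpar D) * (cpar D + cpar B)) = (- 1) ^ cpar B"
      by (cases B; cases D; simp)+
    moreover have "(s *\<^sub>R (a * b) + (- 1) *\<^sub>R (a' * b')) * (t *\<^sub>R p) = (s * t) *\<^sub>R (a * (b * p)) - t *\<^sub>R (a' * (b' * p))"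
      for s t and a b a' b' p :: "('n, 'l) gen grass"
      by (simp add: left_diff_distrib scaleR_diff_right mult.assoc)
    ultimately show ?thesis by (simp only: mult_scaleR_right scaleR_scaleR scaleR_one)
  qed
  have "(\<Sum>C\<in>UNIV. \<Sum>D\<in>UNIV. P A C
      * (\<Sum>i\<in>UNIV. (- 1) ^ cpar D *\<^sub>R (Z C (Inr i) * Z D (Inl i)) + (- 1) *\<^sub>R (Z C (Inl i) * Z D (Inr i)))
      * ((- 1) ^ (cpar B * cpar D) *\<^sub>R P B D))
    = (\<Sum>C\<in>UNIV. \<Sum>D\<in>UNIV. \<Sum>i\<in>UNIV. P A C * Z C (Inr i) * (P B D * Z D (Inl i))
        - (- 1) ^ cpar B *\<^sub>R (P A C * Z C (Inl i) * (P B D * Z D (Inr i))))"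
    unfolding sum_distrib_left sum_distrib_right mult.assoc tail
    by (simp add: right_diff_distrib)
  also have "\<dots> = (\<Sum>i\<in>UNIV. \<Sum>C\<in>UNIV. \<Sum>D\<in>UNIV. P A C * Z C (Inr i) * (P B D * Z D (Inl i))
        - (- 1) ^ cpar B *\<^sub>R (P A C * Z C (Inl i) * (P B D * Z D (Inr i))))"
    by (rule sum_rotate3[symmetric])
  also have "\<dots> = (\<Sum>i\<in>UNIV. (\<Sum>C\<in>UNIV. P A C * Z C (Inr i)) * (\<Sum>D\<in>UNIV. P B D * Z D (Inl i))
      - (- 1) ^ cpar B *\<^sub>R ((\<Sum>C\<in>UNIV. P A C * Z C (Inl i)) * (\<Sum>D\<in>UNIV. P B D * Z D (Inr i))))"
    unfolding sum_product scaleR_sum_right sum_subtractf ..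
  finally show ?thesis unfolding sv ch P_def[symmetric] .
qed

section \<open>Locality and linearity of the odd Laplacian\<close>

lemma Delta_cong:
  assumes "open V" "y \<in> V" "\<And>u. u \<in> V \<Longrightarrow> f u = g u"
  shows "Delta f y = Delta g y"
proof -
  have "sder (Inl i) (sder (Inr i) f) y = sder (Inl i) (sder (Inr i) g) y" for i
    by (rule sder_cong[OF assms(1,2)], rule sder_cong[OF assms(1)]) (simp_all add: assms(3))
  then show ?thesis unfolding Delta_def by simp
qed

lemma Delta_scaleR:
  fixes f :: "('n::{finite,linorder}, 'l::linorder) sfun"
  assumes "open V" "y \<in> V" "smooth_sfun V f"
  shows "Delta (\<lambda>u. c *\<^sub>R f u) y = c *\<^sub>R Delta f y"
proof -
  have "sder (Inl i) (sder (Inr i) (\<lambda>u. c *\<^sub>R f u)) y = c *\<^sub>R sder (Inl i) (sder (Inr i) f) y" for i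
  proof -
    have "sder (Inl i) (sder (Inr i) (\<lambda>u. c *\<^sub>R f u)) y = sder (Inl i) (\<lambda>u. c *\<^sub>R sder (Inr i) f u) y"
      by (rule sder_cong[OF assms(1,2)]) (rule sder_scaleR[OF _ assms(3)])
    then show ?thesis by (simp add: sder_scaleR[OF assms(2) smooth_sfun_sder[OF assms(1,3)]])
  qed
  then show ?thesis unfolding Delta_def by (simp add: scaleR_sum_right)
qed

lemma smooth_Delta:
  fixes f :: "('n::{finite,linorder}, 'l::linorder) sfun"
  shows "open V \<Longrightarrow> smooth_sfun V f \<Longrightarrow> smooth_sfun V (Delta f)"
  unfolding Delta_def by (intro smooth_sfun_sum smooth_sfun_sder)

section \<open>Transition maps between charts\<close>

lemma is_smap_transition:
  fixes c c' :: "('n::{finite,linorder}, 'l::linorder) chart"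
  assumes "c \<in> charts W" "c' \<in> charts W"
  shows "is_smap (overlap c c') (fst c \<inter> fst c') (chart_inv c')"
    and "is_smap (overlap c c') (chart_image c) (transition c c')"
proof -
  have inv': "is_smap (chart_image c') (fst c') (chart_inv c')" and z: "is_smap (fst c) (chart_image c) (snd c)"
    using chart_inverse[OF assms(2)] chart_inverse[OF assms(1)] unfolding inverse_smaps_def by blast+
  show s: "is_smap (overlap c c') (fst c \<inter> fst c') (chart_inv c')"
    by (rule is_smap_subset[OF inv']) (use overlap_eq[OF assms(2), of c] inv' in \<open>auto simp: is_smap_def\<close>)
  have o: "open (fst c)" "open (fst c')" using assms unfolding charts_def by auto
  have "is_smap (fst c \<inter> fst c') (chart_image c) (snd c)"
    by (rule is_smap_subset[OF z]) (auto simp: chart_image_def)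
  then show "is_smap (overlap c c') (chart_image c) (transition c c')"
    unfolding transition_def by (rule is_smap_compose[OF open_overlap[OF assms] open_Int[OF o] s])
qed

lemma darboux_form:
  fixes c :: "('n::{finite,linorder}, 'l::linorder) chart"
  assumes "odd_symplectic W \<Omega>" "c \<in> darboux_charts W \<Omega>" "w \<in> fst c"
  shows "\<Omega> C D w = (\<Sum>i\<in>UNIV. (- 1) ^ cpar D *\<^sub>R (sder C (snd c (Inr i)) w * sder D (snd c (Inl i)) w)
    - sder C (snd c (Inl i)) w * sder D (snd c (Inr i)) w)"
proof -
  have c: "c \<in> charts W" using assms(2) unfolding darboux_charts_def by blast
  then have o: "open (fst c)" "open (chart_image c)" "w \<in> W" using assms(3) unfolding charts_def by auto
  have inv: "is_smap (fst c) (chart_image c) (snd c)" "is_smap (chart_image c) (fst c) (chart_inv c)"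
    "\<And>A x. x \<in> fst c \<Longrightarrow> seval (chart_inv c A) (at_pt (snd c) x) = coord A x"
    using chart_inverse[OF c] unfolding inverse_smaps_def by blast+
  show ?thesis
    by (rule symplectic_form_in_darboux[OF assms(1) o(3) o(1) assms(3) inv(1) o(2) inv(2,3)])
      (use assms(2,3) in \<open>auto simp: darboux_charts_def\<close>)
qed

lemma canonical_transition:
  fixes c c' :: "('n::{finite,linorder}, 'l::linorder) chart"
  assumes \<Omega>: "odd_symplectic W \<Omega>" and c: "c \<in> darboux_charts W \<Omega>" and c': "c' \<in> darboux_charts W \<Omega>"
  shows "canonical_smap (overlap c c') (transition c c')"
proof -
  have ch: "c \<in> charts W" "c' \<in> charts W" using c c' unfolding darboux_charts_def by blast+
  let ?V = "overlap c c'" and ?U = "fst c \<inter> fst c'" and ?\<psi> = "chart_inv c'" and ?\<phi> = "transition c c'"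
  have V: "open ?V" by (rule open_overlap[OF ch])
  have o: "open (fst c)" "open (fst c')" using ch unfolding charts_def by auto
  then have U: "open ?U" by (rule open_Int)
  note \<psi> = is_smap_transition(1)[OF ch] and \<phi> = is_smap_transition(2)[OF ch]
  have z: "is_smap (fst c) (chart_image c) (snd c)" "is_smap (fst c') (chart_image c') (snd c')"
    using chart_inverse[OF ch(1)] chart_inverse[OF ch(2)] unfolding inverse_smaps_def by blast+
  have zU: "is_smap ?U (chart_image c) (snd c)" "is_smap ?U (chart_image c') (snd c')"
    by (rule is_smap_subset[OF z(1)]; auto simp: chart_image_def) (rule is_smap_subset[OF z(2)]; auto simp: chart_image_def)
  have form: "(\<Sum>i\<in>UNIV. sder A (?\<phi> (Inr i)) y * sder B (?\<phi> (Inl i)) y - (- 1) ^ cpar B *\<^sub>R (sder A (?\<phi> (Inl i)) y * sder B (?\<phi> (Inr i)) y))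
     = (\<Sum>i\<in>UNIV. (if A = Inr i then 1 else 0) * (if B = Inl i then 1 else 0)
        - (- 1) ^ cpar B *\<^sub>R ((if A = Inl i then 1 else 0) * (if B = Inr i then 1 else 0)))" if y: "y \<in> ?V" for A B y
  proof -
    let ?form = "\<lambda>z C D w. \<Sum>i\<in>UNIV. (- 1) ^ cpar D *\<^sub>R (sder C (z (Inr i)) w * sder D (z (Inl i)) w)
          - sder C (z (Inl i)) w * sder D (z (Inr i)) w"
    \<comment> \<open>Both expressions equal \<Omega> on the common domain of the charts.\<close>
    have eq: "seval (?form (snd c) C D) (at_pt ?\<psi> y) = seval (?form (snd c') C D) (at_pt ?\<psi> y)" for C D
    proof (rule seval_cong[OF U is_smap_body[OF \<psi> y]])
      fix w assume "w \<in> ?U"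
      then have w: "w \<in> fst c" "w \<in> fst c'" by auto
      show "?form (snd c) C D w = ?form (snd c') C D w"
        by (rule trans[OF darboux_form[OF \<Omega> c w(1), symmetric] darboux_form[OF \<Omega> c' w(2)]])
    qed
    \<comment> \<open>In its own coordinates the second chart is the identity, which makes its side
      of the equation constant.\<close>
    have co: "sder A (\<lambda>y. seval (snd c' F) (at_pt ?\<psi> y)) y = (if A = F then 1 else 0)" for A F
    proof -
      have "sder A (\<lambda>y. seval (snd c' F) (at_pt ?\<psi> y)) y = sder A (coord F) y"
      proof (rule sder_cong[OF V y])
        fix u assume "u \<in> ?V"
        then have "u \<in> chart_image c'" unfolding overlap_eq[OF ch(2)] by blast
        then show "seval (snd c' F) (at_pt ?\<psi> u) = coord F u"
          using chart_inverse[OF ch(2)] unfolding inverse_smaps_def by blast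
      qed
      then show ?thesis by (simp add: sder_coord)
    qed
    show ?thesis
      using pullback_form[OF V y \<psi> U zU(1), of A B] pullback_form[OF V y \<psi> U zU(2), of A B]
      unfolding eq co transition_def by simp
  qed
  show ?thesis
  proof (unfold_locales)
    show "open ?V" by (rule V)
    show "smooth_sfun ?V (?\<phi> E)" for E by (rule is_smap_smooth[OF \<phi>])
    show "has_parity (cpar E) (?\<phi> E y)" if "y \<in> ?V" for E y by (rule is_smap_parity[OF \<phi> that])
    fix i j y assume y: "y \<in> ?V"
    show "(\<Sum>b\<in>UNIV. sder (Inl i) (?\<phi> (Inl b)) y * sder (Inr j) (?\<phi> (Inr b)) y
        + sder (Inl i) (?\<phi> (Inr b)) y * sder (Inr j) (?\<phi> (Inl b)) y) = (if i = j then 1 else 0)"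
      using form[OF y, of "Inl i" "Inr j"]
      by (simp add: sum.distrib add.commute if_distrib[of "\<lambda>x. x * _"] if_distrib[of "(*) _"] cong: if_cong)
    show "(\<Sum>b\<in>UNIV. sder (Inl i) (?\<phi> (Inl b)) y * sder (Inl j) (?\<phi> (Inr b)) y)
        = (\<Sum>b\<in>UNIV. sder (Inl i) (?\<phi> (Inr b)) y * sder (Inl j) (?\<phi> (Inl b)) y)"
      using form[OF y, of "Inl i" "Inl j"] by (simp add: sum_subtractf)
    show "(\<Sum>b\<in>UNIV. sder (Inr i) (?\<phi> (Inl b)) y * sder (Inr j) (?\<phi> (Inr b)) y
        + sder (Inr i) (?\<phi> (Inr b)) y * sder (Inr j) (?\<phi> (Inl b)) y) = 0"
      using form[OF y, of "Inr i" "Inr j"] by (simp add: sum.distrib add.commute)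
  qed
qed

lemma Delta_semidensity_transition:
  fixes c c' :: "('n::{finite,linorder}, 'l::linorder) chart" and F :: "('n, 'l) sfun"
  assumes \<Omega>: "odd_symplectic W \<Omega>" and c: "c \<in> darboux_charts W \<Omega>" and c': "c' \<in> darboux_charts W \<Omega>"
    and F: "smooth_sfun (chart_image c) F" and y: "y \<in> overlap c c'"
  shows "seval (Delta F) (at_pt (transition c c') y) * gpowr (1 / 2) (Ber (super_jacobian (transition c c') y))
    = Delta (\<lambda>u. seval F (at_pt (transition c c') u) * gpowr (1 / 2) (Ber (super_jacobian (transition c c') u))) y"
proof -
  let ?V = "overlap c c'" and ?\<phi> = "transition c c'"
  interpret canonical_smap ?V ?\<phi>
    "\<lambda>i b. sder (Inl i) (?\<phi> (Inl b))" "\<lambda>i b. sder (Inl i) (?\<phi> (Inr b))"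
    "\<lambda>i b. sder (Inr i) (?\<phi> (Inl b))" "\<lambda>i b. sder (Inr i) (?\<phi> (Inr b))"
    by (rule canonical_transition[OF \<Omega> c c'])
  have ch: "c \<in> charts W" "c' \<in> charts W" using c c' unfolding darboux_charts_def by blast+
  have U: "open (chart_image c)" using ch unfolding charts_def by blast
  note \<phi> = is_smap_transition(2)[OF ch]
  define \<epsilon> where "\<epsilon> = sgn (body (r y))"
  have nz: "body (r u) \<noteq> 0" if "u \<in> ?V" for u
    using arg_cong[OF r_inverse(2)[OF that], of body] by auto
  \<comment> \<open>A neighbourhood of \<open>y\<close> on which the body of \<open>r\<close> keeps
    its sign, so that the root is a constant multiple of \<open>r\<close> there.\<close>
  define V' where "V' = ?V \<inter> (\<lambda>u. \<epsilon> * body (r u)) -` {0<..}"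
  have "continuous_on ?V (\<lambda>u. \<epsilon> * body (r u))"
    using smooth_funD[OF smooth_fun_body[OF smooth_r]]
    by (intro continuous_on_mult continuous_on_const continuous_at_imp_continuous_on ballI differentiable_imp_continuous_within)
  then have V': "open V'" "y \<in> V'" "V' \<subseteq> ?V"
    unfolding V'_def using V y nz[OF y]
    by (auto simp: \<epsilon>_def sgn_if intro!: continuous_open_preimage)
  have pow: "gpowr (1 / 2) (Ber (super_jacobian ?\<phi> u)) = \<epsilon> *\<^sub>R r u" if u: "u \<in> V'" for u
  proof -
    have uV: "u \<in> ?V" using u V' by blast
    have "sgn (body (r u)) = \<epsilon>" using u unfolding V'_def \<epsilon>_def by (auto simp: sgn_if split: if_splits)
    then show ?thesis
      unfolding Ber_eq[OF uV] gpowr_half_square[OF r_inverse(1)[OF uV] nz[OF uV]] by simp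
  qed
  have comm_r: "x * r u = r u * x" if "u \<in> ?V" for u x
    by (rule even_commute[OF r_inverse(1)[OF that], symmetric])
  have "Delta (\<lambda>u. seval F (at_pt ?\<phi> u) * gpowr (1 / 2) (Ber (super_jacobian ?\<phi> u))) y
      = Delta (\<lambda>u. \<epsilon> *\<^sub>R (r u * seval F (at_pt ?\<phi> u))) y"
  proof (rule Delta_cong[OF V'(1,2)])
    fix u assume u: "u \<in> V'"
    then have "u \<in> ?V" using V' by blast
    then show "seval F (at_pt ?\<phi> u) * gpowr (1 / 2) (Ber (super_jacobian ?\<phi> u)) = \<epsilon> *\<^sub>R (r u * seval F (at_pt ?\<phi> u))"
      by (simp add: pow[OF u] comm_r)
  qed
  also have "\<dots> = \<epsilon> *\<^sub>R (r y * seval (Delta F) (at_pt ?\<phi> y))"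
    unfolding Delta_scaleR[OF V y smooth_sfun_mult[OF V smooth_r smooth_seval[OF V \<phi> F]]]
      Delta_r_seval[OF y \<phi> U F] ..
  also have "\<dots> = seval (Delta F) (at_pt ?\<phi> y) * gpowr (1 / 2) (Ber (super_jacobian ?\<phi> y))"
    by (simp add: pow[OF V'(2)] comm_r[OF y])
  finally show ?thesis ..
qed

theorem mainTheorem1:
  fixes W :: "(real ^ 'n::{finite,linorder}) set"
    and \<Omega> :: "('n, 'l::linorder) two_form"
    and s :: "('n, 'l) chart \<Rightarrow> ('n, 'l) sfun"
  assumes "odd_symplectic W \<Omega>"
    and "semidensity_on (charts W) s"
  shows "semidensity_on (darboux_charts W \<Omega>) (\<lambda>c. Delta (s c)) \<and>
    (\<forall>c\<in>darboux_charts W \<Omega>. \<forall>c'\<in>darboux_charts W \<Omega>. \<forall>y\<in>overlap c c'.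
       seval (Delta (s c)) (at_pt (transition c c') y)
         * gpowr (1 / 2) (Ber (super_jacobian (transition c c') y))
       = Delta (\<lambda>u. seval (s c) (at_pt (transition c c') u)
                    * gpowr (1 / 2) (Ber (super_jacobian (transition c c') u))) y)"
proof -
  have ch: "c \<in> charts W" if "c \<in> darboux_charts W \<Omega>" for c
    using that unfolding darboux_charts_def by blast
  have sm: "smooth_sfun (chart_image c) (s c)" if "c \<in> darboux_charts W \<Omega>" for c
    using assms(2) ch[OF that] unfolding density_on_def by blast
  have tr: "seval (Delta (s c)) (at_pt (transition c c') y)
         * gpowr (1 / 2) (Ber (super_jacobian (transition c c') y))
       = Delta (\<lambda>u. seval (s c) (at_pt (transition c c') u)
                    * gpowr (1 / 2) (Ber (super_jacobian (transition c c') u))) y"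
    if "c \<in> darboux_charts W \<Omega>" "c' \<in> darboux_charts W \<Omega>" "y \<in> overlap c c'" for c c' y
    by (rule Delta_semidensity_transition[OF assms(1) that(1,2) sm[OF that(1)] that(3)])
  have "semidensity_on (darboux_charts W \<Omega>) (\<lambda>c. Delta (s c))"
    unfolding density_on_def
  proof (intro conjI ballI)
    fix c assume c: "c \<in> darboux_charts W \<Omega>"
    have "open (chart_image c)" using ch[OF c] unfolding charts_def by blast
    then show "smooth_sfun (chart_image c) (Delta (s c))" by (rule smooth_Delta) (rule sm[OF c])
  next
    fix c c' y
    assume c: "c \<in> darboux_charts W \<Omega>" "c' \<in> darboux_charts W \<Omega>" and y: "y \<in> overlap c c'"
    \<comment> \<open>The representative in \<open>c'\<close> is the transformed one from
      \<open>c\<close> on the whole open overlap, so it may be replaced before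
      differentiating.\<close>
    have "Delta (s c') y = Delta (\<lambda>u. seval (s c) (at_pt (transition c c') u)
        * gpowr (1 / 2) (Ber (super_jacobian (transition c c') u))) y"
      by (rule Delta_cong[OF open_overlap[OF ch[OF c(1)] ch[OF c(2)]] y])
        (use assms(2) ch[OF c(1)] ch[OF c(2)] in \<open>auto simp: density_on_def\<close>)
    then show "Delta (s c') y = seval (Delta (s c)) (at_pt (transition c c') y)
        * gpowr (1 / 2) (Ber (super_jacobian (transition c c') y))"
      using tr[OF c y] by simp
  qed
  with tr show ?thesis by blast
qed

end
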